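(* For every word $w\in\mathcal D_n^*$ there is a unique orthogonal tableau $P^D(w)$ of type $D$ with $\mathrm w(P^D(w))\sim w$, and for any two words $w_1,w_2\in\mathcal D_n^*$: $$w_1\sim w_2\iff w_1\equiv^D w_2\iff P^D(w_1)=P^D(w_2).$$
   Context: Fix $n\ge2$. $\mathcal D_n=\{1\prec\cdots\prec n-1\prec n,\bar n\prec\overline{n-1}\prec\cdots\prec\bar1\}$ with $n,\bar n$ incomparable; $\bar{\bar k}=k$; $x$ unbarred iff $x\preceq n$. Vector crystal: arrows $i\xrightarrow{i}i+1$, $\overline{i+1}\xrightarrow{i}\bar i$ ($1\le i<n$), $n-1\xrightarrow{n}\bar n$, $n\xrightarrow{n}\overline{n-1}$ ($a\xrightarrow{i}b$ means $\tilde f_ia=b$). Tensor rule: $\tilde f_i(u\otimes v)=\tilde f_iu\otimes v$ if $\varphi_i(u)>\varepsilon_i(v)$, else $u\otimes\tilde f_iv$; $\tilde e_i(u\otimes v)=u\otimes\tilde e_iv$ if $\varphi_i(u)<\varepsilon_i(v)$, else $\tilde e_iu\otimes v$. $G_n^D$ is the crystal on $\mathcal D_n^*$ identifying $u_1\cdots u_l$ with $u_1\otimes\cdots\otimes u_l$. $w_1\sim w_2$ means: the components of $w_1,w_2$ are isomorphic as colored graphs and there are $i_1,\dots,i_r$ with $w_j=\tilde f_{i_1}\cdots\tilde f_{i_r}w_j^0$ ($j=1,2$), $w_j^0$ the highest weight vertex of the component of $w_j$. Columns of type $D$: sequences $x_1,\dots,x_l$ of letters of $\mathcal D_n$ with $x_{i+1}\not\preceq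 x_i$; reading $x_1\cdots x_l$. $N(z)$ ($z\preceq n$) is the number of letters $x$ of $C$ with $x\preceq z$ or $x\succeq\bar z$. Admissible: $h(C)\le n$ and for every $z=x_p$, $\bar z=x_q$ with $z\preceq n$, $|q-p|\ge h(C)-z+1$. Tabloid $T=C_1\cdots C_r$ with $h(C_1)\ge\cdots\ge h(C_r)$ (shape $Y$), reading $\mathrm w(C_r)\cdots\mathrm w(C_1)$; $T_Y$ fills each column of height $k$ with $1,\dots,k$, and $T_Y^-$ is $T_Y$ with each column of height $n$ filled with $1,\dots,n-1,\bar n$; $T$ is an orthogonal tableau of type $D$ if $\mathrm w(T)$ lies in the component of $G_n^D$ containing $\mathrm w(T_Y)$ or that containing $\mathrm w(T_Y^-)$. $\equiv^D$ is the smallest congruence on $\mathcal D_n^*$ containing: (R1) $yzx\equiv yxz$ for $x\preceq y\prec z$, $x\ne\bar z$, and $xzy\equiv zxy$ for $x\prec y\preceq z$, $x\neq\bar z$; (R2) for $1\prec x\prec n$ and $x\preceq y\preceq\bar x$: $y\,\overline{x-1}\,(x-1)\equiv y\,x\,\bar x$ and $x\,\bar x\,y\equiv\overline{x-1}\,(x-1)\,y$; (R3) for $x\preceq n-1$: $\bar n\,\bar x\,n\equiv\bar x\,\bar n\,n$, $n\,\bar x\,\bar n\equiv\bar x\,n\,\bar n$, $\bar n\,n\,x\equiv\bar n\,x\,n$, $n\,\bar n\,x\equiv n\,x\,\bar n$; (R4) $n\bar n\bar n\equiv\overline{n-1}\,(n-1)\,\bar n$, $\bar nnn\equiv\overline{n-1}\,(n-1)\,n$,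 $\bar n\,\overline{n-1}\,(n-1)\equiv\bar n\bar nn$, $n\,\overline{n-1}\,(n-1)\equiv nn\bar n$; (R5) if $w=\mathrm w(C)$ is the reading of a non-admissible column $C$ of type $D$ all of whose proper factors are admissible column readings, let $z$ be the lowest unbarred letter with $z,\bar z\in C$ and $N(z)>z$; let $\tilde w$ be $w$ with $z$ and $\bar z$ erased if $z\prec n$, and $w$ with a pair of consecutive letters $n,\bar n$ (in either order) erased if $z=n$; then $w\equiv\tilde w$. *)

theory Defs
  imports Main
begin

text \<open>Letters of D_n are encoded as integers: k (1 \<le> k \<le> n) is the unbarred letter k,
  and -k is the barred letter bar k. Colours are integers i with 1 \<le> i \<le> n.\<close>

definition letter :: "int \<Rightarrow> int \<Rightarrow> bool" where
  "letter n x \<longleftrightarrow> x \<noteq> 0 \<and> -n \<le> x \<and> x \<le> n"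

definition lword :: "int \<Rightarrow> int list \<Rightarrow> bool" where
  "lword n w \<longleftrightarrow> (\<forall>x\<in>set w. letter n x)"

definition rankD :: "int \<Rightarrow> int \<Rightarrow> int" where
  "rankD n x = (if x > 0 then x else 2*n + 1 + x)"

text \<open>The partial order on D_n: the chain 1 < ... < n, bar n < ... < bar 1,
  with n and bar n incomparable.\<close>
definition leqD :: "int \<Rightarrow> int \<Rightarrow> int \<Rightarrow> bool" where
  "leqD n x y \<longleftrightarrow> x = y \<or> (rankD n x < rankD n y \<and> \<not> (x = n \<and> y = -n))"

definition lessD :: "int \<Rightarrow> int \<Rightarrow> int \<Rightarrow> bool" where
  "lessD n x y \<longleftrightarrow> leqD n x y \<and> x \<noteq> y"

text \<open>Vector crystal: Kashiwara operators on letters.\<close>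
definition fL :: "int \<Rightarrow> int \<Rightarrow> int \<Rightarrow> int option" where
  "fL n i a =
    (if 1 \<le> i \<and> i < n then
       (if a = i then Some (i+1) else if a = -(i+1) then Some (-i) else None)
     else if i = n then
       (if a = n - 1 then Some (-n) else if a = n then Some (-(n-1)) else None)
     else None)"

definition eL :: "int \<Rightarrow> int \<Rightarrow> int \<Rightarrow> int option" where
  "eL n i b =
    (if 1 \<le> i \<and> i < n then
       (if b = i+1 then Some i else if b = -i then Some (-(i+1)) else None)
     else if i = n then
       (if b = -n then Some (n-1) else if b = -(n-1) then Some n else None)
     else None)"

text \<open>String length: maximal number of times a partial operator can be applied
  (used for phi_i with g = f_i and epsilon_i with g = e_i).\<close>
definition str :: "('a \<Rightarrow> 'a option) \<Rightarrow> 'a \<Rightarrow> nat" where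
  "str g x = (GREATEST m. ((\<lambda>ox. Option.bind ox g) ^^ m) (Some x) \<noteq> None)"

text \<open>Crystal structure (f_i, e_i) on words of length k, the word u_1 ... u_l being
  identified with u_1 \<otimes> (u_2 \<otimes> ( ... \<otimes> u_l)), using the tensor rule of the paper.\<close>
fun crys :: "int \<Rightarrow> nat \<Rightarrow>
    (int \<Rightarrow> int list \<Rightarrow> int list option) \<times> (int \<Rightarrow> int list \<Rightarrow> int list option)" where
  "crys n 0 = ((\<lambda>i w. None), (\<lambda>i w. None))"
| "crys n (Suc k) =
    (let F = fst (crys n k); E = snd (crys n k) in
     ((\<lambda>i w. case w of [] \<Rightarrow> None
         | x # v \<Rightarrow> (if str (fL n i) x > str (E i) v
                     then map_option (\<lambda>y. y # v) (fL n i x)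
                     else map_option (\<lambda>v'. x # v') (F i v))),
      (\<lambda>i w. case w of [] \<Rightarrow> None
         | x # v \<Rightarrow> (if str (fL n i) x < str (E i) v
                     then map_option (\<lambda>v'. x # v') (E i v)
                     else map_option (\<lambda>y. y # v) (eL n i x)))))"

definition fD :: "int \<Rightarrow> int \<Rightarrow> int list \<Rightarrow> int list option" where
  "fD n i w = fst (crys n (length w)) i w"

definition eD :: "int \<Rightarrow> int \<Rightarrow> int list \<Rightarrow> int list option" where
  "eD n i w = snd (crys n (length w)) i w"

definition edgeD :: "int \<Rightarrow> int list \<Rightarrow> int list \<Rightarrow> bool" where
  "edgeD n u v \<longleftrightarrow> (\<exists>i. 1 \<le> i \<and> i \<le> n \<and> fD n i u = Some v)"

definition compD :: "int \<Rightarrow> int list \<Rightarrow> int list set" where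
  "compD n w = {u. (\<lambda>a b. edgeD n a b \<or> edgeD n b a)\<^sup>*\<^sup>* w u}"

definition hwD :: "int \<Rightarrow> int list \<Rightarrow> int list" where
  "hwD n w = (THE u. u \<in> compD n w \<and> (\<forall>i. 1 \<le> i \<and> i \<le> n \<longrightarrow> eD n i u = None))"

definition comp_iso :: "int \<Rightarrow> int list \<Rightarrow> int list \<Rightarrow> bool" where
  "comp_iso n w1 w2 \<longleftrightarrow> (\<exists>g. bij_betw g (compD n w1) (compD n w2) \<and>
     (\<forall>u\<in>compD n w1. \<forall>v\<in>compD n w1. \<forall>i. 1 \<le> i \<and> i \<le> n \<longrightarrow>
        (fD n i u = Some v \<longleftrightarrow> fD n i (g u) = Some (g v))))"

definition fpath :: "int \<Rightarrow> int list \<Rightarrow> int list \<Rightarrow> int list option" where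
  "fpath n is w0 = foldr (\<lambda>i ox. Option.bind ox (fD n i)) is (Some w0)"

definition simD :: "int \<Rightarrow> int list \<Rightarrow> int list \<Rightarrow> bool" where
  "simD n w1 w2 \<longleftrightarrow> comp_iso n w1 w2 \<and>
     (\<exists>is. fpath n is (hwD n w1) = Some w1 \<and> fpath n is (hwD n w2) = Some w2)"

definition is_col :: "int \<Rightarrow> int list \<Rightarrow> bool" where
  "is_col n C \<longleftrightarrow> lword n C \<and> (\<forall>k. k + 1 < length C \<longrightarrow> \<not> leqD n (C ! (k+1)) (C ! k))"

definition adm_col :: "int \<Rightarrow> int list \<Rightarrow> bool" where
  "adm_col n C \<longleftrightarrow> is_col n C \<and> int (length C) \<le> n \<and>
     (\<forall>p q. p < length C \<and> q < length C \<and> 1 \<le> C ! p \<and> C ! p \<le> n \<and> C ! q = - (C ! p)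
        \<longrightarrow> \<bar>int q - int p\<bar> \<ge> int (length C) - C ! p + 1)"

definition NN :: "int \<Rightarrow> int list \<Rightarrow> int \<Rightarrow> int" where
  "NN n C z = int (length (filter (\<lambda>x. leqD n x z \<or> leqD n (-z) x) C))"

text \<open>A tabloid is a list of (nonempty) columns C_1 ... C_r of weakly decreasing heights;
  heights are at most n so that T_Y is a filling by letters of D_n.\<close>
definition tabloid :: "int \<Rightarrow> int list list \<Rightarrow> bool" where
  "tabloid n T \<longleftrightarrow> (\<forall>C\<in>set T. is_col n C \<and> C \<noteq> [] \<and> int (length C) \<le> n) \<and>
     sorted_wrt (\<lambda>C D. length D \<le> length C) T"

definition readingT :: "int list list \<Rightarrow> int list" where
  "readingT T = concat (rev T)"

definition TY :: "int list list \<Rightarrow> int list list" where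
  "TY T = map (\<lambda>C. [1..int (length C)]) T"

definition TYm :: "int \<Rightarrow> int list list \<Rightarrow> int list list" where
  "TYm n T = map (\<lambda>C. if int (length C) = n then [1..n-1] @ [-n] else [1..int (length C)]) T"

definition orth :: "int \<Rightarrow> int list list \<Rightarrow> bool" where
  "orth n T \<longleftrightarrow> tabloid n T \<and>
     (readingT T \<in> compD n (readingT (TY T)) \<or> readingT T \<in> compD n (readingT (TYm n T)))"

inductive baseD :: "int \<Rightarrow> int list \<Rightarrow> int list \<Rightarrow> bool" for n :: int where
  R1a: "\<lbrakk>letter n x; letter n y; letter n z; leqD n x y; lessD n y z; x \<noteq> -z\<rbrakk>
        \<Longrightarrow> baseD n [y,z,x] [y,x,z]"
| R1b: "\<lbrakk>letter n x; letter n y; letter n z; lessD n x y; leqD n y z; x \<noteq> -z\<rbrakk>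
        \<Longrightarrow> baseD n [x,z,y] [z,x,y]"
| R2a: "\<lbrakk>letter n x; letter n y; lessD n 1 x; lessD n x n; leqD n x y; leqD n y (-x)\<rbrakk>
        \<Longrightarrow> baseD n [y, -(x-1), x-1] [y, x, -x]"
| R2b: "\<lbrakk>letter n x; letter n y; lessD n 1 x; lessD n x n; leqD n x y; leqD n y (-x)\<rbrakk>
        \<Longrightarrow> baseD n [x, -x, y] [-(x-1), x-1, y]"
| R3a: "\<lbrakk>letter n x; leqD n x (n-1)\<rbrakk> \<Longrightarrow> baseD n [-n, -x, n] [-x, -n, n]"
| R3b: "\<lbrakk>letter n x; leqD n x (n-1)\<rbrakk> \<Longrightarrow> baseD n [n, -x, -n] [-x, n, -n]"
| R3c: "\<lbrakk>letter n x; leqD n x (n-1)\<rbrakk> \<Longrightarrow> baseD n [-n, n, x] [-n, x, n]"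
| R3d: "\<lbrakk>letter n x; leqD n x (n-1)\<rbrakk> \<Longrightarrow> baseD n [n, -n, x] [n, x, -n]"
| R4a: "baseD n [n, -n, -n] [-(n-1), n-1, -n]"
| R4b: "baseD n [-n, n, n] [-(n-1), n-1, n]"
| R4c: "baseD n [-n, -(n-1), n-1] [-n, -n, n]"
| R4d: "baseD n [n, -(n-1), n-1] [n, n, -n]"
| R5a: "\<lbrakk>is_col n w; \<not> adm_col n w;
         \<forall>a u b. w = a @ u @ b \<and> u \<noteq> w \<longrightarrow> adm_col n u;
         1 \<le> z; z \<le> n; z \<in> set w; -z \<in> set w; NN n w z > z;
         \<forall>z'. 1 \<le> z' \<and> z' \<le> n \<and> z' \<in> set w \<and> -z' \<in> set w \<and> NN n w z' > z' \<longrightarrow> z \<le> z';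
         z < n; w = a @ [z] @ b @ [-z] @ c \<or> w = a @ [-z] @ b @ [z] @ c\<rbrakk>
        \<Longrightarrow> baseD n w (a @ b @ c)"
| R5b: "\<lbrakk>is_col n w; \<not> adm_col n w;
         \<forall>a u b. w = a @ u @ b \<and> u \<noteq> w \<longrightarrow> adm_col n u;
         n \<in> set w; -n \<in> set w; NN n w n > n;
         \<forall>z'. 1 \<le> z' \<and> z' \<le> n \<and> z' \<in> set w \<and> -z' \<in> set w \<and> NN n w z' > z' \<longrightarrow> n \<le> z';
         w = a @ [n, -n] @ b \<or> w = a @ [-n, n] @ b\<rbrakk>
        \<Longrightarrow> baseD n w (a @ b)"

definition stepD :: "int \<Rightarrow> int list \<Rightarrow> int list \<Rightarrow> bool" where
  "stepD n u v \<longleftrightarrow> (\<exists>a b p q. u = a @ p @ b \<and> v = a @ q @ b \<and> lword n a \<and> lword n b \<and>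
                         (baseD n p q \<or> baseD n q p))"

definition congD :: "int \<Rightarrow> int list \<Rightarrow> int list \<Rightarrow> bool" where
  "congD n = (stepD n)\<^sup>*\<^sup>*"

definition PD :: "int \<Rightarrow> int list \<Rightarrow> int list list" where
  "PD n w = (THE T. orth n T \<and> simD n (readingT T) w)"

end

(*
Write u == v for the congruence.  Two facts drive the proof.

(1) Crystal operators respect ==: if u == v then eps_i, phi_i agree and f_i u == f_i v, e_i u == e_i v.
It suffices to treat f_i with i < n on the two sides of each relation, because the relations are
stable under exchanging n and bar n (which exchanges the colours n-1 and n) and under reversing and
barring a word (which exchanges f_i and e_i).  R1-R4 form a finite case analysis.  For R5 put
N_k(w) = number of letters with |x| <= k; a column is admissible iff N_k <= k for all k, and the
left-hand sides of R5 are the columns with max_k (N_k - k) = 1, the erased letter being the first k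
where the maximum is attained.  A step f_i changes only N_i.

(2) Every highest weight word is == the reading of some T_Y or T_Y^-.  Only R1 (which makes the
columns 1...k commute) and the instance 1...k bar k == 1...k-1 of R5 are needed.

No representation theory or local confluence argument is used to see that a component has only one
highest weight vertex: if u1, u2 are two of them, then transporting a path from u1 to u2 along (1)
and (2) gives a word of the weight of u2 in the component of T_Y with the weight of u1, so the two
weights dominate each other in their first n-1 partial sums.  Since prefixes of highest weight words
are of highest weight, induction on the length leaves the words v n and v bar n, which are separated
by length and by a parity invariant of columns of height n.

Consequently congruent words in one component are equal, which turns == into an isomorphism of
components, and the classes of == are parametrised by the elements of the components of T_Y, T_Y^-.
*)
theory Submission imports Defs begin


section \<open>Crystal operators on words\<close>

text \<open>Weights are compared only up to the partial sum n-1 because the families T_Y and T_Y^-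
  differ in the n-th coordinate of the weight, whose sign is reversed by exchanging n and bar n.
  This is why n and bar n remain undecided as last letters. If the n-th coordinate of the prefix v
  is not zero, one of the two words is congruent to a canonical word too short to carry the weight
  of the other. If it is zero, both canonical words have the same length, and only an invariant
  sensitive to the exchange can separate them.

  The passage from ~ back to the congruence rests on the numbers phi_i. An isomorphism of components
  preserves them, and at a highest weight word they determine how many columns of each height occur.
  They also tell T_Y from T_Y^-, except when no column has height n, and then the two
  coincide.\<close>

lemma str_eqI:
  assumes P: "P x"
    and None: "\<And>y. P y \<Longrightarrow> g y = None \<longleftrightarrow> lev y = 0"
    and Some: "\<And>y z. P y \<Longrightarrow> g y = Some z \<Longrightarrow> P z \<and> lev y = Suc (lev z)"
  shows "str g x = lev x"
proof -
  have shift: "((\<lambda>ox. Option.bind ox g) ^^ m) (Option.bind (Some y) g)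
      = ((\<lambda>ox. Option.bind ox g) ^^ Suc m) (Some y)" for m y
    by (simp del: funpow.simps add: funpow_Suc_right)
  have none: "((\<lambda>ox. Option.bind ox g) ^^ m) None = None" for m
    by (induction m) auto
  \<comment> \<open>The exponents for which the iterate is defined form an initial segment, so the
    maximum taken by \<open>GREATEST\<close> in \<open>str\<close> exists.\<close>
  have "P y \<Longrightarrow> ((\<lambda>ox. Option.bind ox g) ^^ m) (Some y) \<noteq> None \<longleftrightarrow> m \<le> lev y" for m y
  proof (induction m arbitrary: y)
    case (Suc m)
    show ?case
    proof (cases "g y")
      case None
      then show ?thesis using shift[of m y] none[of m] assms(2)[OF Suc.prems] by auto
    next
      case (Some z)
      then show ?thesis using shift[of m y] assms(3)[OF Suc.prems Some] Suc.IH[of z] by auto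
    qed
  qed simp
  then have "((\<lambda>ox. Option.bind ox g) ^^ m) (Some x) \<noteq> None \<longleftrightarrow> m \<le> lev x" for m
    using P by blast
  then show ?thesis
    unfolding str_def by (intro Greatest_equality) auto
qed

text \<open>No letter admits two successive arrows of one colour (the vector crystal is minuscule),
  so the string lengths of letters are 0 or 1.\<close>

definition phL :: "int \<Rightarrow> int \<Rightarrow> int \<Rightarrow> nat" where
  "phL n i x = (if fL n i x = None then 0 else 1)"

definition epL :: "int \<Rightarrow> int \<Rightarrow> int \<Rightarrow> nat" where
  "epL n i x = (if eL n i x = None then 0 else 1)"

text \<open>The usual formula eps(x) + max(0, eps(v) - phi(x)) for a tensor product; the truncated
  subtraction on \<open>nat\<close> supplies the maximum.\<close>

fun eps :: "int \<Rightarrow> int \<Rightarrow> int list \<Rightarrow> nat" where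
  "eps n i [] = 0"
| "eps n i (x # v) = epL n i x + (eps n i v - phL n i x)"

fun phi :: "int \<Rightarrow> int \<Rightarrow> int list \<Rightarrow> nat" where
  "phi n i [] = 0"
| "phi n i (x # v) = phi n i v + (phL n i x - eps n i v)"

fun fw :: "int \<Rightarrow> int \<Rightarrow> int list \<Rightarrow> int list option" where
  "fw n i [] = None"
| "fw n i (x # v) = (if phL n i x > eps n i v then map_option (\<lambda>y. y # v) (fL n i x)
     else map_option (\<lambda>v'. x # v') (fw n i v))"

fun ew :: "int \<Rightarrow> int \<Rightarrow> int list \<Rightarrow> int list option" where
  "ew n i [] = None"
| "ew n i (x # v) = (if phL n i x < eps n i v then map_option (\<lambda>v'. x # v') (ew n i v)
     else map_option (\<lambda>y. y # v) (eL n i x))"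

lemma fw_length: "fw n i w = Some w' \<Longrightarrow> length w' = length w"
  by (induction w arbitrary: w') (auto split: if_splits)

lemma ew_length: "ew n i w = Some w' \<Longrightarrow> length w' = length w"
  by (induction w arbitrary: w') (auto split: if_splits)

locale D_crystal =
  fixes n :: int
  assumes n2: "n \<ge> 2"
begin

lemma fL_iff_eL: "fL n i x = Some y \<longleftrightarrow> eL n i y = Some x"
  using n2 by (auto simp: fL_def eL_def)

lemma minuscule: "phL n i x = 0 \<or> epL n i x = 0"
  using n2 by (auto simp: phL_def epL_def fL_def eL_def)

lemma fL_SomeD: "fL n i x = Some y \<Longrightarrow> phL n i x = 1 \<and> epL n i x = 0 \<and> phL n i y = 0 \<and> epL n i y = 1"
  using minuscule[of i x] minuscule[of i y] fL_iff_eL[of i x y]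
  by (auto simp: phL_def epL_def split: if_splits)

lemma phL_le1: "phL n i x \<le> 1" and epL_le1: "epL n i x \<le> 1"
  by (auto simp: phL_def epL_def)

text \<open>The inverse law and the change of the string lengths need each other: e chooses the
  factor on which f has acted because f has raised \<open>eps\<close> of that factor.\<close>

lemma fw_SomeD: "fw n i w = Some w' \<Longrightarrow>
    ew n i w' = Some w \<and> eps n i w' = Suc (eps n i w) \<and> phi n i w = Suc (phi n i w')"
proof (induction w arbitrary: w')
  case (Cons x v)
  show ?case
  proof (cases "phL n i x > eps n i v")
    case True
    then obtain y where y: "fL n i x = Some y" "w' = y # v" using Cons.prems by auto
    then show ?thesis
      using fL_SomeD[OF y(1)] True fL_iff_eL[of i x y] by auto
  next
    case False
    then obtain v' where v': "fw n i v = Some v'" "w' = x # v'" using Cons.prems by auto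
    then show ?thesis using Cons.IH[OF v'(1)] False by auto
  qed
qed simp

lemma ew_SomeD: "ew n i w = Some w' \<Longrightarrow> fw n i w' = Some w"
proof (induction w arbitrary: w')
  case (Cons x v)
  show ?case
  proof (cases "phL n i x < eps n i v")
    case True
    then obtain v' where v': "ew n i v = Some v'" "w' = x # v'" using Cons.prems by auto
    then show ?thesis using Cons.IH[OF v'(1)] fw_SomeD[of i v' v] True by auto
  next
    case False
    then obtain y where y: "eL n i x = Some y" "w' = y # v" using Cons.prems by auto
    then have "fL n i y = Some x" by (simp add: fL_iff_eL)
    then show ?thesis using fL_SomeD[of i y x] False y by auto
  qed
qed simp

lemma fw_iff_ew: "fw n i w = Some w' \<longleftrightarrow> ew n i w' = Some w"
  using fw_SomeD ew_SomeD by blast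

lemma fw_None_iff: "fw n i w = None \<longleftrightarrow> phi n i w = 0"
proof (induction w)
  case (Cons x v)
  then show ?case using phL_le1[of i x] by (auto simp: phL_def)
qed simp

lemma ew_None_iff: "ew n i w = None \<longleftrightarrow> eps n i w = 0"
proof (induction w)
  case (Cons x v)
  then show ?case using minuscule[of i x] by (auto simp: epL_def)
qed simp

lemma str_fL: "str (fL n i) x = phL n i x"
proof (rule str_eqI[where P="\<lambda>_. True"])
  show "True \<and> phL n i y = Suc (phL n i z)" if "fL n i y = Some z" for y z
    using fL_SomeD[OF that] by simp
qed (simp_all add: phL_def)

lemma crys_eq:
  "length w = k \<Longrightarrow> fst (crys n k) i w = fw n i w \<and> snd (crys n k) i w = ew n i w"
proof (induction k arbitrary: w)
  case (Suc k)
  then obtain x v where w: "w = x # v" and v: "length v = k" by (cases w) auto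
  have "str (snd (crys n k) i) v = eps n i v"
  \<comment> \<open>\<open>crys n k\<close> describes the operators on words of length k only, so
    the levels are compared on these words; \<open>ew_length\<close> keeps the iteration among
    them.\<close>
  proof (rule str_eqI[where P="\<lambda>u. length u = k"])
    show "length z = k \<and> eps n i y = Suc (eps n i z)"
      if "length y = k" "snd (crys n k) i y = Some z" for y z
      using Suc.IH[OF that(1)] that fw_SomeD[OF ew_SomeD, of i y z] ew_length[of n i y z] by simp
  qed (use Suc.IH v ew_None_iff in auto)
  then show ?case using Suc.IH[OF v] by (simp add: w str_fL Let_def)
qed simp

lemma fD_eq: "fD n i w = fw n i w" and eD_eq: "eD n i w = ew n i w"
  using crys_eq[of w "length w" i] by (auto simp: fD_def eD_def)

text \<open>Associativity of the tensor rule in numerical form: a word cut at any place behaves like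
  a product of two factors, although the recursion splits off one letter.\<close>

lemma eps_append: "eps n i (u @ v) = eps n i u + (eps n i v - phi n i u)"
  and phi_append: "phi n i (u @ v) = phi n i v + (phi n i u - eps n i v)"
proof (induction u)
  case (Cons x u)
  { case 1 show ?case using Cons phL_le1[of i x] by auto }
  { case 2 show ?case using Cons phL_le1[of i x] by auto }
qed auto

lemma fw_append: "fw n i (u @ v) = (if phi n i u > eps n i v then map_option (\<lambda>u'. u' @ v) (fw n i u)
     else map_option (\<lambda>v'. u @ v') (fw n i v))"
proof (induction u)
  case (Cons x u)
  then show ?case
    by (auto simp: eps_append option.map_comp comp_def)
qed (cases "fw n i v"; simp)

lemma ew_append: "ew n i (u @ v) = (if phi n i u < eps n i v then map_option (\<lambda>v'. u @ v') (ew n i v)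
     else map_option (\<lambda>u'. u' @ v) (ew n i u))"
proof (induction u)
  case Nil
  show ?case using ew_None_iff[of i v] by (cases "ew n i v") auto
next
  case (Cons x u)
  then show ?case
    by (auto simp: eps_append option.map_comp comp_def ew_None_iff)
qed

section \<open>The two symmetries\<close>

text \<open>The passage to the dual crystal, in which both the arrows and the order of the tensor
  factors are reversed.\<close>

definition dual :: "int list \<Rightarrow> int list" where
  "dual w = rev (map uminus w)"

lemma dual_simps [simp]: "dual [] = []" "dual (x # w) = dual w @ [-x]" "dual (u @ v) = dual v @ dual u"
    "dual (dual w) = w" "length (dual w) = length w"
  by (simp_all add: dual_def rev_map comp_def)

lemma fL_uminus: "fL n i (-x) = map_option uminus (eL n i x)"
  and eL_uminus: "eL n i (-x) = map_option uminus (fL n i x)"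
  using n2 by (auto simp: fL_def eL_def)

lemma phL_uminus: "phL n i (-x) = epL n i x" and epL_uminus: "epL n i (-x) = phL n i x"
  by (auto simp: phL_def epL_def fL_uminus eL_uminus)

lemma eps_dual: "eps n i (dual w) = phi n i w" and phi_dual: "phi n i (dual w) = eps n i w"
proof (induction w)
  case (Cons x w)
  { case 1 show ?case using Cons by (auto simp: eps_append phL_uminus epL_uminus) }
  { case 2 show ?case using Cons by (auto simp: phi_append phL_uminus epL_uminus) }
qed auto

lemma fw_dual: "fw n i (dual w) = map_option dual (ew n i w)"
proof (induction w)
  case (Cons x w)
  have "eL n i x = None" if "epL n i x = 0" using that by (simp add: epL_def split: if_splits)
  with Cons show ?case
    by (auto simp: fw_append phL_uminus epL_uminus fL_uminus phi_dual option.map_comp comp_def)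
qed simp

lemma ew_eq_dual: "ew n i w = map_option dual (fw n i (dual w))"
  by (simp add: fw_dual option.map_comp comp_def option.map_ident)

text \<open>Together with \<open>flip_colour\<close> this realises the automorphism of the Dynkin
  diagram of type D that exchanges its two end nodes n-1 and n.\<close>

definition flip :: "int \<Rightarrow> int" where
  "flip x = (if x = n then -n else if x = -n then n else x)"

definition flip_colour :: "int \<Rightarrow> int" where
  "flip_colour i = (if i = n then n - 1 else if i = n - 1 then n else i)"

lemma flip_flip [simp]: "flip (flip x) = x" and flip_colour_flip_colour [simp]: "flip_colour (flip_colour i) = i"
  using n2 by (auto simp: flip_def flip_colour_def)

lemma map_flip_flip [simp]: "map flip (map flip w) = w"
  by (simp add: comp_def)

lemma fL_flip: "fL n i (flip x) = map_option flip (fL n (flip_colour i) x)"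
  and eL_flip: "eL n i (flip x) = map_option flip (eL n (flip_colour i) x)"
  using n2 by (auto simp: fL_def eL_def flip_def flip_colour_def)

lemma phL_flip: "phL n i (flip x) = phL n (flip_colour i) x" and epL_flip: "epL n i (flip x) = epL n (flip_colour i) x"
  by (auto simp: phL_def epL_def fL_flip eL_flip)

lemma eps_flip: "eps n i (map flip w) = eps n (flip_colour i) w"
  by (induction w) (auto simp: phL_flip epL_flip)

lemma phi_flip: "phi n i (map flip w) = phi n (flip_colour i) w"
  by (induction w) (auto simp: phL_flip eps_flip)

lemma fw_flip: "fw n i (map flip w) = map_option (map flip) (fw n (flip_colour i) w)"
  by (induction w) (auto simp: phL_flip eps_flip fL_flip option.map_comp comp_def)

lemma fw_eq_flip: "fw n i w = map_option (map flip) (fw n (flip_colour i) (map flip w))"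
  by (simp add: fw_flip option.map_comp comp_def option.map_ident)

end


section \<open>The relations R1 to R4\<close>

text \<open>The order of the letters is encoded by one integer: x \<prec> y iff pos x < pos y, and pos x = n exactly
  for the incomparable letters n and bar n.\<close>
definition pos :: "int \<Rightarrow> int \<Rightarrow> int" where
  "pos n x = (if x > 0 then x else 2 * n + x)"

text \<open>R1 to R4, with s standing for n or bar n in the last four clauses (the letter a there), so that
  the exchange of n and bar n is visible.\<close>
fun base3 :: "int \<Rightarrow> int list \<Rightarrow> int list \<Rightarrow> bool" where
  "base3 n [a,b,c] [d,e,f] \<longleftrightarrow> letter n a \<and> letter n b \<and> letter n c \<and> letter n d \<and> letter n e \<and> letter n f \<and>
    (d = a \<and> e = c \<and> f = b \<and> (c = a \<or> pos n c < pos n a) \<and> pos n a < pos n b \<and> pos n c + pos n b \<noteq> 2*n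
   \<or> d = b \<and> e = a \<and> f = c \<and> pos n a < pos n c \<and> (c = b \<or> pos n c < pos n b) \<and> pos n a + pos n b \<noteq> 2*n
   \<or> d = a \<and> b = -(e-1) \<and> c = e-1 \<and> f = -e \<and> 1 < e \<and> e < n \<and> e \<le> pos n a \<and> pos n a \<le> 2*n-e
   \<or> b = -a \<and> d = -(a-1) \<and> e = a-1 \<and> f = c \<and> 1 < a \<and> a < n \<and> a \<le> pos n c \<and> pos n c \<le> 2*n-a
   \<or> pos n a = n \<and> n < pos n b \<and> c = -a \<and> d = b \<and> e = a \<and> f = -a
   \<or> pos n a = n \<and> b = -a \<and> pos n c < n \<and> d = a \<and> e = c \<and> f = -a
   \<or> pos n a = n \<and> b = -a \<and> c = -a \<and> d = -(n-1) \<and> e = n-1 \<and> f = -a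
   \<or> pos n a = n \<and> b = -(n-1) \<and> c = n-1 \<and> d = a \<and> e = a \<and> f = -a)"
| "base3 n _ _ \<longleftrightarrow> False"

text \<open>The positions of the letters on which colour i < n does nothing; the four excluded ones
  belong to i, i+1, -(i+1) and -i. For i = n-1 the two middle ones coincide.\<close>

definition far :: "int \<Rightarrow> int \<Rightarrow> int \<Rightarrow> bool" where
  "far n i k \<longleftrightarrow> k \<noteq> i \<and> k \<noteq> i+1 \<and> k \<noteq> 2*n-i-1 \<and> k \<noteq> 2*n-i"

context D_crystal begin

text \<open>For a colour i < n a letter behaves in one of five ways, so a relation in three letters
  has at most 125 cases. Recording \<open>pos\<close> in each case lets linear arithmetic discard
  those that violate the order conditions.\<close>

lemma letter_cases:
  fixes i x :: int
  assumes i: "1 \<le> i" "i < n" and l: "letter n x"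
  obtains "x = i" "phL n i x = 1" "epL n i x = 0" "fL n i x = Some (i+1)" "pos n x = i"
  | "x = i+1" "phL n i x = 0" "epL n i x = 1" "fL n i x = None" "pos n x = i+1"
  | "x = -(i+1)" "phL n i x = 1" "epL n i x = 0" "fL n i x = Some (-i)" "pos n x = 2*n-i-1"
  | "x = -i" "phL n i x = 0" "epL n i x = 1" "fL n i x = None" "pos n x = 2*n-i"
  | "phL n i x = 0" "epL n i x = 0" "fL n i x = None"
     "far n i (pos n x)" "1 \<le> pos n x" "pos n x < 2*n" "letter n x"
  using assms unfolding phL_def epL_def fL_def eL_def letter_def pos_def far_def by atomize_elim auto

lemma pos_i:
  assumes i: "1 \<le> i" "i < n" 
  shows "pos n i = i" "pos n (-i) = 2*n-i" "pos n (i+1) = i+1" "pos n (-(i+1)) = 2*n-i-1" "pos n (-i-1) = 2*n-i-1"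
    "letter n i" "letter n (-i)" "letter n (i+1)" "letter n (-(i+1))" "letter n (-i-1)"
  using assms by (auto simp: pos_def letter_def)

text \<open>The images are related by \<open>base3\<close> but not always by R1 again. For x = i, z
  = -(i+1) and a letter y on which colour i does nothing, they are y, -i, i and y, i+1, -(i+1), an
  instance of R2: the condition excluding x = -z has been lost.\<close>

lemma R1a_f:
  assumes i: "1 \<le> i" "i < n" and l: "letter n x" "letter n y" "letter n z"
    and c: "pos n x < pos n y" "pos n y < pos n z" "pos n x + pos n z \<noteq> 2*n"
  shows "phi n i [y,z,x] = phi n i [y,x,z] \<and> rel_option (base3 n) (fw n i [y,z,x]) (fw n i [y,x,z])"
  by (insert c i n2)
    (rule letter_cases[OF i l(1)]; rule letter_cases[OF i l(2)]; rule letter_cases[OF i l(3)];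
      (linarith; fail)?; simp only: phi.simps eps.simps fw.simps; ((simp (no_asm) del: base3.simps)[1])?;
      ((simp add: pos_i[OF i] far_def; fail)[1])?; (cases "n \<le> i+1"; simp add: pos_i[OF i] far_def)?)

lemma R1b_f:
  assumes i: "1 \<le> i" "i < n" and l: "letter n x" "letter n y" "letter n z"
    and c: "pos n x < pos n y" "pos n y < pos n z" "pos n x + pos n z \<noteq> 2*n"
  shows "phi n i [x,z,y] = phi n i [z,x,y] \<and> rel_option (base3 n) (fw n i [x,z,y]) (fw n i [z,x,y])"
  by (insert c i n2)
    (rule letter_cases[OF i l(1)]; rule letter_cases[OF i l(2)]; rule letter_cases[OF i l(3)];
      (linarith; fail)?; simp only: phi.simps eps.simps fw.simps; ((simp (no_asm) del: base3.simps)[1])?;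
      ((simp add: pos_i[OF i] far_def; fail)[1])?; (cases "n \<le> i+1"; simp add: pos_i[OF i] far_def)?)

lemma R1a_f_eq:
  assumes i: "1 \<le> i" "i < n" and l: "letter n y" "letter n z"
    and c: "pos n y < pos n z" "pos n y + pos n z \<noteq> 2*n"
  shows "phi n i [y,z,y] = phi n i [y,y,z] \<and> rel_option (base3 n) (fw n i [y,z,y]) (fw n i [y,y,z])"
  by (insert c i n2)
    (rule letter_cases[OF i l(1)]; rule letter_cases[OF i l(2)];
      (linarith; fail)?; simp only: phi.simps eps.simps fw.simps; ((simp (no_asm) del: base3.simps)[1])?;
      ((simp add: pos_i[OF i] far_def; fail)[1])?; (cases "n \<le> i+1"; simp add: pos_i[OF i] far_def)?)

lemma R1b_f_eq:
  assumes i: "1 \<le> i" "i < n" and l: "letter n x" "letter n y"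
    and c: "pos n x < pos n y" "pos n x + pos n y \<noteq> 2*n"
  shows "phi n i [x,y,y] = phi n i [y,x,y] \<and> rel_option (base3 n) (fw n i [x,y,y]) (fw n i [y,x,y])"
  by (insert c i n2)
    (rule letter_cases[OF i l(1)]; rule letter_cases[OF i l(2)];
      (linarith; fail)?; simp only: phi.simps eps.simps fw.simps; ((simp (no_asm) del: base3.simps)[1])?;
      ((simp add: pos_i[OF i] far_def; fail)[1])?; (cases "n \<le> i+1"; simp add: pos_i[OF i] far_def)?)

lemma letter_pair_cases:
  fixes i x :: int
  assumes i: "1 \<le> i" "i < n" and x: "1 < x" "x < n"
  obtains "x = i" | "x = i + 1" | "x = i + 2" | "x \<noteq> i" "x \<noteq> i + 1" "x \<noteq> i + 2"
  by blast

lemma letter_x: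
  assumes "1 < x" "x < n"
  shows "letter n (1-x)" "letter n (x-1)" "letter n x" "letter n (-x)"
  using assms by (auto simp: letter_def)

lemma letter_n: "letter n n" "letter n (-n)" "letter n (n-1)" "letter n (1-n)"
     "pos n n = n" "pos n (-n) = n" "pos n (n-1) = n-1" "pos n (1-n) = n+1" 
  using n2 by (auto simp: letter_def pos_def)

lemma R2a_f:
  assumes i: "1 \<le> i" "i < n" and l: "letter n y" and x: "1 < x" "x < n"
    and c: "x \<le> pos n y" "pos n y \<le> 2*n - x"
  shows "phi n i [y,-(x-1),x-1] = phi n i [y,x,-x] \<and> rel_option (base3 n) (fw n i [y,-(x-1),x-1]) (fw n i [y,x,-x])"
  by (insert c i n2 x)
    (rule letter_pair_cases[OF i x]; rule letter_cases[OF i l];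
      (linarith; fail)?; simp only: phi.simps eps.simps fw.simps;
      ((simp (no_asm_simp) del: base3.simps add: phL_def epL_def fL_def eL_def)[1])?;
      ((simp add: pos_i[OF i] letter_x[OF x] far_def; fail)[1])?; (cases "n \<le> i+1"; simp add: pos_i[OF i] letter_x[OF x] far_def)?; (simp add: letter_def)?)

lemma R2b_f:
  assumes i: "1 \<le> i" "i < n" and l: "letter n y" and x: "1 < x" "x < n"
    and c: "x \<le> pos n y" "pos n y \<le> 2*n - x"
  shows "phi n i [x,-x,y] = phi n i [-(x-1),x-1,y] \<and> rel_option (base3 n) (fw n i [x,-x,y]) (fw n i [-(x-1),x-1,y])"
  by (insert c i n2 x)
    (rule letter_pair_cases[OF i x]; rule letter_cases[OF i l];
      (linarith; fail)?; simp only: phi.simps eps.simps fw.simps;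
      ((simp (no_asm_simp) del: base3.simps add: phL_def epL_def fL_def eL_def)[1])?;
      ((simp add: pos_i[OF i] letter_x[OF x] far_def; fail)[1])?; (cases "n \<le> i+1"; simp add: pos_i[OF i] letter_x[OF x] far_def)?; (simp add: letter_def)?)

lemma R3_f:
  assumes i: "1 \<le> i" "i < n" and l: "letter n x" and c: "n < pos n x" and s: "s = n \<or> s = -n"
  shows "phi n i [s,x,-s] = phi n i [x,s,-s] \<and> rel_option (base3 n) (fw n i [s,x,-s]) (fw n i [x,s,-s])"
  by (insert c i n2)
    (rule disjE[OF s]; rule letter_cases[OF i l];
      (linarith; fail)?; simp only: phi.simps eps.simps fw.simps;
      ((insert i n2; simp (no_asm_simp) del: base3.simps add: phL_def epL_def fL_def eL_def)[1])?;
      (cases "n \<le> i+1"; simp add: pos_i[OF i] letter_n far_def)?; (simp add: letter_def)?)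

lemma R3_f':
  assumes i: "1 \<le> i" "i < n" and l: "letter n x" and c: "pos n x < n" and s: "s = n \<or> s = -n"
  shows "phi n i [s,-s,x] = phi n i [s,x,-s] \<and> rel_option (base3 n) (fw n i [s,-s,x]) (fw n i [s,x,-s])"
  by (insert c i n2)
    (rule disjE[OF s]; rule letter_cases[OF i l];
      (linarith; fail)?; simp only: phi.simps eps.simps fw.simps;
      ((insert i n2; simp (no_asm_simp) del: base3.simps add: phL_def epL_def fL_def eL_def)[1])?;
      (cases "n \<le> i+1"; simp add: pos_i[OF i] letter_n far_def)?; (simp add: letter_def)?)

lemma R4_f:
  assumes i: "1 \<le> i" "i < n" and s: "s = n \<or> s = -n"
  shows "phi n i [s,-s,-s] = phi n i [-(n-1),n-1,-s] \<and> rel_option (base3 n) (fw n i [s,-s,-s]) (fw n i [-(n-1),n-1,-s])"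
  by (insert i n2)
    (rule disjE[OF s]; cases "n \<le> i+1"; simp add: phL_def epL_def fL_def eL_def pos_i[OF i] letter_n)

lemma R4_f':
  assumes i: "1 \<le> i" "i < n" and s: "s = n \<or> s = -n"
  shows "phi n i [s,-(n-1),n-1] = phi n i [s,s,-s] \<and> rel_option (base3 n) (fw n i [s,-(n-1),n-1]) (fw n i [s,s,-s])"
  by (insert i n2)
    (rule disjE[OF s]; cases "n \<le> i+1"; simp add: phL_def epL_def fL_def eL_def pos_i[OF i] letter_n)

lemma pos_eq_n: "letter n x \<Longrightarrow> pos n x = n \<longleftrightarrow> x = n \<or> x = -n"
  by (auto simp: pos_def letter_def)

lemma pos_uminus: "letter n x \<Longrightarrow> pos n (-x) = 2*n - pos n x"
  by (auto simp: pos_def letter_def)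

lemma letter_uminus: "letter n (-x) \<longleftrightarrow> letter n x"
  by (auto simp: letter_def)

lemma pos_flip: "pos n (flip x) = pos n x" and letter_flip: "letter n (flip x) = letter n x"
  using n2 by (auto simp: pos_def letter_def flip_def)

lemma base3_cases:
  assumes "base3 n p q"
  obtains (R1a) x y z where "p = [y,z,x]" "q = [y,x,z]" "letter n x" "letter n y" "letter n z"
      "x = y \<or> pos n x < pos n y" "pos n y < pos n z" "pos n x + pos n z \<noteq> 2*n"
  | (R1b) x y z where "p = [x,z,y]" "q = [z,x,y]" "letter n x" "letter n y" "letter n z"
      "pos n x < pos n y" "y = z \<or> pos n y < pos n z" "pos n x + pos n z \<noteq> 2*n"
  | (R2a) x y where "p = [y,-(x-1),x-1]" "q = [y,x,-x]" "letter n y" "1 < x" "x < n"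
      "x \<le> pos n y" "pos n y \<le> 2*n - x"
  | (R2b) x y where "p = [x,-x,y]" "q = [-(x-1),x-1,y]" "letter n y" "1 < x" "x < n"
      "x \<le> pos n y" "pos n y \<le> 2*n - x"
  | (R3a) x s where "p = [s,x,-s]" "q = [x,s,-s]" "letter n x" "n < pos n x" "s = n \<or> s = -n"
  | (R3b) x s where "p = [s,-s,x]" "q = [s,x,-s]" "letter n x" "pos n x < n" "s = n \<or> s = -n"
  | (R4a) s where "p = [s,-s,-s]" "q = [-(n-1),n-1,-s]" "s = n \<or> s = -n"
  | (R4b) s where "p = [s,-(n-1),n-1]" "q = [s,s,-s]" "s = n \<or> s = -n"
proof -
  obtain a b c d e f where pq: "p = [a,b,c]" "q = [d,e,f]"
    using assms by (cases "(n,p,q)" rule: base3.cases) auto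
  have l: "letter n a" "letter n b" "letter n c" "letter n d" "letter n e" "letter n f"
    using assms pq by auto
  from assms[unfolded pq base3.simps]
  show thesis
    apply (elim conjE disjE)
    subgoal using R1a[of a b c] pq l by auto
    subgoal using R1a[of a b c] pq l by auto
    subgoal using R1b[of a b c] pq l by auto
    subgoal using R1b[of a b c] pq l by auto
    subgoal using R2a[of a e] pq l by auto
    subgoal using R2b[of a c] pq l by auto
    subgoal using R3a[of a b] pq l pos_eq_n[of a] by auto
    subgoal using R3b[of a c] pq l pos_eq_n[of a] by auto
    subgoal using R4a[of a] pq l pos_eq_n[of a] by auto
    subgoal using R4b[of a] pq l pos_eq_n[of a] by auto
    done
qed

lemma base3_f:
  assumes "base3 n p q" and i: "1 \<le> i" "i < n"
  shows "phi n i p = phi n i q \<and> rel_option (base3 n) (fw n i p) (fw n i q)"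
  using assms(1)
proof (cases rule: base3_cases)
  case (R1a x y z)
  then show ?thesis
    using R1a_f[OF i, of x y z] R1a_f_eq[OF i, of y z] by blast
next
  case (R1b x y z)
  then show ?thesis
    using R1b_f[OF i, of x y z] R1b_f_eq[OF i, of x y] by blast
next
  case (R2a x y) then show ?thesis using R2a_f[OF i, of y x] by blast
next
  case (R2b x y) then show ?thesis using R2b_f[OF i, of y x] by blast
next
  case (R3a x s) then show ?thesis using R3_f[OF i, of x s] by blast
next
  case (R3b x s) then show ?thesis using R3_f'[OF i, of x s] by blast
next
  case (R4a s) then show ?thesis using R4_f[OF i, of s] by blast
next
  case (R4b s) then show ?thesis using R4_f'[OF i, of s] by blast
qed


lemma
  shows base3_R1a: "\<lbrakk>letter n x; letter n y; letter n z; x = y \<or> pos n x < pos n y; pos n y < pos n z;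
      pos n x + pos n z \<noteq> 2*n\<rbrakk> \<Longrightarrow> base3 n [y,z,x] [y,x,z]"
    and base3_R1b: "\<lbrakk>letter n x; letter n y; letter n z; pos n x < pos n y; y = z \<or> pos n y < pos n z;
      pos n x + pos n z \<noteq> 2*n\<rbrakk> \<Longrightarrow> base3 n [x,z,y] [z,x,y]"
    and base3_R2a: "\<lbrakk>letter n y; 1 < x; x < n; x \<le> pos n y; pos n y \<le> 2*n - x\<rbrakk>
      \<Longrightarrow> base3 n [y,-(x-1),x-1] [y,x,-x]"
    and base3_R2b: "\<lbrakk>letter n y; 1 < x; x < n; x \<le> pos n y; pos n y \<le> 2*n - x\<rbrakk>
      \<Longrightarrow> base3 n [x,-x,y] [-(x-1),x-1,y]"
    and base3_R3a: "\<lbrakk>letter n x; n < pos n x; s = n \<or> s = -n\<rbrakk> \<Longrightarrow> base3 n [s,x,-s] [x,s,-s]"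
    and base3_R3b: "\<lbrakk>letter n x; pos n x < n; s = n \<or> s = -n\<rbrakk> \<Longrightarrow> base3 n [s,-s,x] [s,x,-s]"
    and base3_R4a: "s = n \<or> s = -n \<Longrightarrow> base3 n [s,-s,-s] [-(n-1),n-1,-s]"
    and base3_R4b: "s = n \<or> s = -n \<Longrightarrow> base3 n [s,-(n-1),n-1] [s,s,-s]"
  using n2 letter_x[of x] letter_n by auto

lemma flip_simps: "\<lbrakk>-n < x; x < n\<rbrakk> \<Longrightarrow> flip x = x" "flip n = -n" "flip (-n) = n"
  using n2 by (auto simp: flip_def)

lemma pos_gt_n: "letter n x \<Longrightarrow> n < pos n x \<Longrightarrow> -n < x \<and> x < 0"
  and pos_lt_n: "letter n x \<Longrightarrow> pos n x < n \<Longrightarrow> 0 < x \<and> x < n"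
  by (auto simp: pos_def letter_def split: if_splits)

lemma flip_uminus: "flip (-x) = - flip x"
  using n2 by (auto simp: flip_def)

lemma base3_flip:
  assumes "base3 n p q" shows "base3 n (map flip p) (map flip q)"
  using assms
proof (cases rule: base3_cases)
  case (R1a x y z)
  then show ?thesis using base3_R1a[of "flip x" "flip y" "flip z"] by (auto simp del: base3.simps simp add: pos_flip letter_flip)
next
  case (R1b x y z)
  then show ?thesis using base3_R1b[of "flip x" "flip y" "flip z"] by (auto simp del: base3.simps simp add: pos_flip letter_flip)
next
  case (R2a x y)
  then show ?thesis using base3_R2a[of "flip y" x] by (simp del: base3.simps add: pos_flip letter_flip flip_simps)
next
  case (R2b x y)
  then show ?thesis using base3_R2b[of "flip y" x] by (simp del: base3.simps add: pos_flip letter_flip flip_simps)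
next
  case (R3a x s)
  then show ?thesis
    using base3_R3a[of x "flip s"] pos_gt_n[of x] n2 by (auto simp del: base3.simps simp add: flip_simps)
next
  case (R3b x s)
  then show ?thesis
    using base3_R3b[of x "flip s"] pos_lt_n[of x] n2 by (auto simp del: base3.simps simp add: flip_simps)
next
  case (R4a s)
  then show ?thesis using base3_R4a[of "flip s"] n2 by (auto simp del: base3.simps simp add: flip_simps)
next
  case (R4b s)
  then show ?thesis using base3_R4b[of "flip s"] n2 by (auto simp del: base3.simps simp add: flip_simps)
qed

text \<open>The clauses come in pairs, R1a with R1b, R2a with R2b and so on. Reversing and barring
  exchanges the members of a pair and swaps the two sides.\<close>

lemma base3_dual:
  assumes "base3 n p q" shows "base3 n (dual q) (dual p)"
  using assms
proof (cases rule: base3_cases)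
  case (R1a x y z)
  have "base3 n [-z,-x,-y] [-x,-z,-y]"
    using R1a by (intro base3_R1b) (auto simp: pos_uminus letter_uminus)
  then show ?thesis using R1a by (simp del: base3.simps)
next
  case (R1b x y z)
  have "base3 n [-y,-x,-z] [-y,-z,-x]"
    using R1b by (intro base3_R1a) (auto simp: pos_uminus letter_uminus)
  then show ?thesis using R1b by (simp del: base3.simps)
next
  case (R2a x y)
  then show ?thesis using base3_R2b[of "-y" x] by (simp del: base3.simps add: pos_uminus letter_uminus)
next
  case (R2b x y)
  then show ?thesis using base3_R2a[of "-y" x] by (simp del: base3.simps add: pos_uminus letter_uminus)
next
  case (R3a x s)
  then show ?thesis using base3_R3b[of "-x" s] by (simp del: base3.simps add: pos_uminus letter_uminus)
next
  case (R3b x s)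
  then show ?thesis using base3_R3a[of "-x" s] by (simp del: base3.simps add: pos_uminus letter_uminus)
next
  case (R4a s)
  then show ?thesis using base3_R4b[of s] by (simp del: base3.simps)
next
  case (R4b s)
  then show ?thesis using base3_R4a[of s] by (simp del: base3.simps)
qed

end


section \<open>Columns\<close>

definition NB :: "int \<Rightarrow> int list \<Rightarrow> int" where
  "NB k w = int (length (filter (\<lambda>x. \<bar>x\<bar> \<le> k) w))"

lemma NB_simps [simp]: "NB k [] = 0" "NB k (x # w) = (if \<bar>x\<bar> \<le> k then 1 else 0) + NB k w"
  "NB k (u @ v) = NB k u + NB k v"
  by (simp_all add: NB_def)

lemma NB_nonneg: "0 \<le> NB k w"
  by (simp add: NB_def)

lemma NB_eq_length: "(\<And>x. x \<in> set w \<Longrightarrow> \<bar>x\<bar> \<le> k) \<Longrightarrow> NB k w = int (length w)"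
  by (induction w) auto

lemma NB_eq_0: "(\<And>x. x \<in> set w \<Longrightarrow> \<bar>x\<bar> > k) \<Longrightarrow> NB k w = 0"
  by (induction w) force+

context D_crystal begin

lemma leqD_pos: "letter n x \<Longrightarrow> letter n y \<Longrightarrow> leqD n x y \<longleftrightarrow> x = y \<or> pos n x < pos n y"
  and lessD_pos: "letter n x \<Longrightarrow> letter n y \<Longrightarrow> lessD n x y \<longleftrightarrow> pos n x < pos n y"
  by (auto simp: lessD_def leqD_def rankD_def letter_def pos_def)

text \<open>The condition on neighbours in a column: a strict increase, or a switch between n and
  -n, which may therefore alternate several times.\<close>

definition adj :: "int \<Rightarrow> int \<Rightarrow> bool" where
  "adj x y \<longleftrightarrow> pos n x < pos n y \<or> pos n x = n \<and> y = -x"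

definition colw :: "int list \<Rightarrow> bool" where
  "colw C \<longleftrightarrow> lword n C \<and> successively adj C"

lemma not_leqD_adj: "letter n x \<Longrightarrow> letter n y \<Longrightarrow> \<not> leqD n y x \<longleftrightarrow> adj x y"
  by (auto simp: leqD_def rankD_def letter_def pos_def adj_def)

lemma is_col_iff: "is_col n C \<longleftrightarrow> colw C"
proof -
  have "(\<forall>k. k + 1 < length C \<longrightarrow> \<not> leqD n (C ! (k+1)) (C ! k)) \<longleftrightarrow> successively adj C"
    if "lword n C"
    unfolding successively_conv_nth
    using that not_leqD_adj by (auto simp: lword_def)
  then show ?thesis by (auto simp: is_col_def colw_def)
qed

lemma lword_append [simp]: "lword n (u @ v) \<longleftrightarrow> lword n u \<and> lword n v"
  and lword_Cons [simp]: "lword n (x # v) \<longleftrightarrow> letter n x \<and> lword n v"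
  and lword_Nil [simp]: "lword n []"
  by (auto simp: lword_def)

lemma adj_pos: "letter n x \<Longrightarrow> adj x y \<Longrightarrow> pos n x \<le> pos n y"
  using pos_uminus[of x] by (auto simp: adj_def)

lemma colw_append: "colw (u @ v) \<longleftrightarrow> colw u \<and> colw v \<and> (u = [] \<or> v = [] \<or> adj (last u) (hd v))"
  by (auto simp: colw_def successively_append_iff)

lemma colw_Nil [simp]: "colw []" and colw_single [simp]: "colw [x] \<longleftrightarrow> letter n x"
  by (auto simp: colw_def)

lemma colw_Cons: "colw (x # v) \<longleftrightarrow> letter n x \<and> colw v \<and> (v = [] \<or> adj x (hd v))"
  using colw_append[of "[x]" v] by auto

lemma colw_lword: "colw C \<Longrightarrow> lword n C"
  by (simp add: colw_def)

lemma colw_sorted: "colw C \<Longrightarrow> sorted (map (pos n) C)"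
proof (induction C)
  case (Cons x v)
  then show ?case
    by (cases v) (use adj_pos[of x] in \<open>auto simp: colw_Cons\<close>, fastforce)
qed simp

text \<open>The last two claims hold away from position n, where a column increases strictly; only n
  and -n can recur.\<close>

lemma colw_split:
  assumes "colw (u @ [x] @ v)"
  shows "\<And>y. y \<in> set u \<Longrightarrow> pos n y \<le> pos n x" "\<And>y. y \<in> set v \<Longrightarrow> pos n x \<le> pos n y"
    "\<And>y. pos n x \<noteq> n \<Longrightarrow> y \<in> set u \<Longrightarrow> pos n y < pos n x"
    "\<And>y. pos n x \<noteq> n \<Longrightarrow> y \<in> set v \<Longrightarrow> pos n x < pos n y"
proof -
  have s: "sorted (map (pos n) (u @ [x] @ v))" using assms by (rule colw_sorted)
  then show a: "\<And>y. y \<in> set u \<Longrightarrow> pos n y \<le> pos n x" and b: "\<And>y. y \<in> set v \<Longrightarrow> pos n x \<le> pos n y"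
    by (auto simp: sorted_append)
  { fix y assume x: "pos n x \<noteq> n" and y: "y \<in> set u"
    then obtain u' l where u: "u = u' @ [l]" by (cases u rule: rev_cases) auto
    have l: "letter n x" "letter n l" using assms u by (auto simp: colw_def)
    have "adj l x" using assms u by (auto simp: colw_append colw_Cons)
    then have "pos n l < pos n x" using x pos_uminus[OF l(2)] by (auto simp: adj_def)
    moreover have "pos n y \<le> pos n l" using s u y by (auto simp: sorted_append)
    ultimately show "pos n y < pos n x" by simp }
  { fix y assume x: "pos n x \<noteq> n" and y: "y \<in> set v"
    then obtain v' l where u: "v = l # v'" by (cases v) auto
    have "adj x l" using assms u by (auto simp: colw_append colw_Cons)
    then have "pos n x < pos n l" using x by (auto simp: adj_def)
    moreover have "pos n l \<le> pos n y" using s u y by (auto simp: sorted_append)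
    ultimately show "pos n x < pos n y" by simp }
qed

lemma pos_lt_D: "letter n y \<Longrightarrow> pos n y < k \<Longrightarrow> k \<le> n \<Longrightarrow> 0 < y \<and> y < k"
  and pos_gt_D: "letter n y \<Longrightarrow> 2*n - k < pos n y \<Longrightarrow> k \<le> n \<Longrightarrow> y < 0 \<and> -k < y"
  and pos_mid: "letter n y \<Longrightarrow> k < pos n y \<Longrightarrow> pos n y < 2*n - k \<Longrightarrow> k < \<bar>y\<bar>"
  by (auto simp: pos_def letter_def split: if_splits)

section \<open>Columns under the crystal operators\<close>

text \<open>The signature rule. The letter that changes has no uncancelled arrow before it and is
  not cancelled from behind, which is what \<open>phi n i u = 0\<close> and
  \<open>eps n i v = 0\<close> express.\<close>

lemma fw_decomp:
  "fw n i C = Some C' \<Longrightarrow>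
    \<exists>u x y v. C = u @ [x] @ v \<and> C' = u @ [y] @ v \<and> fL n i x = Some y \<and> phi n i u = 0 \<and> eps n i v = 0"
proof (induction C arbitrary: C')
  case (Cons x v)
  show ?case
  proof (cases "phL n i x > eps n i v")
    case True
    then obtain y where "fL n i x = Some y" "C' = y # v" using Cons.prems by auto
    moreover have "eps n i v = 0" using True phL_le1[of i x] by simp
    ultimately show ?thesis by (intro exI[of _ "[]"]) auto
  next
    case False
    then obtain v' where v': "fw n i v = Some v'" "C' = x # v'" using Cons.prems by auto
    from Cons.IH[OF v'(1)] obtain u a b t where d: "v = u @ [a] @ t" "v' = u @ [b] @ t" "fL n i a = Some b"
      "phi n i u = 0" "eps n i t = 0" by blast
    have "eps n i v = eps n i u" using d fL_SomeD[OF d(3)] by (simp add: eps_append)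
    then have "phi n i (x # u) = 0" using False d(4) by simp
    then show ?thesis using d v'(2) by (intro exI[of _ "x # u"]) auto
  qed
qed simp

lemma fL_letter: "letter n x \<Longrightarrow> fL n i x = Some y \<Longrightarrow> letter n y"
  using n2 by (auto simp: fL_def letter_def split: if_splits)

lemma fw_lword: "lword n w \<Longrightarrow> fw n i w = Some w' \<Longrightarrow> lword n w'"
  using fw_decomp[of i w w'] fL_letter by auto

lemma adj_f_strict:
  assumes i: "1 \<le> i" "i < n" and l: "letter n a" "letter n b" and c: "pos n a < pos n b"
  shows "case fw n i [a,b] of None \<Rightarrow> True | Some w \<Rightarrow> adj (w ! 0) (w ! 1)"
  by (insert i n2 c)
    (rule letter_cases[OF i l(1)]; rule letter_cases[OF i l(2)];
      (linarith; fail)?; simp add: adj_def pos_i[OF i] far_def; arith?)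

lemma adj_f:
  assumes i: "1 \<le> i" "i < n" and l: "letter n a" "letter n b" and c: "adj a b" and f: "fw n i [a,b] = Some [a',b']"
  shows "adj a' b'"
proof -
  from c consider "pos n a < pos n b" | "pos n a = n" "b = -a" by (auto simp: adj_def)
  then show ?thesis
  proof cases
    case 1
    then show ?thesis using adj_f_strict[OF i l 1] f by (simp del: fw.simps)
  next
    case 2
    then have "a = n \<or> a = -n" using pos_eq_n l by auto
    then show ?thesis using 2 f i n2
      by (cases "n \<le> i + 1") (auto simp: phL_def epL_def fL_def eL_def adj_def pos_def split: if_splits)
  qed
qed

text \<open>Being a column is a condition on neighbouring pairs. Since f leaves such a pair alone or
  acts on it as on a word of two letters, \<open>adj_f\<close> suffices for
  \<open>colw_f\<close>.\<close>

lemma fw_factor: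
  assumes "fw n i (u @ m @ v) = Some w'"
  shows "\<exists>u' m' v'. w' = u' @ m' @ v' \<and> length u' = length u \<and> length m' = length m \<and>
     (m' = m \<or> fw n i m = Some m')"
  using assms fw_length[of n i u] fw_length[of n i m]
  by (auto simp: fw_append split: if_splits)

lemma colw_f:
  assumes i: "1 \<le> i" "i < n" and C: "colw C" and f: "fw n i C = Some C'"
  shows "colw C'"
proof -
  have "adj (C' ! k) (C' ! Suc k)" if k: "Suc k < length C'" for k
  proof -
    have len: "length C' = length C" using f by (rule fw_length)
    have CC: "C = take k C @ [C ! k, C ! Suc k] @ drop (k+2) C"
      using k len by (metis Cons_nth_drop_Suc Suc_lessD add_2_eq_Suc' append_Cons append_Nil append_take_drop_id)
    have "fw n i (take k C @ [C ! k, C ! Suc k] @ drop (k+2) C) = Some C'" using f CC by simp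
    from fw_factor[OF this] have "\<exists>u' m' v'. C' = u' @ m' @ v' \<and> length u' = k \<and> length m' = 2 \<and>
        (m' = [C ! k, C ! Suc k] \<or> fw n i [C ! k, C ! Suc k] = Some m')"
      using k len by (simp del: fw.simps add: numeral_2_eq_2)
    then obtain u' m' v' where w: "C' = u' @ m' @ v'" "length u' = k" "length m' = 2"
      and m: "m' = [C ! k, C ! Suc k] \<or> fw n i [C ! k, C ! Suc k] = Some m'"
      by blast
    obtain a b where ab: "m' = [a,b]" using w(3) by (metis (no_types) One_nat_def Suc_1 length_0_conv length_Suc_conv)
    have "adj (C ! k) (C ! Suc k)" using C k len by (auto simp: colw_def successively_conv_nth)
    moreover have "letter n (C ! k)" "letter n (C ! Suc k)"
      using C k len by (auto simp: colw_def lword_def)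
    ultimately have "adj a b" using m adj_f[OF i] ab by blast
    then show ?thesis using w ab by (simp add: nth_append)
  qed
  then show ?thesis using C fw_lword[of C i C'] f by (auto simp: colw_def successively_conv_nth)
qed


lemma fL_lt: "i < n \<Longrightarrow> fL n i x = Some y \<Longrightarrow> 1 \<le> i \<and> (x = i \<and> y = i + 1 \<or> x = -(i+1) \<and> y = -i)"
  by (auto simp: fL_def split: if_splits)

lemma no_eps:
  "(\<And>x. x \<in> set u \<Longrightarrow> epL n i x = 0) \<Longrightarrow> eps n i u = 0"
  "(\<And>x. x \<in> set u \<Longrightarrow> epL n i x = 0) \<Longrightarrow> y \<in> set u \<Longrightarrow> phL n i y \<le> phi n i u"
proof (induction u)
  case (Cons x u)
  { case 1 show ?case using Cons(1) 1 by auto }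
  { case 2
    have e: "eps n i u = 0" using Cons(1) 2(1) by auto
    show ?case using Cons(2) 2 e by auto }
qed auto

lemma epL_lt: "1 \<le> i \<Longrightarrow> i < n \<Longrightarrow> 0 < epL n i x \<Longrightarrow> x = i + 1 \<or> x = -i"
  by (auto simp: epL_def eL_def split: if_splits)

lemma NB_ge: "x \<in> set w \<Longrightarrow> \<bar>x\<bar> \<le> k \<Longrightarrow> 1 \<le> NB k w"
proof (induction w)
  case (Cons y w)
  then show ?case using NB_nonneg[of k w] by auto
qed simp

lemma NB_step: "NB k w = NB (k-1) w + int (length (filter (\<lambda>x. \<bar>x\<bar> = k) w))"
  by (induction w) auto

text \<open>\<open>NB i\<close> grows only when -(i+1) becomes -i. If i is absent from C, no letter
  of C has absolute value i, hence \<open>NB i C = NB (i-1) C\<close>. If i is present, its arrow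
  must be cancelled by a letter i+1 to the left of -(i+1), and these two letters give
  \<open>NB (i+1) C >= NB i C + 2\<close>. Either alternative preserves bounds
  \<open>NB k <= B k\<close> as soon as B increases by one from i-1 to i and from i to i+1.\<close>

lemma NB_f:
  assumes i: "1 \<le> i" "i < n" and C: "colw C" and f: "fw n i C = Some C'"
  shows "k \<noteq> i \<Longrightarrow> NB k C' = NB k C"
    and "NB i C' < NB i C \<or>
         NB i C' = NB i C + 1 \<and> (NB i C = NB (i - 1) C \<or> NB i C + 2 \<le> NB (i + 1) C)"
proof -
  obtain u x y v where d: "C = u @ [x] @ v" "C' = u @ [y] @ v" "fL n i x = Some y" "phi n i u = 0"
    using fw_decomp[OF f] by blast
  have xy: "x = i \<and> y = i + 1 \<or> x = -(i+1) \<and> y = -i" using fL_lt[OF i(2) d(3)] by blast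
  show "NB k C' = NB k C" if "k \<noteq> i" using that d xy i by auto
  from xy consider "x = i" "y = i + 1" | "x = -(i+1)" "y = -i" by blast
  then show "NB i C' < NB i C \<or>
         NB i C' = NB i C + 1 \<and> (NB i C = NB (i - 1) C \<or> NB i C + 2 \<le> NB (i + 1) C)"
  proof cases
    case 1 then show ?thesis using d i by auto
  next
    case 2
    have C': "colw (u @ [-i] @ v)" using colw_f[OF i C f] d 2 by simp
    have ki: "pos n (-i) = 2*n - i" "pos n (-i) \<noteq> n" using pos_i[OF i] i by auto
    have notin: "-i \<notin> set u" "-i \<notin> set v"
      using colw_split(3,4)[OF C'] ki by force+
    have col: "NB i C' = NB i C + 1" using d 2 i by auto
    show ?thesis
    proof (cases "i \<in> set C")
      case False
      have "filter (\<lambda>x. \<bar>x\<bar> = i) C = []"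
        using False notin d(1) 2 i by (auto simp: filter_empty_conv abs_if split: if_splits)
      then show ?thesis using col NB_step[of i C] by simp
    next
      case True
      have "i \<in> set u"
        using True d(1) 2 i colw_split(2)[of u x v i] C pos_i[OF i] by auto
      \<comment> \<open>Otherwise nothing in u could cancel the arrow of i, against
        \<open>phi n i u = 0\<close>.\<close>
      have "\<exists>t\<in>set u. epL n i t \<noteq> 0"
      proof (rule ccontr)
        assume "\<not> ?thesis"
        then have "phL n i i \<le> phi n i u" using no_eps(2)[of u i i] \<open>i \<in> set u\<close> by auto
        then show False using d(4) i by (auto simp: phL_def fL_def)
      qed
      then have "i + 1 \<in> set u" using epL_lt[OF i] notin by auto
      then obtain p q where u: "u = p @ [i+1] @ q" by (auto dest: split_list)
      have "NB (i + 1) C = NB i C + int (length (filter (\<lambda>x. \<bar>x\<bar> = i+1) C))"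
        using NB_step[of "i+1" C] by simp
      then show ?thesis using col u d(1) 2 i by auto
    qed
  qed
qed

definition neutral :: "int \<Rightarrow> int list \<Rightarrow> bool" where
  "neutral i m \<longleftrightarrow> eps n i m = 0 \<and> phi n i m = 0"

lemma neutral_fw: "neutral i m \<Longrightarrow> fw n i m = None"
  by (simp add: neutral_def fw_None_iff)

lemma neutral_Nil [simp]: "neutral i []" by (simp add: neutral_def)

lemma neutral_word:
  assumes i: "1 \<le> i" "i < n" shows "(\<And>x. x \<in> set m \<Longrightarrow> \<bar>x\<bar> \<noteq> i \<and> \<bar>x\<bar> \<noteq> i + 1) \<Longrightarrow> neutral i m"
proof (induction m)
  case (Cons x m)
  have "phL n i x = 0" "epL n i x = 0"
    using Cons.prems[of x] i by (auto simp: phL_def epL_def fL_def eL_def)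
  then show ?case using Cons by (auto simp: neutral_def)
qed simp

lemma neutral_eps_phi:
  assumes "neutral i m"
  shows "eps n i (u @ m @ v) = eps n i (u @ v)" "phi n i (u @ m @ v) = phi n i (u @ v)"
    "eps n i (m @ v) = eps n i v" "phi n i (m @ v) = phi n i v"
    "eps n i (u @ m) = eps n i u" "phi n i (u @ m) = phi n i u"
  using assms by (auto simp: neutral_def eps_append phi_append)

text \<open>A factor on which e and f vanish is invisible to the tensor rule.\<close>
lemma neutral_insert:
  assumes m: "neutral i m" and f: "fw n i (u @ m @ v) = Some w"
  shows "\<exists>u' v'. w = u' @ m @ v' \<and> length u' = length u \<and> fw n i (u @ v) = Some (u' @ v')"
  using f m neutral_fw[OF m] fw_length[of n i u]
  by (auto simp: fw_append neutral_def eps_append split: if_splits)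

section \<open>The relation R5\<close>

text \<open>The left-hand sides of R5, with z the erased letter (see badcolI and badcol_factors).\<close>
definition badcol :: "int \<Rightarrow> int list \<Rightarrow> bool" where
  "badcol z w \<longleftrightarrow> colw w \<and> 1 \<le> z \<and> z \<le> n \<and> (\<forall>k. 1 \<le> k \<and> k < z \<longrightarrow> NB k w \<le> k) \<and> NB z w = z + 1 \<and>
     (\<forall>k. z \<le> k \<and> k \<le> n \<longrightarrow> NB k w \<le> k + 1)"

text \<open>For z < n the order of a column forces s = z. For z = n both orders of the pair occur
  and are exchanged by \<open>flip\<close>, so s may have either sign, and the erased letters must
  be adjacent.\<close>

definition contr :: "int list \<Rightarrow> int list \<Rightarrow> bool" where
  "contr p q \<longleftrightarrow> (\<exists>z s a b c. badcol z p \<and> p = a @ [s] @ b @ [-s] @ c \<and> q = a @ b @ c \<and> \<bar>s\<bar> = z \<and>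
     (z = n \<longrightarrow> b = []))"

lemma NB_0: "lword n w \<Longrightarrow> NB 0 w = 0"
  by (intro NB_eq_0) (auto simp: lword_def letter_def)

lemma badcol_f:
  assumes i: "1 \<le> i" "i < n" and C: "badcol z C" and f: "fw n i C = Some C'" and z: "z \<noteq> i" "z \<noteq> i + 1"
  shows "badcol z C'"
proof -
  have col: "colw C" "colw C'" using C colw_f[OF i _ f] by (auto simp: badcol_def)
  have same: "k \<noteq> i \<Longrightarrow> NB k C' = NB k C" for k using NB_f(1)[OF i col(1) f] .
  \<comment> \<open>The bounds of a bad column in one function with a jump at z. As z is neither i
    nor i+1, B increases by exactly one on both sides of i, and \<open>NB_f\<close> applies.\<close>
  define B where "B = (\<lambda>k::int. if k < z then k else k + 1)"
  have B: "NB k C \<le> B k" if "0 \<le> k" "k \<le> n" for k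
    using that C NB_0[of C] by (cases "k = 0") (auto simp: B_def badcol_def colw_def)
  have "NB i C' \<le> B i"
    using NB_f(2)[OF i col(1) f] B[of "i-1"] B[of i] B[of "i+1"] i z by (auto simp: B_def split: if_splits)
  then have B': "NB k C' \<le> B k" if "0 \<le> k" "k \<le> n" for k
    using same[of k] B[of k] that by (cases "k = i") auto
  have "NB z C' = z + 1" using same[of z] z C by (auto simp: badcol_def)
  moreover have "NB k C' \<le> k" if "1 \<le> k" "k < z" for k
    using B'[of k] that C by (auto simp: B_def badcol_def)
  moreover have "NB k C' \<le> k + 1" if "z \<le> k" "k \<le> n" for k
    using B'[of k] that C by (auto simp: B_def badcol_def)
  ultimately show ?thesis using C col by (auto simp: badcol_def)
qed

text \<open>Neither letter of the pair is seen by colour i, so f acts on the other letters in the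
  same way before and after the erasure.\<close>

lemma contr_neutral:
  assumes i: "1 \<le> i" "i < n" and p: "p = a @ [s] @ b @ [-s] @ c" and q: "q = a @ b @ c"
    and bad: "badcol z p" "\<bar>s\<bar> = z" "z = n \<longrightarrow> b = []" and z: "z \<noteq> i" "z \<noteq> i + 1"
  shows "phi n i p = phi n i q \<and> rel_option contr (fw n i p) (fw n i q)"
proof -
  have n1: "neutral i [s]" and n2: "neutral i [-s]"
    using bad z by (auto intro!: neutral_word[OF i])
  have ph: "phi n i p = phi n i q"
    using neutral_eps_phi(2)[OF n1, of a "b @ [-s] @ c"] neutral_eps_phi(2)[OF n2, of "a @ b" c] p q by simp
  show ?thesis
  proof (cases "fw n i p")
    case None
    then have "fw n i q = None" using ph by (simp add: fw_None_iff)
    then show ?thesis using None ph by simp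
  next
    case (Some p')
    have "fw n i (a @ [s] @ (b @ [-s] @ c)) = Some p'" using Some p by simp
    from neutral_insert[OF n1 this] obtain a' t where
      a': "p' = a' @ [s] @ t" "length a' = length a" "fw n i (a @ b @ [-s] @ c) = Some (a' @ t)" by blast
    have "fw n i ((a @ b) @ [-s] @ c) = Some (a' @ t)" using a'(3) by simp
    from neutral_insert[OF n2 this] obtain y c' where
      y: "a' @ t = y @ [-s] @ c'" "length y = length (a @ b)" "fw n i ((a @ b) @ c) = Some (y @ c')" by blast
    define b' where "b' = drop (length a) y"
    have yb: "y = a' @ b'" "t = b' @ [-s] @ c'" "length b' = length b"
    proof -
      have "take (length a) (a' @ t) = take (length a) (y @ [-s] @ c')" using y(1) by simp
      then have "a' = take (length a) y" using a'(2) y(2) by simp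
      then show "y = a' @ b'" by (simp add: b'_def)
      then show "t = b' @ [-s] @ c'" using y(1) by simp
      show "length b' = length b" using y(2) by (simp add: b'_def)
    qed
    have "badcol z p'" using badcol_f[OF i bad(1) Some z] .
    then have "contr p' (a' @ b' @ c')"
      unfolding contr_def using a'(1) yb bad by (intro exI[of _ z] exI[of _ s] exI[of _ a'] exI[of _ b'] exI[of _ c']) auto
    moreover have "fw n i q = Some (a' @ b' @ c')" using y(3) q yb by simp
    ultimately show ?thesis using Some ph by simp
  qed
qed


lemma letters_i:
  assumes i: "1 \<le> i" "i < n"
  shows "phL n i i = 1" "epL n i i = 0" "fL n i i = Some (i+1)"
    "phL n i (i+1) = 0" "epL n i (i+1) = 1" "fL n i (i+1) = None"
    "phL n i (-(i+1)) = 1" "epL n i (-(i+1)) = 0" "fL n i (-(i+1)) = Some (-i)"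
    "phL n i (-i-1) = 1" "epL n i (-i-1) = 0" "fL n i (-i-1) = Some (-i)"
    "phL n i (-i) = 0" "epL n i (-i) = 1" "fL n i (-i) = None"
  using i by (auto simp: phL_def epL_def fL_def eL_def)

text \<open>For colour n-1 the letters -n and n are not neutral one by one, but in this order the
  arrow of -n is cancelled by n. The order n, -n does not cancel.\<close>

lemma contr_pair:
  assumes i: "1 \<le> i" "i = n - 1" and p: "p = a @ [-n, n] @ c" and q: "q = a @ c" and bad: "badcol n p"
  shows "phi n i p = phi n i q \<and> rel_option contr (fw n i p) (fw n i q)"
proof -
  have i': "i < n" using i by simp
  have "neutral i [-n, n]"
    using letters_i[OF i(1) i'] i by (simp add: neutral_def)
  note nt = this
  have ph: "phi n i p = phi n i q" using neutral_eps_phi(2)[OF nt, of a c] p q by simp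
  show ?thesis
  proof (cases "fw n i p")
    case None
    then have "fw n i q = None" using ph by (simp add: fw_None_iff)
    then show ?thesis using None ph by simp
  next
    case (Some p')
    have "fw n i (a @ [-n,n] @ c) = Some p'" using Some p by simp
    from neutral_insert[OF nt this] obtain a' c' where
      a': "p' = a' @ [-n,n] @ c'" "fw n i (a @ c) = Some (a' @ c')" by blast
    have col: "colw p" "colw p'" using bad colw_f[OF i(1) i' _ Some] by (auto simp: badcol_def)
    have same: "k \<noteq> i \<Longrightarrow> NB k p' = NB k p" for k using NB_f(1)[OF i(1) i' col(1) Some] .
    have len: "NB n p' = int (length p')"
      using col(2) by (intro NB_eq_length) (auto simp: colw_def lword_def letter_def)
    have lt: "NB i u \<le> int (length u)" for u by (simp add: NB_def)
    \<comment> \<open>The word has length n+1, and the pair -n, n is not counted by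
      \<open>NB (n-1)\<close>; this leaves at most n-1 = i letters.\<close>
    have "NB i p' \<le> int (length p') - 2"
      using a'(1) i lt[of a'] lt[of c'] by auto
    then have "NB i p' \<le> i" using len same[of n] bad i by (auto simp: badcol_def)
    moreover have "NB k p' \<le> k" if "1 \<le> k" "k < n" "k \<noteq> i" for k
      using same[of k] that bad by (auto simp: badcol_def)
    ultimately have "NB k p' \<le> k" if "1 \<le> k" "k < n" for k
      using that by (cases "k = i") auto
    then have "badcol n p'"
      using col same[of n] bad i by (auto simp: badcol_def)
    then have "contr p' (a' @ c')"
      unfolding contr_def using a'(1) n2 
      by (intro exI[of _ n] exI[of _ "-n"] exI[of _ a'] exI[of _ "[]"] exI[of _ c']) auto
    then show ?thesis using a'(2) Some ph q by simp
  qed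
qed

lemma filter_le_one:
  assumes "length (filter P b) \<le> 1"
  obtains "filter P b = []" | b1 t b2 where "b = b1 @ [t] @ b2" "P t" "filter P b1 = []" "filter P b2 = []"
proof (cases "filter P b")
  case Nil then show thesis using that by blast
next
  case (Cons t r)
  then have "t \<in> set (filter P b)" by simp
  then have "P t" and "t \<in> set b" by auto
  moreover from \<open>t \<in> set b\<close> obtain b1 b2 where b: "b = b1 @ t # b2" by (auto dest: split_list)
  ultimately have "filter P b1 = []" "filter P b2 = []" using assms by auto
  then show thesis using that(2)[of b1 t b2] b \<open>P t\<close> by simp
qed

text \<open>A pair k, -k with k < n cuts a column by absolute value: smaller letters outside, larger
  ones inside. So \<open>NB k\<close> counts the pair and exactly the letters outside it.\<close>

lemma outer_inner:
  assumes k: "1 \<le> k" "k < n" and p: "colw (a @ [k] @ b @ [-k] @ c)"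
  shows "\<And>x. x \<in> set a \<Longrightarrow> 0 < x \<and> x < k" "\<And>x. x \<in> set c \<Longrightarrow> -k < x \<and> x < 0"
    "\<And>x. x \<in> set b \<Longrightarrow> k < \<bar>x\<bar> \<and> pos n x < 2*n - k \<and> k < pos n x"
proof -
  have kk: "pos n k = k" "pos n (-k) = 2*n - k" using k by (auto simp: pos_def)
  have l: "lword n (a @ [k] @ b @ [-k] @ c)" using p by (rule colw_lword)
  have p': "colw ((a @ [k] @ b) @ [-k] @ c)" using p by simp
  show "0 < x \<and> x < k" if "x \<in> set a" for x
    using colw_split(3)[OF p _ that] kk k pos_lt_D[of x k] l that by (auto simp: lword_def)
  show "-k < x \<and> x < 0" if "x \<in> set c" for x
    using colw_split(4)[OF p' _ that] kk k pos_gt_D[of x k] l that by (auto simp: lword_def)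
  show "k < \<bar>x\<bar> \<and> pos n x < 2*n - k \<and> k < pos n x" if "x \<in> set b" for x
    using colw_split(4)[OF p, of x] colw_split(3)[OF p', of x] kk k pos_mid[of x k] l that by (auto simp: lword_def)
qed

lemma neutral_word': "1 \<le> i \<Longrightarrow> i < n \<Longrightarrow> \<forall>x\<in>set m. \<bar>x\<bar> \<noteq> i \<and> \<bar>x\<bar> \<noteq> i + 1 \<Longrightarrow>
    eps n i m = 0 \<and> phi n i m = 0 \<and> fw n i m = None"
  using neutral_word[of i m] neutral_fw by (auto simp: neutral_def)

lemma badcol_upper: "badcol z w \<Longrightarrow> z \<le> k \<Longrightarrow> k \<le> n \<Longrightarrow> NB k w \<le> k + 1"
  by (simp add: badcol_def)

lemma badcol_lower: "badcol z w \<Longrightarrow> 1 \<le> k \<Longrightarrow> k < z \<Longrightarrow> NB k w \<le> k"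
  by (simp add: badcol_def)

text \<open>If z = i, the only case in which f acts moves the bad pair up to i+1.\<close>
lemma contr_low:
  assumes i: "1 \<le> i" "i < n" and p: "p = a @ [i] @ b @ [-i] @ c" and q: "q = a @ b @ c" and bad: "badcol i p"
  shows "phi n i p = phi n i q \<and> rel_option contr (fw n i p) (fw n i q)"
proof -
  have col: "colw p" using bad by (simp add: badcol_def)
  note oi = outer_inner[OF i col[unfolded p]]
  have na: "eps n i a = 0" "phi n i a = 0" "fw n i a = None" and nc: "eps n i c = 0" "phi n i c = 0" "fw n i c = None"
    using neutral_word'[OF i, of a] neutral_word'[OF i, of c] oi(1,2) by force+
  \<comment> \<open>With \<open>NB i p = i + 1\<close> already reached, the bound at i+1 leaves room
    for a single letter of absolute value i+1.\<close>
  have "NB (i+1) p \<le> (i+1) + 1" "NB i p = i + 1" using bad i badcol_upper[OF bad, of "i+1"] by (simp_all add: badcol_def)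
  then have "length (filter (\<lambda>x. \<bar>x\<bar> = i+1) p) \<le> 1" using NB_step[of "i+1" p] by simp
  then have "length (filter (\<lambda>x. \<bar>x\<bar> = i+1) b) \<le> 1" using p by (auto split: if_splits)
  then show ?thesis
  proof (cases rule: filter_le_one)
    case 1
    then have "eps n i b = 0 \<and> phi n i b = 0 \<and> fw n i b = None"
      using oi(3) by (intro neutral_word'[OF i]) (force simp: filter_empty_conv)
    then show ?thesis using na nc p q letters_i[OF i] by (simp add: eps_append phi_append fw_append)
  next
    case (2 b1 t b2)
    have n1: "eps n i b1 = 0" "phi n i b1 = 0" "fw n i b1 = None"
      and n2: "eps n i b2 = 0" "phi n i b2 = 0" "fw n i b2 = None"
      using neutral_word'[OF i, of b1] neutral_word'[OF i, of b2] 2 oi(3) by (force simp: filter_empty_conv)+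
    have "t = i + 1 \<or> t = -(i+1)" using 2(2) i by linarith
    then show ?thesis
    proof
      assume "t = i + 1"
      then show ?thesis using na nc n1 n2 p q 2(1) letters_i[OF i]
        by (simp add: eps_append phi_append fw_append)
    next
      assume t: "t = -(i+1)"
      have c1: "colw ((a @ [i] @ b1) @ [t] @ (b2 @ [-i] @ c))" using col p 2(1) by simp
      have lets: "letter n x" if "x \<in> set b" for x using col p that by (auto simp: colw_def lword_def)
      have kt: "pos n t = 2*n - i - 1" using t pos_i[OF i] by simp
      have b2: "b2 = []"
      proof (rule ccontr)
        assume "b2 \<noteq> []"
        then obtain x where x: "x \<in> set b2" by (cases b2) auto
        then have "pos n x = 2*n - (i+1)"
          using colw_split(2)[OF c1, of x] oi(3)[of x] 2(1) kt by auto
        then have "\<bar>x\<bar> = i + 1" using lets[of x] x 2(1) i by (auto simp: pos_def letter_def split: if_splits)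
        then show False using 2(4) x by (auto simp: filter_empty_conv)
      qed
      \<comment> \<open>The pair to be erased from the image is i+1, -(i+1); if i+1 = n,
        \<open>contr\<close> asks for it to be adjacent.\<close>
      have b1: "b1 = []" if "i + 1 = n"
      proof (rule ccontr)
        assume "b1 \<noteq> []"
        then obtain x where x: "x \<in> set b1" by (cases b1) auto
        then have "pos n x = n"
          using colw_split(1)[OF c1, of x] oi(3)[of x] 2(1) kt that by auto
        then have "\<bar>x\<bar> = i + 1" using lets[of x] x 2(1) that pos_eq_n[of x] i by auto
        then show False using 2(3) x by (auto simp: filter_empty_conv)
      qed
      \<comment> \<open>In p the arrow of -(i+1) is cancelled by the following -i, so f changes i to
        i+1. In q that -i is missing and f changes -(i+1) to -i. Erasing i+1, -(i+1) from p' gives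
        the same word.\<close>
      define p' where "p' = a @ [i+1] @ b1 @ [-(i+1)] @ [-i] @ c"
      have fp: "fw n i p = Some p'"
        using na nc n1 p 2(1) b2 t letters_i[OF i] by (simp add: p'_def eps_append phi_append fw_append)
      have fq: "fw n i q = Some (a @ b1 @ [-i] @ c)" and ph: "phi n i p = phi n i q"
        using na nc n1 p q 2(1) b2 t letters_i[OF i] by (simp_all add: eps_append phi_append fw_append)
      have pp: "p = a @ [i] @ b1 @ [-(i+1)] @ [-i] @ c" using p 2(1) b2 t by simp
      have same: "k \<noteq> i \<Longrightarrow> NB k p' = NB k p" for k using NB_f(1)[OF i col fp] .
      have "NB i p' = NB i p - 1" using pp i by (simp add: p'_def)
      then have NBi: "NB i p' = i" using bad by (simp add: badcol_def)
      have "filter (\<lambda>x. \<bar>x\<bar> = i+1) a = []" "filter (\<lambda>x. \<bar>x\<bar> = i+1) c = []"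
        using oi(1,2) by (fastforce simp: filter_empty_conv)+
      then have "NB (i+1) p = NB i p + 1" using NB_step[of "i+1" p] 2 p t i by simp
      then have NBi1: "NB (i+1) p' = i + 2" using same[of "i+1"] bad by (simp add: badcol_def)
      have "badcol (i+1) p'" unfolding badcol_def
      proof (intro conjI allI impI)
        show "colw p'" using colw_f[OF i col fp] .
        fix k
        { assume "1 \<le> k \<and> k < i + 1"
          then show "NB k p' \<le> k" using same[of k] NBi bad by (cases "k = i") (auto simp: badcol_def) }
        { assume "i + 1 \<le> k \<and> k \<le> n"
          then show "NB k p' \<le> k + 1" using same[of k] bad i by (auto simp: badcol_def) }
      qed (use NBi1 i in auto)
      then have "contr p' (a @ b1 @ [-i] @ c)"
        unfolding contr_def using i b1
        by (intro exI[of _ "i+1"] exI[of _ "i+1"] exI[of _ a] exI[of _ b1] exI[of _ "[-i] @ c"])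
          (auto simp: p'_def)
      then show ?thesis using fp fq ph by simp
    qed
  qed
qed

text \<open>If z = i+1, the only case in which f acts moves the bad pair down to i.\<close>
lemma contr_high:
  assumes i: "1 \<le> i" "i < n" and p: "p = a @ [i+1] @ b @ [-(i+1)] @ c" and q: "q = a @ b @ c"
    and bad: "badcol (i+1) p" and b: "i + 1 = n \<longrightarrow> b = []"
    and two: "\<forall>x\<in>set (a @ b @ c). \<bar>x\<bar> \<noteq> i + 1"
  shows "phi n i p = phi n i q \<and> rel_option contr (fw n i p) (fw n i q)"
proof -
  have col: "colw p" using bad by (simp add: badcol_def)
  have l: "letter n x" if "x \<in> set (a @ b @ c)" for x using col p that by (auto simp: colw_def lword_def)
  have c1: "colw (a @ [i+1] @ (b @ [-(i+1)] @ c))" "colw ((a @ [i+1] @ b) @ [-(i+1)] @ c)" using col p by simp_all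
  have k1: "pos n (i+1) = i+1" "pos n (-(i+1)) = 2*n-i-1" using pos_i[OF i] by auto
  have "b \<noteq> [] \<Longrightarrow> i + 1 < n" using b i by linarith
  then have ob: "\<bar>x\<bar> > i + 1" if "x \<in> set b" for x
    using outer_inner(3)[of "i+1" a b c x] col[unfolded p] i that by force
  have oa: "0 < x \<and> x \<le> i" if "x \<in> set a" for x
    using colw_split(1)[OF c1(1) that] k1 l[of x] that two[rule_format, of x] i by (auto simp: pos_def letter_def split: if_splits)
  have oc: "x < 0 \<and> -i \<le> x" if "x \<in> set c" for x
    using colw_split(2)[OF c1(2) that] k1 l[of x] that two[rule_format, of x] i by (auto simp: pos_def letter_def split: if_splits)
  have nb: "eps n i b = 0" "phi n i b = 0" "fw n i b = None"
    using neutral_word'[OF i, of b] ob by force+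
  have NBp: "NB (i+1) p = i + 2" using bad by (simp add: badcol_def)
  have f1: "filter (\<lambda>x. \<bar>x\<bar> = i+1) p = [i+1, -(i+1)]"
    using two p i by (simp add: filter_empty_conv)
  then have NBi: "NB i p = i" using NB_step[of "i+1" p] NBp by simp
  have "NB (i-1) p \<le> i - 1" 
    using badcol_lower[OF bad, of "i-1"] i NB_0[OF colw_lword[OF col]] by (cases "i = 1") auto
  \<comment> \<open>\<open>NB i p\<close> exceeds \<open>NB (i-1) p\<close>, so a letter of absolute
    value i occurs, and the order leaves only a for i and c for -i.\<close>
  then have ex: "i \<in> set a \<or> -i \<in> set c"
  proof -
    have "filter (\<lambda>x. \<bar>x\<bar> = i) p \<noteq> []" using NB_step[of i p] NBi \<open>NB (i-1) p \<le> i - 1\<close> by auto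
    then obtain x where x: "x \<in> set p" "\<bar>x\<bar> = i" by (auto simp: filter_empty_conv)
    then show ?thesis using p oa[of x] ob[of x] oc[of x] i by (auto simp: abs_if split: if_splits)
  qed
  have kii: "pos n i = i" "pos n (-i) = 2*n - i" using pos_i[OF i] by auto
  have sa: "\<exists>a1. a = a1 @ [i] \<and> i \<notin> set a1" if "i \<in> set a"
  proof -
    obtain a1 a2 where a: "a = a1 @ i # a2" using \<open>i \<in> set a\<close> by (auto dest: split_list)
    have c2: "colw (a1 @ [i] @ (a2 @ [i+1] @ b @ [-(i+1)] @ c))" using c1 a by simp
    have "a2 = []"
    proof (rule ccontr)
      assume "a2 \<noteq> []"
      then obtain x where x: "x \<in> set a2" by (cases a2) auto
      then show False using colw_split(4)[OF c2, of x] kii i oa[of x] a by (auto simp: pos_def)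
    qed
    moreover have "i \<notin> set a1" using colw_split(3)[OF c2, of i] kii i by auto
    ultimately show ?thesis using a by blast
  qed
  have sc: "\<exists>d1 d2. c = d1 @ [-i] @ d2 \<and> -i \<notin> set d1 \<and> -i \<notin> set d2" if "-i \<in> set c"
  proof -
    obtain d1 d2 where c: "c = d1 @ [-i] @ d2" using \<open>-i \<in> set c\<close> by (auto dest: split_list)
    have "colw ((a @ [i+1] @ b @ [-(i+1)] @ d1) @ [-i] @ d2)" using c1 c by simp
    from colw_split(3,4)[OF this, of "-i"] show ?thesis using kii i c by auto
  qed
  have neut: "eps n i m = 0 \<and> phi n i m = 0 \<and> fw n i m = None"
    if "set m \<subseteq> set a \<union> set c" "i \<notin> set m" "-i \<notin> set m" for m
    using that oa oc i by (intro neutral_word'[OF i] ballI) (fastforce simp: abs_if)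
  show ?thesis
  proof (cases "i \<in> set a")
    case False
    then obtain d1 d2 where c: "c = d1 @ [-i] @ d2" "-i \<notin> set d1" "-i \<notin> set d2" using ex sc by blast
    have n: "eps n i a = 0" "phi n i a = 0" "fw n i a = None" "eps n i d1 = 0" "phi n i d1 = 0" "fw n i d1 = None"
       "eps n i d2 = 0" "phi n i d2 = 0" "fw n i d2 = None"
      using neut[of a] neut[of d1] neut[of d2] c False oa[of "-i"] oc[of i] i by auto
    then show ?thesis using nb p q c(1) letters_i[OF i] by (simp add: eps_append phi_append fw_append)
  next
    case True
    then obtain a1 where a: "a = a1 @ [i]" "i \<notin> set a1" using sa by blast
    have n1: "eps n i a1 = 0" "phi n i a1 = 0" "fw n i a1 = None"
      using neut[of a1] a oa[of "-i"] i by auto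
    show ?thesis
    proof (cases "-i \<in> set c")
      case True
      then obtain d1 d2 where c: "c = d1 @ [-i] @ d2" "-i \<notin> set d1" "-i \<notin> set d2" using sc by blast
      have "eps n i d1 = 0" "phi n i d1 = 0" "fw n i d1 = None"
         "eps n i d2 = 0" "phi n i d2 = 0" "fw n i d2 = None"
        using neut[of d1] neut[of d2] c oc[of i] i by auto
      then show ?thesis using n1 nb p q c(1) a(1) letters_i[OF i] by (simp add: eps_append phi_append fw_append)
    next
      case False
      have nc: "eps n i c = 0" "phi n i c = 0" "fw n i c = None"
        using neut[of c] False oc[of i] i by auto
      \<comment> \<open>In p the arrow of i is cancelled by i+1, so f changes -(i+1) to -i. In q
        that i+1 is missing and f changes i to i+1. Erasing i, -i from p' gives the same
        word.\<close>
      define p' where "p' = a1 @ [i] @ ([i+1] @ b) @ [-i] @ c"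
      have fp: "fw n i p = Some p'"
        using n1 nb nc p a(1) letters_i[OF i] by (simp add: p'_def eps_append phi_append fw_append)
      have fq: "fw n i q = Some (a1 @ ([i+1] @ b) @ c)" and ph: "phi n i p = phi n i q"
        using n1 nb nc p q a(1) letters_i[OF i] by (simp_all add: eps_append phi_append fw_append)
      have same: "k \<noteq> i \<Longrightarrow> NB k p' = NB k p" for k using NB_f(1)[OF i col fp] .
      have "NB i p' = NB i p + 1" using p a(1) i by (simp add: p'_def)
      then have NBi': "NB i p' = i + 1" using NBi by simp
      have "badcol i p'" unfolding badcol_def
      proof (intro conjI allI impI)
        show "colw p'" using colw_f[OF i col fp] .
        fix k
        { assume "1 \<le> k \<and> k < i"
          then show "NB k p' \<le> k" using same[of k] bad by (auto simp: badcol_def) }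
        { assume "i \<le> k \<and> k \<le> n"
          then show "NB k p' \<le> k + 1" using same[of k] NBi' bad by (cases "k = i") (auto simp: badcol_def) }
      qed (use NBi' i in auto)
      then have "contr p' (a1 @ ([i+1] @ b) @ c)"
        unfolding contr_def using i
        by (intro exI[of _ i] exI[of _ i] exI[of _ a1] exI[of _ "[i+1] @ b"] exI[of _ c])
          (auto simp: p'_def)
      then show ?thesis using fp fq ph by simp
    qed
  qed
qed

lemma contr_f:
  assumes pq: "contr p q" and i: "1 \<le> i" "i < n"
  shows "phi n i p = phi n i q \<and> rel_option contr (fw n i p) (fw n i q)"
proof -
  obtain z s a b c where bad: "badcol z p" and p: "p = a @ [s] @ b @ [-s] @ c" and q: "q = a @ b @ c"
    and s: "\<bar>s\<bar> = z" and zn: "z = n \<longrightarrow> b = []"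
    using pq unfolding contr_def by blast
  have z: "1 \<le> z" "z \<le> n" and col: "colw p" using bad by (auto simp: badcol_def)
  have spos: "s = z" if "z < n"
  proof -
    have "pos n s \<le> pos n (-s)" using colw_split(2)[of a s "b @ [-s] @ c" "-s"] col p by auto
    then show ?thesis using s that z by (auto simp: pos_def abs_if split: if_splits)
  qed
  consider "z \<noteq> i" "z \<noteq> i + 1" | "z = i" | "z = i + 1" "i + 1 < n" | "z = i + 1" "i + 1 = n" using i by linarith
  then show ?thesis
  proof cases
    case 1
    then show ?thesis using contr_neutral[OF i p q bad s zn] by blast
  next
    case 2
    then show ?thesis using contr_low[OF i _ q] bad p spos i by auto
  next
    case 3
    have "NB i p \<le> i" "NB (i+1) p = i + 2" using bad 3 i by (auto simp: badcol_def)
    have out: "\<bar>x\<bar> \<noteq> i + 1" if "x \<in> set (a @ b @ c)" for x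
      using outer_inner[of "i+1" a b c] 3 col p spos that i by fastforce
    then show ?thesis using contr_high[OF i _ q] bad p spos 3 i by auto
  next
    case 4
    have b: "b = []" using zn 4 by simp
    have i1: "i = n - 1" using 4 by simp
    have sn: "s = n \<or> s = -n" using s 4 by linarith
    have ls: "letter n x" if "x \<in> set (a @ c)" for x using col p that by (auto simp: colw_def lword_def)
    have bad': "badcol n p" using bad 4 by simp
    \<comment> \<open>Adjacent pairs of an alternating run of n and -n may be erased with the same
      result. If some pair -n, n meets the given pair, it is taken instead and
      \<open>contr_pair\<close> applies; otherwise n and -n occur nowhere else, as
      \<open>contr_high\<close> requires.\<close>
    consider "s = -n" | "s = n" "c \<noteq> []" "hd c = n" | "s = n" "a \<noteq> []" "last a = -n"
      | "s = n" "c = [] \<or> hd c \<noteq> n" "a = [] \<or> last a \<noteq> -n" using sn by blast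
    then show ?thesis
    proof cases
      case 1
      then show ?thesis using contr_pair[OF i(1) i1 _ q[unfolded b]] p b bad' by auto
    next
      case 2
      then obtain c' where c: "c = n # c'" by (cases c) auto
      have "p = (a @ [n]) @ [-n, n] @ c'" "q = (a @ [n]) @ c'" using p q b c 2 by auto
      then show ?thesis using contr_pair[OF i(1) i1] bad' by blast
    next
      case 3
      then obtain a' where a: "a = a' @ [-n]" by (cases a rule: rev_cases) auto
      have "p = a' @ [-n, n] @ ([-n] @ c)" "q = a' @ ([-n] @ c)" using p q b a 3 by auto
      then show ?thesis using contr_pair[OF i(1) i1] bad' by blast
    next
      case 4
      have kn: "pos n n = n" "pos n (-n) = n" using letter_n by auto
      have "\<bar>x\<bar> \<noteq> n" if "x \<in> set a" for x
      proof -
        have "a \<noteq> []" using that by auto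
        then obtain a' t where a: "a = a' @ [t]" by (metis rev_exhaust)
        have c2: "colw (a' @ [t] @ ([n, -n] @ c))" using col p b 4 a by simp
        have "t \<noteq> -n" using 4 a by simp
        have "adj t n" using c2 by (auto simp: colw_append colw_Cons)
        then have "pos n t < n" using \<open>t \<noteq> -n\<close> kn by (auto simp: adj_def)
        moreover have "x = t \<or> pos n x \<le> pos n t" using colw_split(1)[OF c2, of x] that a by auto
        ultimately have "pos n x < n" by auto
        then show ?thesis using ls[of x] that pos_lt_n[of x] by auto
      qed
      moreover have "\<bar>x\<bar> \<noteq> n" if "x \<in> set c" for x
      proof -
        have "c \<noteq> []" using that by auto
        then obtain c' t where c: "c = t # c'" by (cases c) auto
        have c2: "colw ((a @ [n, -n]) @ [t] @ c')" using col p b 4 c by simp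
        have "t \<noteq> n" using 4 c by simp
        have "adj (-n) t" using c2 by (auto simp: colw_append colw_Cons)
        then have "n < pos n t" using \<open>t \<noteq> n\<close> kn by (auto simp: adj_def)
        moreover have "x = t \<or> pos n t \<le> pos n x" using colw_split(2)[OF c2, of x] that c by auto
        ultimately have "n < pos n x" by auto
        then show ?thesis using ls[of x] that pos_gt_n[of x] by auto
      qed
      ultimately have "\<forall>x\<in>set (a @ b @ c). \<bar>x\<bar> \<noteq> i + 1" using b i1 by auto
      then show ?thesis using contr_high[OF i _ q] bad' p b 4(1) i1 by auto
    qed
  qed
qed


section \<open>Stability of R5 under the two symmetries\<close>

lemma NB_flip: "NB k (map flip w) = NB k w"
  by (induction w) (auto simp: flip_def)

lemma NB_dual: "NB k (dual w) = NB k w"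
  by (induction w) auto

lemma flip_inj: "flip x = flip y \<longleftrightarrow> x = y"
  using flip_flip[of x] flip_flip[of y] by metis

lemma abs_flip: "\<bar>flip x\<bar> = \<bar>x\<bar>"
  by (auto simp: flip_def)

lemma adj_flip: "adj (flip x) (flip y) \<longleftrightarrow> adj x y"
  by (simp add: adj_def pos_flip flip_uminus[symmetric] flip_inj)

lemma colw_flip: "colw (map flip w) \<longleftrightarrow> colw w"
  by (auto simp: colw_def lword_def successively_map adj_flip letter_flip)

lemma adj_dual: "letter n x \<Longrightarrow> letter n y \<Longrightarrow> adj (-y) (-x) \<longleftrightarrow> adj x y"
  by (auto simp: adj_def pos_uminus)

lemma lword_dual: "lword n (dual w) \<longleftrightarrow> lword n w"
  by (auto simp: lword_def dual_def letter_uminus)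

lemma colw_dual: "colw w \<Longrightarrow> colw (dual w)"
proof (induction w)
  case (Cons x v)
  show ?case
  proof (cases v)
    case Nil
    then show ?thesis using Cons by (simp add: colw_Cons letter_uminus)
  next
    case (Cons y r)
    then have "adj (-y) (-x)" using Cons.prems adj_dual[of x y] by (simp add: colw_Cons)
    then show ?thesis using Cons Cons.IH Cons.prems by (simp add: colw_append colw_Cons letter_uminus)
  qed
qed simp

lemma contr_flip: "contr p q \<Longrightarrow> contr (map flip p) (map flip q)"
proof -
  assume "contr p q"
  then obtain z s a b c where d: "badcol z p" "p = a @ [s] @ b @ [-s] @ c" "q = a @ b @ c" "\<bar>s\<bar> = z" "z = n \<longrightarrow> b = []"
    unfolding contr_def by blast
  have "badcol z (map flip p)" using d(1) by (auto simp: badcol_def NB_flip colw_flip)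
  then show ?thesis unfolding contr_def using d
    by (intro exI[of _ z] exI[of _ "flip s"] exI[of _ "map flip a"] exI[of _ "map flip b"] exI[of _ "map flip c"])
      (simp_all add: flip_uminus abs_flip)
qed

lemma contr_dual: "contr p q \<Longrightarrow> contr (dual p) (dual q)"
proof -
  assume "contr p q"
  then obtain z s a b c where d: "badcol z p" "p = a @ [s] @ b @ [-s] @ c" "q = a @ b @ c" "\<bar>s\<bar> = z" "z = n \<longrightarrow> b = []"
    unfolding contr_def by blast
  have "badcol z (dual p)" using d(1) by (auto simp: badcol_def NB_dual colw_dual)
  then show ?thesis unfolding contr_def using d
    by (intro exI[of _ z] exI[of _ s] exI[of _ "dual c"] exI[of _ "dual b"] exI[of _ "dual a"]) auto
qed

section \<open>The congruence respects the crystal operators\<close>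

text \<open>Symmetrised because \<open>dual\<close> swaps the sides of R1 to R4 but keeps those of
  R5.\<close>

definition base_rel :: "int list \<Rightarrow> int list \<Rightarrow> bool" where
  "base_rel p q \<longleftrightarrow> base3 n p q \<or> base3 n q p \<or> contr p q \<or> contr q p"

lemma base_rel_sym: "base_rel p q \<Longrightarrow> base_rel q p"
  by (auto simp: base_rel_def)

lemma base_rel_flip: "base_rel p q \<Longrightarrow> base_rel (map flip p) (map flip q)"
  using base3_flip contr_flip by (auto simp: base_rel_def)

lemma base_rel_dual: "base_rel p q \<Longrightarrow> base_rel (dual p) (dual q)"
  using base3_dual contr_dual by (auto simp: base_rel_def)

lemma base_rel_f_lt:
  assumes "base_rel p q" "1 \<le> i" "i < n"
  shows "phi n i p = phi n i q \<and> rel_option base_rel (fw n i p) (fw n i q)"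
proof -
  have *: "phi n i p = phi n i q \<and> rel_option base_rel (fw n i p) (fw n i q)" if "base3 n p q \<or> contr p q" for p q
  proof (cases "base3 n p q")
    case True
    from base3_f[OF this assms(2,3)] show ?thesis
      by (auto simp: base_rel_def elim!: option.rel_cases)
  next
    case False
    then have "contr p q" using that by simp
    from contr_f[OF this assms(2,3)] show ?thesis
      by (auto simp: base_rel_def elim!: option.rel_cases)
  qed
  from assms(1) consider "base3 n p q" | "contr p q" | "base3 n q p" | "contr q p" by (auto simp: base_rel_def)
  then show ?thesis
  proof cases
    case 3
    then show ?thesis using *[of q p] base_rel_sym by (auto elim!: option.rel_cases)
  next
    case 4
    then show ?thesis using *[of q p] base_rel_sym by (auto elim!: option.rel_cases)
  qed (use * in blast)+
qed

lemma colour_out: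
  assumes "\<not> (1 \<le> i \<and> i \<le> n)"
  shows "fw n i w = None" "ew n i w = None" "eps n i w = 0" "phi n i w = 0"
proof -
  have "phL n i x = 0" "epL n i x = 0" for x using assms n2 by (auto simp: phL_def epL_def fL_def eL_def)
  then show "eps n i w = 0" "phi n i w = 0" by (induction w) auto
  then show "fw n i w = None" "ew n i w = None" by (simp_all add: fw_None_iff ew_None_iff)
qed

lemma base_rel_f:
  assumes "base_rel p q"
  shows "phi n i p = phi n i q \<and> rel_option base_rel (fw n i p) (fw n i q)"
proof -
  consider "\<not> (1 \<le> i \<and> i \<le> n)" | "1 \<le> i" "i < n" | "i = n" by linarith
  then show ?thesis
  proof cases
    case 1 then show ?thesis by (simp add: colour_out)
  next
    case 2 then show ?thesis using base_rel_f_lt assms by blast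
  next
    case 3
    have "phi n n w = phi n (n - 1) (map flip w)" "fw n n w = map_option (map flip) (fw n (n-1) (map flip w))" for w
      using phi_flip[of n "map flip w", unfolded map_flip_flip] fw_eq_flip[of n w] by (simp_all add: flip_colour_def)
    moreover have "phi n (n-1) (map flip p) = phi n (n-1) (map flip q) \<and>
        rel_option base_rel (fw n (n-1) (map flip p)) (fw n (n-1) (map flip q))"
      using base_rel_f_lt[OF base_rel_flip[OF assms], of "n-1"] n2 by simp
    ultimately show ?thesis using 3 base_rel_flip by (auto elim!: option.rel_cases)
  qed
qed

lemma base_rel_ok:
  assumes "base_rel p q"
  shows "phi n i p = phi n i q" "eps n i p = eps n i q"
    "rel_option base_rel (fw n i p) (fw n i q)" "rel_option base_rel (ew n i p) (ew n i q)"
proof -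
  show "phi n i p = phi n i q" "rel_option base_rel (fw n i p) (fw n i q)" using base_rel_f[OF assms] by auto
  have d: "phi n i (dual p) = phi n i (dual q)" "rel_option base_rel (fw n i (dual p)) (fw n i (dual q))"
    using base_rel_f[OF base_rel_dual[OF assms]] by auto
  then show "eps n i p = eps n i q" by (simp add: phi_dual)
  show "rel_option base_rel (ew n i p) (ew n i q)"
    unfolding ew_eq_dual[of i p] ew_eq_dual[of i q] option.rel_map
    using d(2) by (rule option.rel_mono_strong) (rule base_rel_dual)
qed

definition cstep :: "int list \<Rightarrow> int list \<Rightarrow> bool" where
  "cstep u v \<longleftrightarrow> (\<exists>a b p q. u = a @ p @ b \<and> v = a @ q @ b \<and> lword n a \<and> lword n b \<and> base_rel p q)"

text \<open>The tensor rule sees the middle factor only through \<open>eps\<close> and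
  \<open>phi\<close>, which agree for p and q. Hence an operator acts on the same one of the three
  factors in both words.\<close>

lemma cstep_ok:
  assumes "cstep u v"
  shows "phi n i u = phi n i v" "eps n i u = eps n i v"
    "rel_option cstep (fw n i u) (fw n i v)" "rel_option cstep (ew n i u) (ew n i v)"
proof -
  obtain a b p q where d: "u = a @ p @ b" "v = a @ q @ b" "lword n a" "lword n b" "base_rel p q"
    using assms unfolding cstep_def by blast
  note ok = base_rel_ok[OF d(5)]
  have I: "cstep (a' @ p' @ b') (a' @ q' @ b')" if "lword n a'" "lword n b'" "base_rel p' q'" for a' p' b' q'
    using that unfolding cstep_def by blast
  have ew_lword: "lword n w'" if "lword n w" "ew n i w = Some w'" for w w'
  proof -
    have "fw n i (dual w) = Some (dual w')" using that(2) by (simp add: fw_dual)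
    then show ?thesis using fw_lword[of "dual w" i "dual w'"] that(1) lword_dual by simp
  qed
  show "phi n i u = phi n i v" "eps n i u = eps n i v" using d ok[of i] by (simp_all add: phi_append eps_append)
  show "rel_option cstep (fw n i u) (fw n i v)"
  proof (cases "phi n i a > eps n i (p @ b)")
    case True
    then have "fw n i u = map_option (\<lambda>a'. a' @ p @ b) (fw n i a)"
      "fw n i v = map_option (\<lambda>a'. a' @ q @ b) (fw n i a)"
      using d(1,2) ok(1,2)[of i] by (simp_all add: fw_append[of i a] eps_append)
    then show ?thesis using d(3,4,5) fw_lword[of a i] I by (cases "fw n i a") auto
  next
    case False
    then have F: "fw n i u = map_option (\<lambda>w. a @ w) (fw n i (p @ b))"
      "fw n i v = map_option (\<lambda>w. a @ w) (fw n i (q @ b))"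
      using d(1,2) ok(1,2)[of i] by (simp_all add: fw_append[of i a] eps_append)
    show ?thesis
    proof (cases "phi n i p > eps n i b")
      case True
      then have "fw n i u = map_option (\<lambda>w. a @ w @ b) (fw n i p)"
        "fw n i v = map_option (\<lambda>w. a @ w @ b) (fw n i q)"
        using F ok(1,2)[of i] by (simp_all add: fw_append option.map_comp comp_def)
      then show ?thesis using ok(3)[of i] d(3,4) I by (auto elim!: option.rel_cases)
    next
      case False
      then have "fw n i u = map_option (\<lambda>w. a @ p @ w) (fw n i b)"
        "fw n i v = map_option (\<lambda>w. a @ q @ w) (fw n i b)"
        using F ok(1,2)[of i] by (simp_all add: fw_append option.map_comp comp_def)
      then show ?thesis using d(3,4,5) fw_lword[of b i] I by (cases "fw n i b") auto
    qed
  qed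
  show "rel_option cstep (ew n i u) (ew n i v)"
  proof (cases "phi n i a < eps n i (p @ b)")
    case False
    then have "ew n i u = map_option (\<lambda>a'. a' @ p @ b) (ew n i a)"
      "ew n i v = map_option (\<lambda>a'. a' @ q @ b) (ew n i a)"
      using d(1,2) ok(1,2)[of i] by (simp_all add: ew_append[of i a] eps_append)
    then show ?thesis using d(3,4,5) ew_lword[of a] I by (cases "ew n i a") auto
  next
    case True
    then have F: "ew n i u = map_option (\<lambda>w. a @ w) (ew n i (p @ b))"
      "ew n i v = map_option (\<lambda>w. a @ w) (ew n i (q @ b))"
      using d(1,2) ok(1,2)[of i] by (simp_all add: ew_append[of i a] eps_append)
    show ?thesis
    proof (cases "phi n i p < eps n i b")
      case False
      then have "ew n i u = map_option (\<lambda>w. a @ w @ b) (ew n i p)"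
        "ew n i v = map_option (\<lambda>w. a @ w @ b) (ew n i q)"
        using F ok(1,2)[of i] by (simp_all add: ew_append option.map_comp comp_def)
      then show ?thesis using ok(4)[of i] d(3,4) I by (auto elim!: option.rel_cases)
    next
      case True
      then have "ew n i u = map_option (\<lambda>w. a @ p @ w) (ew n i b)"
        "ew n i v = map_option (\<lambda>w. a @ q @ w) (ew n i b)"
        using F ok(1,2)[of i] by (simp_all add: ew_append option.map_comp comp_def)
      then show ?thesis using d(3,4,5) ew_lword[of b] I by (cases "ew n i b") auto
    qed
  qed
qed


section \<open>Admissible columns in terms of \<open>NB\<close>, and the agreement with the defining
  relations\<close>

lemma NN_eq: "lword n C \<Longrightarrow> 1 \<le> z \<Longrightarrow> z \<le> n \<Longrightarrow> NN n C z = NB z C"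
  unfolding NN_def NB_def
  by (intro arg_cong[of _ _ int] arg_cong[of _ _ length] filter_cong)
    (use n2 in \<open>auto simp: leqD_def rankD_def lword_def letter_def\<close>)

lemma NB_n: "lword n C \<Longrightarrow> NB n C = int (length C)"
  by (intro NB_eq_length) (auto simp: lword_def letter_def)

text \<open>By \<open>outer_inner\<close> the letters between the pair are those not counted by
  \<open>NB k\<close>. The distance condition of admissibility at k thus reads
  \<open>NB k C <= k\<close>.\<close>

lemma pair_split:
  assumes C: "colw C" and k: "1 \<le> k" "k < n" and p: "p < length C" "C ! p = k" and q: "q < length C" "C ! q = -k"
  shows "\<bar>int q - int p\<bar> = int (length C) - NB k C + 1"
proof -
  have kk: "pos n k = k" "pos n (-k) = 2*n - k" using k by (auto simp: pos_def)
  have "p < q"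
  proof (rule ccontr)
    assume "\<not> p < q"
    moreover have "p \<noteq> q" using p q k by auto
    ultimately have "q < p" by simp
    then have "pos n (C ! q) \<le> pos n (C ! p)"
      using sorted_nth_mono[OF colw_sorted[OF C], of q p] p q by simp
    then show False using p q kk k by simp
  qed
  define a b c where "a = take p C" "b = take (q - p - 1) (drop (p+1) C)" "c = drop (q+1) C"
  have "drop (p+1) C = b @ drop (q - p - 1) (drop (p+1) C)" by (simp add: a_b_c_def del: drop_drop)
  also have "drop (q - p - 1) (drop (p+1) C) = drop q C" using \<open>p < q\<close> by simp
  also have "drop q C = (-k) # c" using q by (metis Cons_nth_drop_Suc Suc_eq_plus1 a_b_c_def(3))
  finally have "C = a @ [k] @ b @ [-k] @ c"
    using p by (metis Cons_nth_drop_Suc Suc_eq_plus1 a_b_c_def(1) append_Cons append_Nil append_take_drop_id)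
  note d = this
  note oi = outer_inner[OF k C[unfolded d]]
  have "NB k a = int (length a)" "NB k c = int (length c)" "NB k b = 0"
    using oi by (force intro!: NB_eq_length NB_eq_0)+
  then have "NB k C = int (length a) + int (length c) + 2" using d k by simp
  moreover have "length C = length a + length b + length c + 2" using d by simp
  moreover have "length a = p" "int (length b) = int q - int p - 1"
    using \<open>p < q\<close> p q by (auto simp: a_b_c_def)
  ultimately show ?thesis using \<open>p < q\<close> by linarith
qed

lemma colw_count_le_1:
  assumes C: "colw C" and k: "1 \<le> k" "k < n" and x: "\<bar>x\<bar> = k"
  shows "length (filter (\<lambda>y. y = x) C) \<le> 1"
proof (cases "x \<in> set C")
  case True
  then obtain u v where C': "C = u @ [x] @ v" by (auto dest: split_list)
  have "pos n x \<noteq> n" using x k by (auto simp: pos_def)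
  then have "x \<notin> set u" "x \<notin> set v" using colw_split(3,4)[OF C[unfolded C']] by auto
  then show ?thesis using C' by (auto simp: filter_empty_conv)
next
  case False
  then have "filter (\<lambda>y. y = x) C = []" by (auto simp: filter_empty_conv)
  then show ?thesis by simp
qed

lemma NB_pair:
  assumes C: "colw C" and k: "1 \<le> k" "k < n"
  shows "k \<in> set C \<and> -k \<in> set C \<or> NB k C \<le> NB (k-1) C + 1" "NB k C \<le> NB (k-1) C + 2"
proof -
  have "length (filter (\<lambda>x. \<bar>x\<bar> = k) C) = length (filter (\<lambda>y. y = k) C) + length (filter (\<lambda>y. y = -k) C)"
    using k by (induction C) auto
  then have N: "NB k C = NB (k-1) C + int (length (filter (\<lambda>y. y = k) C)) + int (length (filter (\<lambda>y. y = -k) C))"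
    using NB_step[of k C] by simp
  have c: "length (filter (\<lambda>y. y = k) C) \<le> 1" "length (filter (\<lambda>y. y = -k) C) \<le> 1"
    using colw_count_le_1[OF C k, of k] colw_count_le_1[OF C k, of "-k"] k by auto
  show "NB k C \<le> NB (k-1) C + 2" using N c by linarith
  show "k \<in> set C \<and> -k \<in> set C \<or> NB k C \<le> NB (k-1) C + 1"
  proof (cases "k \<in> set C \<and> -k \<in> set C")
    case False
    then have "filter (\<lambda>y. y = k) C = [] \<or> filter (\<lambda>y. y = -k) C = []" by (auto simp: filter_empty_conv)
    then show ?thesis using N c by auto
  qed simp
qed

text \<open>Admissibility bounds \<open>NB k\<close> directly only where both k and -k occur. At
  other k < n the count grows by at most one from k-1 to k, so the bound follows by induction from
  \<open>NB 0 C = 0\<close>; at n it is the bound on the height.\<close>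

lemma adm_col_iff:
  assumes C: "colw C"
  shows "adm_col n C \<longleftrightarrow> (\<forall>k. 1 \<le> k \<and> k \<le> n \<longrightarrow> NB k C \<le> k)"
proof
  assume A: "adm_col n C"
  have len: "int (length C) \<le> n" using A by (simp add: adm_col_def)
  have "NB (int k) C \<le> int k" if "int k < n" for k using that
  proof (induction k)
    case 0
    then show ?case using NB_0[OF colw_lword[OF C]] by simp
  next
    case (Suc k)
    have k: "1 \<le> int (Suc k)" "int (Suc k) < n" using Suc.prems by auto
    have IH: "NB (int (Suc k) - 1) C \<le> int k" using Suc by simp
    show ?case
    proof (cases "int (Suc k) \<in> set C \<and> - int (Suc k) \<in> set C")
      case True
      then obtain p q where pq: "p < length C" "C ! p = int (Suc k)" "q < length C" "C ! q = - int (Suc k)"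
        by (meson in_set_conv_nth)
      have "1 \<le> C ! p \<and> C ! p \<le> n \<and> C ! q = - (C ! p)" using pq k by simp
      then have "\<bar>int q - int p\<bar> \<ge> int (length C) - C ! p + 1"
        using A pq unfolding adm_col_def by blast
      then show ?thesis using pair_split[OF C k pq] pq(2) by linarith
    next
      case False
      then show ?thesis using NB_pair(1)[OF C k] IH by auto
    qed
  qed
  then have "NB k C \<le> k" if "1 \<le> k" "k < n" for k using that by (metis nonneg_int_cases order_trans zero_le_one)
  moreover have "NB n C \<le> n" using NB_n[OF colw_lword[OF C]] len by simp
  ultimately show "\<forall>k. 1 \<le> k \<and> k \<le> n \<longrightarrow> NB k C \<le> k" by (metis order_le_less)
next
  assume A: "\<forall>k. 1 \<le> k \<and> k \<le> n \<longrightarrow> NB k C \<le> k"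
  have len: "int (length C) \<le> n" using A[rule_format, of n] NB_n[OF colw_lword[OF C]] n2 by simp
  have "\<bar>int q - int p\<bar> \<ge> int (length C) - C ! p + 1"
    if pq: "p < length C" "q < length C" "1 \<le> C ! p" "C ! p \<le> n" "C ! q = - (C ! p)" for p q
  proof (cases "C ! p < n")
    case True
    then show ?thesis using pair_split[OF C pq(3) True pq(1) refl pq(2,5)] A pq(3,4) by force
  next
    \<comment> \<open>For the letter n the required distance is at most 1, because the height is at
      most n.\<close>
    case False
    have "p \<noteq> q" using pq by auto
    then show ?thesis using False pq len by linarith
  qed
  then show "adm_col n C" using C len by (auto simp: adm_col_def is_col_iff)
qed

lemma colw_factor: "colw (a @ u @ b) \<Longrightarrow> colw u"
  by (simp add: colw_append)

lemma badcol_ends: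
  assumes bad: "badcol z w" and w: "w = a @ [s] @ b @ [-s] @ c" and s: "\<bar>s\<bar> = z"
  shows "\<bar>hd w\<bar> \<le> z" "\<bar>last w\<bar> \<le> z"
proof -
  have col: "colw w" and z: "1 \<le> z" "z \<le> n" using bad by (auto simp: badcol_def)
  have l: "\<bar>x\<bar> \<le> n" if "x \<in> set w" for x using colw_lword[OF col] that by (auto simp: lword_def letter_def)
  have "\<bar>hd w\<bar> \<le> z \<and> \<bar>last w\<bar> \<le> z"
  proof (cases "z = n")
    case True
    have "w \<noteq> []" using w by simp
    then have "hd w \<in> set w" "last w \<in> set w" by auto
    then show ?thesis using l True by blast
  next
    case False
    then have zn: "z < n" using z by simp
    have c1: "colw (a @ [s] @ (b @ [-s] @ c))" using col w by simp
    have sz: "s = z" using colw_split(2)[OF c1, of "-s"] s zn z by (auto simp: pos_def abs_if split: if_splits)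
    note oi = outer_inner[OF z(1) zn, of a b c] 
    have "\<bar>hd w\<bar> \<le> z"
      using oi(1) col w sz s by (cases a) force+
    moreover have "\<bar>last w\<bar> \<le> z"
      using oi(2) col w sz s by (cases c rule: rev_cases) force+
    ultimately show ?thesis by simp
  qed
  then show "\<bar>hd w\<bar> \<le> z" "\<bar>last w\<bar> \<le> z" by auto
qed

text \<open>A proper factor misses the first or the last letter of the column. Both are counted by
  \<open>NB k\<close> for all k >= z, so the excess of one disappears there.\<close>

lemma badcol_factors:
  assumes bad: "badcol z w" and w: "w = a @ [s] @ b @ [-s] @ c" and s: "\<bar>s\<bar> = z"
    and f: "w = a' @ u @ b'" "u \<noteq> w"
  shows "adm_col n u"
proof -
  have col: "colw u" using bad f(1) colw_factor by (auto simp: badcol_def)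
  have "NB k u \<le> k" if k: "1 \<le> k" "k \<le> n" for k
  proof (cases "k < z")
    case True
    have "NB k u \<le> NB k w" using f(1) NB_nonneg[of k a'] NB_nonneg[of k b'] by simp
    then show ?thesis using badcol_lower[OF bad k(1) True] by simp
  next
    case False
    have ne: "a' \<noteq> [] \<or> b' \<noteq> []" using f by auto
    have "NB k u + 1 \<le> NB k w"
    proof (cases "a' = []")
      case False
      then have "hd w \<in> set a'" using f by (cases a') auto
      then have "1 \<le> NB k a'" using NB_ge badcol_ends(1)[OF bad w s] \<open>\<not> k < z\<close> by force
      then show ?thesis using f(1) NB_nonneg[of k b'] by simp
    next
      case True
      then have "b' \<noteq> []" using ne by simp
      then have "last w \<in> set b'" using f by simp
      then have "1 \<le> NB k b'" using NB_ge badcol_ends(2)[OF bad w s] \<open>\<not> k < z\<close> by force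
      then show ?thesis using f(1) NB_nonneg[of k a'] by simp
    qed
    then show ?thesis using badcol_upper[OF bad _ k(2)] False by force
  qed
  then show ?thesis using adm_col_iff[OF col] by simp
qed

lemma contr_baseD: assumes "contr p q" shows "baseD n p q"
proof -
  obtain z s a b c where bad: "badcol z p" and p: "p = a @ [s] @ b @ [-s] @ c" and q: "q = a @ b @ c"
    and s: "\<bar>s\<bar> = z" and zn: "z = n \<longrightarrow> b = []"
    using assms unfolding contr_def by blast
  have col: "colw p" and z: "1 \<le> z" "z \<le> n" "NB z p = z + 1" using bad by (auto simp: badcol_def)
  have lw: "lword n p" using col by (rule colw_lword)
  have nadm: "\<not> adm_col n p" using adm_col_iff[OF col] z by force
  have fac: "\<forall>a u b. p = a @ u @ b \<and> u \<noteq> p \<longrightarrow> adm_col n u" using badcol_factors[OF bad p s] by blast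
  have mem: "z \<in> set p" "-z \<in> set p" using p s by (auto simp: abs_if split: if_splits)
  have NNz: "NN n p z > z" using NN_eq[OF lw z(1,2)] z(3) by simp
  have low: "\<forall>z'. 1 \<le> z' \<and> z' \<le> n \<and> z' \<in> set p \<and> -z' \<in> set p \<and> NN n p z' > z' \<longrightarrow> z \<le> z'"
    using NN_eq[OF lw] badcol_lower[OF bad] by force
  have ss: "s = z \<or> s = -z" using s by linarith
  show ?thesis
  proof (cases "z = n")
    case False
    then have "z < n" using z by simp
    moreover have "p = a @ [z] @ b @ [-z] @ c \<or> p = a @ [-z] @ b @ [z] @ c" using p ss by auto
    ultimately have "baseD n p (a @ b @ c)"
      using baseD.R5a[OF _ nadm fac z(1,2) mem NNz low] col is_col_iff by blast
    then show ?thesis using q by simp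
  next
    case True
    have "p = a @ [n, -n] @ c \<or> p = a @ [-n, n] @ c" using p ss zn True by auto
    then have "baseD n p (a @ c)"
      using baseD.R5b[OF _ nadm fac] mem NNz low col is_col_iff True by blast
    then show ?thesis using q zn True by simp
  qed
qed

text \<open>Without its first letter the column is admissible, so the excess of every
  \<open>NB k\<close> is at most one. A first violation below z would occur at some k with both k
  and -k present, against the minimality of z.\<close>

lemma badcolI:
  assumes col: "is_col n w" and nadm: "\<not> adm_col n w"
    and fac: "\<forall>a u b. w = a @ u @ b \<and> u \<noteq> w \<longrightarrow> adm_col n u"
    and z: "1 \<le> z" "z \<le> n" "z \<in> set w" "-z \<in> set w" "NN n w z > z"
    and low: "\<forall>z'. 1 \<le> z' \<and> z' \<le> n \<and> z' \<in> set w \<and> -z' \<in> set w \<and> NN n w z' > z' \<longrightarrow> z \<le> z'"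
  shows "badcol z w"
proof -
  have c: "colw w" using col is_col_iff by simp
  have lw: "lword n w" using c by (rule colw_lword)
  obtain x v where w: "w = x # v" using z(3) by (cases w) auto
  have "w = [x] @ v @ [] \<and> v \<noteq> w" using w by simp
  then have "adm_col n v" using fac by blast
  moreover have cv: "colw v" using c w by (simp add: colw_Cons)
  ultimately have v: "\<forall>k. 1 \<le> k \<and> k \<le> n \<longrightarrow> NB k v \<le> k" using adm_col_iff by blast
  have col: "NB k w \<le> k + 1" if "1 \<le> k" "k \<le> n" for k using v that w by force
  have "NB (int k) w \<le> int k" if "int k < z" for k using that
  proof (induction k)
    case 0
    then show ?case using NB_0[OF lw] by simp
  next
    case (Suc k)
    have k: "1 \<le> int (Suc k)" "int (Suc k) < n" using Suc.prems z by auto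
    show ?case
    proof (rule ccontr)
      assume neg: "\<not> ?case"
      moreover have "NB (int (Suc k) - 1) w \<le> int k" using Suc by simp
      ultimately have "int (Suc k) \<in> set w \<and> - int (Suc k) \<in> set w" using NB_pair(1)[OF c k] by auto
      moreover have "NN n w (int (Suc k)) > int (Suc k)" using NN_eq[OF lw, of "int (Suc k)"] k neg by simp
      ultimately have "z \<le> int (Suc k)" using low k by (metis order_less_imp_le)
      then show False using Suc.prems by simp
    qed
  qed
  then have "NB k w \<le> k" if "1 \<le> k" "k < z" for k using that by (metis nonneg_int_cases order_trans zero_le_one)
  moreover have "NB z w = z + 1" using col[of z] NN_eq[OF lw z(1,2)] z by simp
  ultimately show ?thesis using c z col by (auto simp: badcol_def)
qed


lemma pos_sum: "letter n x \<Longrightarrow> letter n z \<Longrightarrow> pos n x < pos n z \<Longrightarrow> pos n x + pos n z = 2*n \<longleftrightarrow> x = -z"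
  unfolding pos_def letter_def by (cases "0 < x"; cases "0 < z"; simp; linarith)

lemma R2_cond:
  assumes "letter n x" "letter n y" "lessD n 1 x" "lessD n x n" "leqD n x y" "leqD n y (-x)"
  shows "1 < x" "x < n" "x \<le> pos n y" "pos n y \<le> 2*n - x"
proof -
  have one: "letter n 1" "pos n 1 = 1" using n2 by (simp_all add: letter_def pos_def)
  have "pos n 1 < pos n x" using lessD_pos[OF one(1) assms(1)] assms(3) by (rule iffD1)
  then have x1: "1 < pos n x" using one(2) by (rule back_subst[of "\<lambda>t. t < _"])
  have "pos n x < pos n n" using lessD_pos[OF assms(1) letter_n(1)] assms(4) by (rule iffD1)
  then have "pos n x < n" unfolding letter_n(5) .
  then have x0: "0 < x \<and> x < n" by (rule pos_lt_n[OF assms(1)])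
  then have k: "pos n x = x" "pos n (-x) = 2*n - x" unfolding pos_def by simp_all
  show "1 < x" "x < n" using x0 x1 unfolding k(1) by blast+
  have "x = y \<or> pos n x < pos n y" using leqD_pos[OF assms(1,2)] assms(5) by (rule iffD1)
  then show "x \<le> pos n y" using k(1) by (elim disjE) simp_all
  have "letter n (-x)" using letter_uminus assms(1) by blast
  from leqD_pos[OF assms(2) this] have "y = -x \<or> pos n y < pos n (-x)" using assms(6) by (rule iffD1)
  then show "pos n y \<le> 2*n - x" using k(2) by (elim disjE) simp_all
qed

lemma R3_cond:
  assumes "letter n x" "leqD n x (n-1)"
  shows "pos n x < n" "n < pos n (-x)"
proof -
  have "x = n - 1 \<or> pos n x < pos n (n-1)" using assms leqD_pos[OF assms(1) letter_n(3)] by blast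
  then show "pos n x < n" using letter_n(7) by (elim disjE) simp_all
  then show "n < pos n (-x)" using pos_uminus[OF assms(1)] by simp
qed

lemma baseD_base3_or_contr: assumes "baseD n p q" shows "base3 n p q \<or> contr p q"
  using assms
proof cases
  case (R1a x y z)
  then have "x = y \<or> pos n x < pos n y" "pos n y < pos n z" by (simp_all add: leqD_pos lessD_pos)
  moreover from this have "pos n x + pos n z \<noteq> 2*n" using pos_sum[of x z] R1a by auto
  ultimately show ?thesis using base3_R1a[of x y z] R1a by (simp del: base3.simps)
next
  case (R1b x y z)
  then have "pos n x < pos n y" "y = z \<or> pos n y < pos n z" by (simp_all add: leqD_pos lessD_pos)
  moreover from this have "pos n x + pos n z \<noteq> 2*n" using pos_sum[of x z] R1b by auto
  ultimately show ?thesis using base3_R1b[of x y z] R1b by (simp del: base3.simps)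
next
  case (R2a x y)
  then show ?thesis using base3_R2a[of y x] R2_cond[of x y] by (simp del: base3.simps)
next
  case (R2b x y)
  then show ?thesis using base3_R2b[of y x] R2_cond[of x y] by (simp del: base3.simps)
next
  case (R3a x)
  then show ?thesis using base3_R3a[of "-x" "-n"] R3_cond[of x] by (simp del: base3.simps add: letter_uminus)
next
  case (R3b x)
  then show ?thesis using base3_R3a[of "-x" n] R3_cond[of x] by (simp del: base3.simps add: letter_uminus)
next
  case (R3c x)
  then show ?thesis using base3_R3b[of x "-n"] R3_cond[of x] by (simp del: base3.simps)
next
  case (R3d x)
  then show ?thesis using base3_R3b[of x n] R3_cond[of x] by (simp del: base3.simps)
next
  case (R5a z a b c)
  then have "badcol z p" by (intro badcolI) auto
  moreover have "\<exists>s. p = a @ [s] @ b @ [-s] @ c \<and> \<bar>s\<bar> = z"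
  proof (cases "p = a @ [z] @ b @ [-z] @ c")
    case True
    then show ?thesis using R5a by (intro exI[of _ z]) simp
  next
    case False
    then show ?thesis using R5a by (intro exI[of _ "-z"]) simp
  qed
  ultimately show ?thesis unfolding contr_def using R5a by blast
next
  case (R5b a b)
  then have "badcol n p" using n2 by (intro badcolI) auto
  moreover have "\<exists>s. p = a @ [s] @ [] @ [-s] @ b \<and> \<bar>s\<bar> = n"
  proof (cases "p = a @ [n, -n] @ b")
    case True
    then show ?thesis using n2 by (intro exI[of _ n]) simp
  next
    case False
    then show ?thesis using R5b n2 by (intro exI[of _ "-n"]) simp
  qed
  moreover have "q = a @ [] @ b" using R5b by simp
  ultimately show ?thesis unfolding contr_def by blast
qed (use base3_R4a[of n] base3_R4a[of "-n"] base3_R4b[of n] base3_R4b[of "-n"] in \<open>simp_all del: base3.simps\<close>)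

lemma letter_pos_bounds:
  assumes y: "letter n y" and x: "1 < x" "x < n" "x \<le> pos n y" "pos n y \<le> 2*n - x"
  shows "leqD n x y \<and> leqD n y (-x) \<and> lessD n 1 x \<and> lessD n x n"
proof -
  have l: "letter n x" "letter n (-x)" "letter n 1" using x letter_x by (auto simp: letter_def)
  have k: "pos n x = x" "pos n (-x) = 2*n - x" "pos n 1 = 1" using x by (auto simp: pos_def)
  have "y = x" if "pos n y = x" using that y x by (simp add: pos_def letter_def split: if_splits)
  moreover have "y = -x" if "pos n y = 2*n - x" using that y x by (simp add: pos_def letter_def split: if_splits)
  ultimately show ?thesis
    using x k leqD_pos[OF l(1) y] leqD_pos[OF y l(2)] lessD_pos[OF l(3,1)] lessD_pos[OF l(1) letter_n(1)] letter_n(5)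
    by linarith
qed

lemma base3_baseD: assumes "base3 n p q" shows "baseD n p q"
  using assms
proof (cases rule: base3_cases)
  case (R1a x y z)
  then have "pos n x < pos n z" by auto
  then have "x \<noteq> -z" using R1a pos_sum[of x z] by auto
  then show ?thesis using R1a baseD.R1a[of n x y z] by (simp add: leqD_pos lessD_pos)
next
  case (R1b x y z)
  then have "pos n x < pos n z" by auto
  then have "x \<noteq> -z" using R1b pos_sum[of x z] by auto
  then show ?thesis using R1b baseD.R1b[of n x y z] by (simp add: leqD_pos lessD_pos)
next
  case (R2a x y)
  then show ?thesis using baseD.R2a[of n x y] letter_pos_bounds[of y x] letter_x[of x] by simp
next
  case (R2b x y)
  then show ?thesis using baseD.R2b[of n x y] letter_pos_bounds[of y x] letter_x[of x] by simp
next
  case (R3a x s)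
  then have "-n < x" "x < 0" using pos_gt_n by auto
  then have "leqD n (-x) (n-1)" using R3a by (auto simp: leqD_def rankD_def)
  then show ?thesis using R3a baseD.R3a[of n "-x"] baseD.R3b[of n "-x"] by (auto simp: letter_uminus)
next
  case (R3b x s)
  then have "0 < x" "x < n" using pos_lt_n by auto
  then have "leqD n x (n-1)" using R3b by (auto simp: leqD_def rankD_def)
  then show ?thesis using R3b baseD.R3c[of n x] baseD.R3d[of n x] by auto
next
  case (R4a s)
  then show ?thesis using baseD.R4a[of n] baseD.R4b[of n] by auto
next
  case (R4b s)
  then show ?thesis using baseD.R4c[of n] baseD.R4d[of n] by auto
qed

lemma stepD_iff: "stepD n u v \<longleftrightarrow> cstep u v"
proof -
  have "baseD n p q \<or> baseD n q p \<longleftrightarrow> base_rel p q" for p q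
    using baseD_base3_or_contr base3_baseD contr_baseD unfolding base_rel_def by blast
  then show ?thesis unfolding stepD_def cstep_def by simp
qed


section \<open>The congruence as an equivalence compatible with operators, contexts and
  \<open>flip\<close>\<close>

abbreviation cong :: "int list \<Rightarrow> int list \<Rightarrow> bool" where "cong \<equiv> congD n"

lemma cong_refl [simp]: "cong w w" by (simp add: congD_def)
lemma cong_trans [trans]: "cong u v \<Longrightarrow> cong v w \<Longrightarrow> cong u w" by (simp add: congD_def)

lemma cstep_sym: "cstep u v \<Longrightarrow> cstep v u"
  unfolding cstep_def using base_rel_sym by blast

lemma cstep_cong: "cstep u v \<Longrightarrow> cong u v"
  by (simp add: congD_def r_into_rtranclp stepD_iff)

lemma cong_sym: "cong u v \<Longrightarrow> cong v u"
proof -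
  have "stepD n = cstep" by (intro ext) (rule stepD_iff)
  moreover have "symp cstep" using cstep_sym by (rule sympI)
  ultimately show "cong u v \<Longrightarrow> cong v u"
    unfolding congD_def using symp_rtranclp by (metis sympD)
qed

lemma cong_ind:
  assumes "cong u v" "\<And>w. P w w" "\<And>u v w. P u v \<Longrightarrow> P v w \<Longrightarrow> P u w" "\<And>u v. cstep u v \<Longrightarrow> P u v"
  shows "P u v"
  using assms(1) unfolding congD_def
proof (induction rule: rtranclp_induct)
  case base
  show ?case by (rule assms(2))
next
  case (step v w)
  have "cstep v w" using step.hyps(2) stepD_iff by blast
  then show ?case using assms(3)[OF step.IH] assms(4) by blast
qed

lemma cong_phi: "cong u v \<Longrightarrow> phi n i u = phi n i v"
  by (erule cong_ind) (rule refl, erule (1) trans, rule cstep_ok)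

lemma cong_eps: "cong u v \<Longrightarrow> eps n i u = eps n i v"
  by (erule cong_ind) (rule refl, erule (1) trans, rule cstep_ok)

lemma rel_option_cong_trans: "rel_option cong x y \<Longrightarrow> rel_option cong y z \<Longrightarrow> rel_option cong x z"
  by (cases x; cases y; cases z; simp) (erule (1) cong_trans)

lemma cong_fw: "cong u v \<Longrightarrow> rel_option cong (fw n i u) (fw n i v)"
proof (erule cong_ind)
  show "rel_option cong (fw n i w) (fw n i w)" for w by (rule option.rel_refl) simp
  show "rel_option cong (fw n i u) (fw n i v)" if "cstep u v" for u v
    using cstep_ok(3)[OF that] by (rule option.rel_mono_strong) (rule cstep_cong)
qed (rule rel_option_cong_trans)

lemma cong_ew: "cong u v \<Longrightarrow> rel_option cong (ew n i u) (ew n i v)"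
proof (erule cong_ind)
  show "rel_option cong (ew n i w) (ew n i w)" for w by (rule option.rel_refl) simp
  show "rel_option cong (ew n i u) (ew n i v)" if "cstep u v" for u v
    using cstep_ok(4)[OF that] by (rule option.rel_mono_strong) (rule cstep_cong)
qed (rule rel_option_cong_trans)

lemma cong_context: "cong u v \<Longrightarrow> lword n a \<Longrightarrow> lword n b \<Longrightarrow> cong (a @ u @ b) (a @ v @ b)"
proof (erule cong_ind)
  fix u v assume l: "lword n a" "lword n b" and "cstep u v"
  then obtain a' b' p q where "u = a' @ p @ b'" "v = a' @ q @ b'" "lword n a'" "lword n b'" "base_rel p q"
    unfolding cstep_def by blast
  then have "cstep (a @ u @ b) (a @ v @ b)" unfolding cstep_def using l
    by (intro exI[of _ "a @ a'"] exI[of _ "b' @ b"] exI[of _ p] exI[of _ q]) simp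
  then show "cong (a @ u @ b) (a @ v @ b)" by (rule cstep_cong)
qed (rule cong_refl, erule (1) cong_trans)

lemma cong_right: "cong u v \<Longrightarrow> lword n b \<Longrightarrow> cong (u @ b) (v @ b)"
  and cong_left: "cong u v \<Longrightarrow> lword n a \<Longrightarrow> cong (a @ u) (a @ v)"
  using cong_context[of u v "[]" b] cong_context[of u v a "[]"] by simp_all

lemma lword_flip: "lword n (map flip w) \<longleftrightarrow> lword n w"
  by (auto simp: lword_def letter_flip)

lemma cong_flip: "cong u v \<Longrightarrow> cong (map flip u) (map flip v)"
proof (erule cong_ind)
  fix u v assume "cstep u v"
  then obtain a b p q where "u = a @ p @ b" "v = a @ q @ b" "lword n a" "lword n b" "base_rel p q"
    unfolding cstep_def by blast
  then have "cstep (map flip u) (map flip v)" unfolding cstep_def using base_rel_flip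
    by (intro exI[of _ "map flip a"] exI[of _ "map flip b"] exI[of _ "map flip p"] exI[of _ "map flip q"])
      (simp add: lword_flip)
  then show "cong (map flip u) (map flip v)" by (rule cstep_cong)
qed (rule cong_refl, erule (1) cong_trans)

lemma cong_base3: "base3 n p q \<Longrightarrow> cong p q" and cong_contr: "contr p q \<Longrightarrow> cong p q"
proof -
  have "base_rel p q \<Longrightarrow> cong p q"
  proof (rule cstep_cong)
    assume "base_rel p q"
    then show "cstep p q" unfolding cstep_def by (intro exI[of _ "[]"] exI[of _ p] exI[of _ q]) simp
  qed
  then show "base3 n p q \<Longrightarrow> cong p q" "contr p q \<Longrightarrow> cong p q" by (auto simp: base_rel_def)
qed

section \<open>Highest weight words\<close>

lemma pos_letter: "1 \<le> x \<Longrightarrow> x \<le> n \<Longrightarrow> letter n x \<and> pos n x = x"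
  by (auto simp: letter_def pos_def)

lemma pos_lword: "\<forall>t\<in>set L. 1 \<le> t \<and> t \<le> n \<Longrightarrow> lword n L"
  by (auto simp: lword_def letter_def)

text \<open>R1 in the form l t y = l y t with y <= l < t carries y to the left, one letter of the
  column at a time, until it stands behind x.\<close>

lemma cong_move_inner:
  "sorted_wrt (<) (x # L) \<Longrightarrow> (\<forall>t\<in>set (x # L). 1 \<le> t \<and> t \<le> n) \<Longrightarrow> 1 \<le> y \<Longrightarrow> y \<le> x \<Longrightarrow>
    cong ((x # L) @ [y]) ((x # [y]) @ L)"
proof (induction L rule: rev_induct)
  case (snoc t L)
  obtain L' l where L': "x # L = L' @ [l]" by (metis append_butlast_last_id list.distinct(1))
  have lt: "x \<le> l" "l < t" "1 \<le> l" "t \<le> n"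
  proof -
    have "l \<in> set (x # L)" using L' by simp
    moreover have "\<forall>s\<in>set (x # L). x \<le> s \<and> s < t" using snoc.prems(1) by (auto simp: sorted_wrt_append)
    ultimately show "x \<le> l" "l < t" "1 \<le> l" "t \<le> n" using snoc.prems(2) by auto
  qed
  have "base3 n [l,t,y] [l,y,t]"
    using lt snoc.prems pos_letter by (intro base3_R1a) auto
  moreover have lw: "lword n L'" "letter n t"
  proof -
    have "lword n (x # L)" using snoc.prems(2) by (intro pos_lword) simp
    then show "lword n L'" unfolding L' by simp
    show "letter n t" using pos_letter[of t] lt by simp
  qed
  ultimately have "cong (L' @ [l,t,y]) (L' @ [l,y,t])" using cong_left cong_base3 by blast
  then have "cong ((L' @ [l]) @ [t, y]) ((L' @ [l]) @ [y, t])" by simp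
  then have "cong ((x # L @ [t]) @ [y]) (((x # L) @ [y]) @ [t])" unfolding L'[symmetric] by simp
  also have "cong \<dots> (((x # [y]) @ L) @ [t])"
    using snoc.IH snoc.prems lw by (intro cong_right) (auto simp: sorted_wrt_append)
  finally show ?case by simp
qed simp

lemma cong_move_outer:
  "sorted_wrt (<) (L @ [t]) \<Longrightarrow> (\<forall>s\<in>set L. 1 \<le> s) \<Longrightarrow> 1 \<le> t \<Longrightarrow> t \<le> y \<Longrightarrow> y \<le> n \<Longrightarrow>
    cong (L @ [y, t]) ([y] @ L @ [t])"
proof (induction L arbitrary: t rule: rev_induct)
  case (snoc l L)
  have lt: "l < t" "1 \<le> l" "sorted_wrt (<) (L @ [l])"
    using snoc.prems(1,2) by (auto simp: sorted_wrt_append)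
  have lw: "lword n L" "letter n t"
    using snoc.prems lt pos_letter by (force simp: lword_def letter_def sorted_wrt_append)+
  have "base3 n [l,y,t] [y,l,t]"
    using lt snoc.prems pos_letter[of l] pos_letter[of t] pos_letter[of y] by (intro base3_R1b) auto
  then have "cong (L @ [l,y,t]) (L @ [y,l,t])" using cong_left cong_base3 lw by blast
  then have "cong ((L @ [l]) @ [y, t]) ((L @ [y, l]) @ [t])" by simp
  also have "cong \<dots> (([y] @ L @ [l]) @ [t])"
    using snoc.IH[of l] snoc.prems lt lw by (intro cong_right) auto
  finally show ?case by simp
qed simp

abbreviation col :: "int \<Rightarrow> int list" where "col k \<equiv> [1..k]"

lemma col_Suc: "1 \<le> k \<Longrightarrow> col k = col (k - 1) @ [k]"
  by (rule upto_rec2)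

lemma lword_col: "k \<le> n \<Longrightarrow> lword n (col k)"
  by (auto simp: lword_def letter_def)

lemma sorted_col: "sorted_wrt (<) [i..j]"
  by (simp add: sorted_wrt_upto)

text \<open>The letter y travels left up to the entry y of the column. Of the two adjacent copies
  the left one then leaves through 1...(y-1), by R1 in the form l y t = y l t with l < t <=
  y.\<close>

lemma cong_col_letter:
  assumes "1 \<le> y" "y \<le> k" "k \<le> n"
  shows "cong (col k @ [y]) ([y] @ col k)"
proof -
  have u: "col k = col (y-1) @ y # [y+1..k]"
    using assms by (metis upto_split3 diff_add_cancel add_diff_cancel_right' )
  have l: "lword n (col (y-1))" "lword n [y+1..k]" using assms by (auto simp: lword_def letter_def)
  have s: "sorted_wrt (<) (y # [y+1..k])" "sorted_wrt (<) (col (y-1) @ [y])"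
    using sorted_col[of 1 k] sorted_col[of "y+1" k] u by (auto simp: sorted_wrt_append)
  have "cong ((y # [y+1..k]) @ [y]) ((y # [y]) @ [y+1..k])"
    using s assms by (intro cong_move_inner) auto
  then have "cong (col (y-1) @ ((y # [y+1..k]) @ [y])) (col (y-1) @ ((y # [y]) @ [y+1..k]))"
    using l by (intro cong_left)
  then have "cong (col k @ [y]) ((col (y-1) @ [y, y]) @ [y+1..k])" using u by simp
  also have "cong \<dots> (([y] @ col (y-1) @ [y]) @ [y+1..k])"
    using s assms l by (intro cong_right cong_move_outer) auto
  finally show ?thesis using u by simp
qed

lemma cong_col_word: "(\<forall>y\<in>set v. 1 \<le> y \<and> y \<le> k) \<Longrightarrow> k \<le> n \<Longrightarrow> cong (col k @ v) (v @ col k)"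
proof (induction v rule: rev_induct)
  case (snoc y v)
  have l: "lword n v" "letter n y" "lword n (col k)" using snoc.prems by (auto simp: lword_def letter_def)
  have "cong ((col k @ v) @ [y]) ((v @ col k) @ [y])" using snoc l by (intro cong_right) auto
  moreover have "cong (v @ (col k @ [y])) (v @ ([y] @ col k))" using snoc l by (intro cong_left cong_col_letter) auto
  ultimately show ?case using cong_trans[of "col k @ v @ [y]" "v @ col k @ [y]" "v @ y # col k"] by simp
qed simp

definition cols :: "int list \<Rightarrow> int list" where
  "cols ks = concat (map col ks)"

definition heights :: "int list \<Rightarrow> bool" where
  "heights ks \<longleftrightarrow> (\<forall>k\<in>set ks. 1 \<le> k \<and> k \<le> n)"

lemma cols_simps [simp]: "cols [] = []" "cols (k # ks) = col k @ cols ks" "cols (ks @ ls) = cols ks @ cols ls"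
  by (auto simp: cols_def)

lemma heights_simps [simp]: "heights []" "heights (k # ks) \<longleftrightarrow> 1 \<le> k \<and> k \<le> n \<and> heights ks"
  "heights (ks @ ls) \<longleftrightarrow> heights ks \<and> heights ls"
  by (auto simp: heights_def)

lemma lword_cols: "heights ks \<Longrightarrow> lword n (cols ks)"
  by (induction ks) (auto simp: lword_col)

lemma cong_col_col: "1 \<le> j \<Longrightarrow> 1 \<le> k \<Longrightarrow> j \<le> n \<Longrightarrow> k \<le> n \<Longrightarrow> cong (col j @ col k) (col k @ col j)"
  using cong_col_word[of "col k" j] cong_col_word[of "col j" k] cong_sym by (cases "j \<le> k") auto

lemma cong_col_cols: "heights ls \<Longrightarrow> 1 \<le> k \<Longrightarrow> k \<le> n \<Longrightarrow> cong (col k @ cols ls) (cols ls @ col k)"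
proof (induction ls)
  case (Cons l ls)
  have "cong ((col k @ col l) @ cols ls) ((col l @ col k) @ cols ls)"
    using Cons.prems lword_cols by (intro cong_right cong_col_col) auto
  also have "(col l @ col k) @ cols ls = col l @ (col k @ cols ls)" by simp
  also have "cong \<dots> (col l @ (cols ls @ col k))"
    using Cons lword_col by (intro cong_left) auto
  finally show ?case by simp
qed simp

lemma cong_cols_last: "heights ks \<Longrightarrow> k \<in> set ks \<Longrightarrow> cong (cols ks) (cols (remove1 k ks) @ col k)"
proof (induction ks)
  case (Cons j ks)
  show ?case
  proof (cases "k = j")
    case True
    then show ?thesis using cong_col_cols[of ks k] Cons.prems by simp
  next
    case False
    then have "cong (col j @ cols ks) (col j @ (cols (remove1 k ks) @ col k))"
      using Cons by (intro cong_left) (auto simp: lword_col)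
    then show ?thesis using False by simp
  qed
qed simp

lemma heights_remove1: "heights ks \<Longrightarrow> heights (remove1 k ks)"
  using set_remove1_subset[of k ks] by (auto simp: heights_def)

lemma cong_cols_perm:
  "heights ks \<Longrightarrow> (\<And>k. count_list ks k = count_list ls k) \<Longrightarrow> cong (cols ks) (cols ls)"
proof (induction ls arbitrary: ks rule: rev_induct)
  case Nil
  have "ks = []"
  proof (cases ks)
    case (Cons a l)
    then show ?thesis using Nil.prems(2)[of a] by simp
  qed simp
  then show ?case by simp
next
  case (snoc k ls)
  have "count_list ks k \<noteq> 0" using snoc.prems(2)[of k] by simp
  then have k: "k \<in> set ks" by (simp add: count_list_0_iff)
  have c: "count_list (remove1 k ks) j = count_list ls j" for j
  proof -
    have "count_list ks j = count_list (remove1 k ks) j + (if j = k then 1 else 0)"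
      using k by (induction ks) auto
    then show ?thesis using snoc.prems(2)[of j] by (cases "j = k") simp_all
  qed
  have "cong (cols ks) (cols (remove1 k ks) @ col k)" using snoc.prems(1) k by (rule cong_cols_last)
  also have "cong (cols (remove1 k ks)) (cols ls)" using heights_remove1[OF snoc.prems(1)] c by (rule snoc.IH)
  then have "cong (cols (remove1 k ks) @ col k) (cols ls @ col k)"
    using snoc.prems(1) k by (intro cong_right lword_col) (simp_all add: heights_def)
  finally show ?case by simp
qed

text \<open>In fundamental weights, 1...k has weight omega_k for 1 <= k <= n-2, omega_(n-1) +
  omega_n for k = n-1, and 2 omega_n for k = n.\<close>

lemma col_eps_phi:
  assumes "0 \<le> k" "k \<le> n" "1 \<le> i" "i \<le> n"
  shows "eps n i (col k) = 0 \<and>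
    phi n i (col k) = (if i < n then (if k = i then 1 else 0) else if k = n then 2 else if k = n - 1 then 1 else 0)"
proof -
  have "k \<le> n \<longrightarrow> ?thesis" using assms(1)
  proof (induction k rule: int_ge_induct)
    case base
    then show ?case using n2 assms by auto
  next
    case (step k)
    have u: "col (k+1) = col k @ [k+1]" using step(1) col_Suc[of "k+1"] by simp
    show ?case
    proof (cases "i < n")
      case True
      then have "phL n i (k+1) = (if k + 1 = i then 1 else 0)" "epL n i (k+1) = (if k = i then 1 else 0)"
        using step(1) assms by (auto simp: phL_def epL_def fL_def eL_def)
      then show ?thesis using step True u by (auto simp: eps_append phi_append)
    next
      case False
      then have "i = n" using assms by simp
      then have "k + 1 \<le> n \<Longrightarrow> phL n i (k+1) = (if k + 1 = n \<or> k + 1 = n - 1 then 1 else 0)"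
        "k + 1 \<le> n \<Longrightarrow> epL n i (k+1) = 0"
        using step(1) n2 by (auto simp: phL_def epL_def fL_def eL_def)
      then show ?thesis using step False u n2 by (auto simp: eps_append phi_append)
    qed
  qed
  then show ?thesis using assms(2) by blast
qed

lemma cols_eps: "heights ks \<Longrightarrow> eps n i (cols ks) = 0"
proof (induction ks)
  case (Cons k ks)
  then show ?case
    using col_eps_phi[of k i] colour_out(3)[of i "col k"] by (cases "1 \<le> i \<and> i \<le> n") (auto simp: eps_append)
qed simp

lemma cols_phi:
  "heights ks \<Longrightarrow> 1 \<le> i \<Longrightarrow> i \<le> n \<Longrightarrow>
    phi n i (cols ks) = (if i < n then count_list ks i else 2 * count_list ks n + count_list ks (n-1))"
proof (induction ks)
  case (Cons k ks)
  have "phi n i (cols (k # ks)) = phi n i (cols ks) + phi n i (col k)"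
    using Cons.prems(1) cols_eps[of ks i] by (simp add: phi_append)
  moreover have "phi n i (col k) = (if i < n then (if k = i then 1 else 0) else if k = n then 2 else if k = n - 1 then 1 else 0)"
    using col_eps_phi[of k i] Cons.prems by simp
  moreover have "phi n i (cols ks) = (if i < n then count_list ks i else 2 * count_list ks n + count_list ks (n-1))"
    using Cons.IH Cons.prems by simp
  ultimately show ?case by simp
qed simp

section \<open>Reduction of highest weight words to products of columns\<close>

lemma NB_col: "0 \<le> k \<Longrightarrow> 0 \<le> j \<Longrightarrow> NB j (col k) = min j k"
proof (induction k rule: int_ge_induct)
  case (step k)
  then show ?case using col_Suc[of "k+1"] by auto
qed simp

lemma colw_col: "0 \<le> k \<Longrightarrow> k \<le> n \<Longrightarrow> colw (col k)"
proof (induction k rule: int_ge_induct)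
  case (step k)
  have "col k \<noteq> [] \<Longrightarrow> last (col k) = k" using col_Suc[of k] step(1) by (cases "k = 0") auto
  then show ?case using col_Suc[of "k+1"] step
    by (cases "k = 0") (auto simp: colw_append adj_def pos_def letter_def)
qed simp

lemma cong_col_cancel:
  assumes "1 \<le> k" "k \<le> n"
  shows "cong (col k @ [-k]) (col (k-1))"
proof -
  have u: "col k = col (k-1) @ [k]" using col_Suc assms by simp
  have "adj k (-k)" "last (col k) = k" using assms u by (auto simp: adj_def pos_def)
  then have "colw (col k @ [-k])"
    using assms colw_col[of k] u colw_append[of "col k" "[-k]"] by (simp add: letter_def)
  then have "badcol k (col k @ [-k])" using assms NB_col[of k] by (auto simp: badcol_def)
  then have "contr (col k @ [-k]) (col (k-1))"
    unfolding contr_def using u assms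
    by (intro exI[of _ k] exI[of _ "col (k-1)"] exI[of _ "[]"]) auto
  then show ?thesis by (rule cong_contr)
qed

lemma map_flip_col: "k < n \<Longrightarrow> map flip (col k) = col k"
  by (rule map_idI) (auto simp: flip_def)

lemma map_flip_cols: "(\<forall>k\<in>set ks. k < n) \<Longrightarrow> map flip (cols ks) = cols ks"
  by (induction ks) (auto simp: map_flip_col)

text \<open>Readings of \<open>TY\<close> and \<open>TYm\<close> with the columns in any order:
  \<open>flip\<close> turns 1...n into 1...(n-1), -n and fixes the shorter columns.\<close>

definition canonical :: "int list \<Rightarrow> bool" where
  "canonical c \<longleftrightarrow> (\<exists>ks. heights ks \<and> (c = cols ks \<or> c = map flip (cols ks)))"

text \<open>The bound on \<open>epL\<close> provides a column that fits y: of height y-1 if y > 1,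
  of height -y if -n < y < 0, of height n or n-1 if y = -n. This column commutes to the end, where y
  prolongs it or cancels its last letter.\<close>

lemma cols_snoc_canonical:
  assumes ks: "heights ks" and y: "letter n y" and hw: "\<And>i. epL n i y \<le> phi n i (cols ks)"
  shows "\<exists>c. canonical c \<and> cong (cols ks @ [y]) c"
proof -
  have lK: "lword n (cols ls)" if "heights ls" for ls using lword_cols that .
  have rem: "cong (cols ks @ [y]) (cols (remove1 k ks) @ (col k @ [y]))" if "k \<in> set ks" for k
    using cong_right[OF cong_cols_last[OF ks that], of "[y]"] y by simp
  have cancel: "\<exists>c. canonical c \<and> cong (cols ks @ [y]) c" if k: "k \<in> set ks" and yk: "y = -k" for k
  proof -
    have kk: "1 \<le> k" "k \<le> n" using ks k by (auto simp: heights_def)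
    have "cong (cols (remove1 k ks) @ (col k @ [y])) (cols (remove1 k ks) @ col (k-1))"
      using cong_col_cancel[OF kk] yk lK heights_remove1[OF ks] by (intro cong_left) auto
    then have c: "cong (cols ks @ [y]) (cols (remove1 k ks) @ col (k-1))" using rem[OF k] cong_trans by blast
    show ?thesis
    proof (cases "k = 1")
      case True
      then have "cong (cols ks @ [y]) (cols (remove1 1 ks))" using c by simp
      moreover have "canonical (cols (remove1 1 ks))" using heights_remove1[OF ks] unfolding canonical_def by blast
      ultimately show ?thesis by blast
    next
      case False
      then have "heights (remove1 k ks @ [k-1])" using heights_remove1[OF ks] kk by auto
      then have "canonical (cols (remove1 k ks @ [k-1]))" unfolding canonical_def by blast
      then show ?thesis using c by auto
    qed
  qed
  consider "y = 1" | "1 < y" "y \<le> n" | "y < 0" "-n < y" | "y = -n" using y unfolding letter_def by linarith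
  then show ?thesis
  proof cases
    case 1
    have "heights (ks @ [1])" using ks n2 by simp
    then have "canonical (cols (ks @ [1]))" unfolding canonical_def by blast
    then show ?thesis using 1 by (intro exI[of _ "cols (ks @ [1])"]) simp
  next
    case 2
    have "epL n (y-1) y = 1" using 2 by (auto simp: epL_def eL_def)
    then have "0 < phi n (y-1) (cols ks)" using hw[of "y-1"] by simp
    then have "0 < count_list ks (y-1)" using cols_phi[OF ks, of "y-1"] 2 by simp
    then have m: "y - 1 \<in> set ks" by (metis count_list_0_iff less_irrefl)
    have "col (y-1) @ [y] = col y" using col_Suc[of y] 2 by simp
    then have "cong (cols ks @ [y]) (cols (remove1 (y-1) ks @ [y]))" using rem[OF m] by simp
    moreover have "heights (remove1 (y-1) ks @ [y])" using heights_remove1[OF ks] 2 by simp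
    ultimately show ?thesis unfolding canonical_def by blast
  next
    case 3
    have "epL n (-y) y = 1" using 3 by (auto simp: epL_def eL_def)
    then have "0 < phi n (-y) (cols ks)" using hw[of "-y"] by simp
    then have "0 < count_list ks (-y)" using cols_phi[OF ks, of "-y"] 3 by simp
    then have m: "-y \<in> set ks" by (metis count_list_0_iff less_irrefl)
    then show ?thesis using cancel[of "-y"] by simp
  next
    case 4
    have "epL n n y = 1" using 4 n2 by (auto simp: epL_def eL_def)
    then have "0 < phi n n (cols ks)" using hw[of n] by simp
    then have c: "0 < 2 * count_list ks n + count_list ks (n-1)" using cols_phi[OF ks, of n] n2 by simp
    show ?thesis
    proof (cases "n \<in> set ks")
      case True
      then show ?thesis using cancel[of n] 4 by simp
    next
      case False
      then have "0 < count_list ks (n-1)" using c count_list_0_iff[of ks n] by simp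
      then have m: "n - 1 \<in> set ks" by (metis count_list_0_iff less_irrefl)
      let ?r = "remove1 (n-1) ks"
      \<comment> \<open>As no column has height n, all remaining ones are fixed by
        \<open>flip\<close>; hence attaching -n to 1...(n-1) yields the flip of a product of
        columns.\<close>
      have "\<forall>k\<in>set ?r. k < n"
        using False ks set_remove1_subset[of "n-1" ks] by (force simp: heights_def order_le_less)
      then have "map flip (cols (?r @ [n])) = cols ?r @ (col (n-1) @ [y])"
        using map_flip_cols[of ?r] col_Suc[of n] map_flip_col[of "n-1"] 4 n2 by (simp add: flip_def)
      then have "cong (cols ks @ [y]) (map flip (cols (?r @ [n])))" using rem[OF m] by simp
      moreover have "heights (?r @ [n])" using heights_remove1[OF ks] n2 by simp
      ultimately show ?thesis unfolding canonical_def by blast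
    qed
  qed
qed

lemma canonical_flip: "canonical c \<Longrightarrow> canonical (map flip c)"
  unfolding canonical_def by (metis map_flip_flip)

text \<open>A prefix of a highest weight word is one, and whether y may follow it depends only on
  its \<open>phi\<close>. Therefore the prefix can be replaced by a congruent canonical word before
  y is absorbed.\<close>

lemma hw_canonical:
  "lword n w \<Longrightarrow> (\<And>i. eps n i w = 0) \<Longrightarrow> \<exists>c. canonical c \<and> cong w c"
proof (induction w rule: rev_induct)
  case Nil
  have "canonical []" unfolding canonical_def by (intro exI[of _ "[]"]) simp
  then show ?case using cong_refl by blast
next
  case (snoc y v)
  have e: "eps n i v = 0" "epL n i y \<le> phi n i v" for i
    using snoc.prems(2)[of i] by (auto simp: eps_append)
  have l: "lword n v" "letter n y" using snoc.prems(1) by auto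
  obtain c where c: "canonical c" "cong v c" using snoc.IH e l by blast
  have vy: "cong (v @ [y]) (c @ [y])" using cong_right[OF c(2), of "[y]"] l by simp
  have ph: "epL n i y \<le> phi n i c" for i using e(2)[of i] cong_phi[OF c(2), of i] by simp
  obtain ks where ks: "heights ks" "c = cols ks \<or> c = map flip (cols ks)" using c(1) unfolding canonical_def by blast
  show ?case
  proof (cases "c = cols ks")
    case True
    then obtain d where "canonical d" "cong (c @ [y]) d" using cols_snoc_canonical[OF ks(1) l(2)] ph by blast
    then show ?thesis using vy cong_trans by blast
  next
    case False
    then have cs: "c = map flip (cols ks)" using ks by blast
    have "epL n i (flip y) \<le> phi n i (cols ks)" for i
      using ph[of "flip_colour i"] cs phi_flip[of "flip_colour i" "cols ks"] by (simp add: epL_flip)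
    then obtain d where d: "canonical d" "cong (cols ks @ [flip y]) d"
      using cols_snoc_canonical[OF ks(1), of "flip y"] l(2) letter_flip by blast
    have "cong (c @ [y]) (map flip d)" using cong_flip[OF d(2)] cs by simp
    then show ?thesis using vy cong_trans canonical_flip[OF d(1)] by blast
  qed
qed


section \<open>Components\<close>

definition edge :: "int list \<Rightarrow> int list \<Rightarrow> bool" where
  "edge u v \<longleftrightarrow> (\<exists>i. fw n i u = Some v \<or> ew n i u = Some v)"

abbreviation component :: "int list \<Rightarrow> int list set" where "component \<equiv> compD n"

lemma edge_edgeD: "(\<lambda>a b. edgeD n a b \<or> edgeD n b a) = edge"
proof (intro ext iffI)
  fix a b assume "edge a b"
  then obtain i where i: "fw n i a = Some b \<or> fw n i b = Some a" unfolding edge_def using fw_iff_ew by blast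
  moreover have "1 \<le> i \<and> i \<le> n" using i colour_out(1)[of i] by fastforce
  ultimately show "edgeD n a b \<or> edgeD n b a" unfolding edgeD_def fD_eq by blast
next
  fix a b assume "edgeD n a b \<or> edgeD n b a"
  then show "edge a b" unfolding edgeD_def fD_eq edge_def using fw_iff_ew by blast
qed

lemma comp_iff: "u \<in> component w \<longleftrightarrow> edge\<^sup>*\<^sup>* w u"
  by (simp add: compD_def edge_edgeD)

lemma edge_sym: "edge u v \<Longrightarrow> edge v u"
  unfolding edge_def using fw_iff_ew by blast

lemma comp_refl [simp]: "w \<in> component w" by (simp add: comp_iff)

lemma comp_trans: "u \<in> component w \<Longrightarrow> v \<in> component u \<Longrightarrow> v \<in> component w"
  unfolding comp_iff by (rule rtranclp_trans)

lemma comp_sym: "u \<in> component w \<Longrightarrow> w \<in> component u"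
proof -
  have "symp edge" using edge_sym by (rule sympI)
  then show "u \<in> component w \<Longrightarrow> w \<in> component u"
    unfolding comp_iff using symp_rtranclp by (metis sympD)
qed

lemma comp_eq: "u \<in> component w \<Longrightarrow> component u = component w"
  using comp_trans comp_sym by blast

lemma comp_edge: "edge w u \<Longrightarrow> u \<in> component w"
  by (simp add: comp_iff r_into_rtranclp)

lemma comp_fw: "fw n i w = Some u \<Longrightarrow> u \<in> component w" and comp_ew: "ew n i w = Some u \<Longrightarrow> u \<in> component w"
  by (rule comp_edge; auto simp: edge_def)+

lemma comp_inv:
  assumes "u \<in> component w" "P w" "\<And>u v. P u \<Longrightarrow> edge u v \<Longrightarrow> P v"
  shows "P u"
  using assms(1) unfolding comp_iff
proof (induction rule: rtranclp_induct)
  case base show ?case by (rule assms(2))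
next
  case (step y z) then show ?case using assms(3) by blast
qed

lemma comp_length: "u \<in> component w \<Longrightarrow> length u = length w"
proof (erule comp_inv[where P="\<lambda>u. length u = length w"])
  fix u v assume "length u = length w" "edge u v"
  then show "length v = length w" unfolding edge_def using fw_length ew_length by metis
qed simp

lemma edge_flip: "edge u v \<Longrightarrow> edge (map flip u) (map flip v)"
proof -
  assume "edge u v"
  then obtain i where i: "fw n i u = Some v \<or> fw n i v = Some u" unfolding edge_def using fw_iff_ew by blast
  then have "fw n (flip_colour i) (map flip u) = Some (map flip v) \<or> fw n (flip_colour i) (map flip v) = Some (map flip u)"
    by (simp only: fw_flip flip_colour_flip_colour) auto
  then show "edge (map flip u) (map flip v)" unfolding edge_def using fw_iff_ew by blast
qed

lemma comp_flip: "u \<in> component w \<Longrightarrow> map flip u \<in> component (map flip w)"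
proof (erule comp_inv[where P="\<lambda>u. map flip u \<in> component (map flip w)"])
  fix u v assume "map flip u \<in> component (map flip w)" "edge u v"
  then show "map flip v \<in> component (map flip w)" using comp_trans comp_edge edge_flip by blast
qed simp

lemma edge_append:
  assumes "edge (u @ v) x"
  shows "\<exists>u' v'. x = u' @ v' \<and> u' \<in> component u \<and> v' \<in> component v"
proof -
  obtain i where "fw n i (u @ v) = Some x \<or> ew n i (u @ v) = Some x" using assms unfolding edge_def by blast
  then show ?thesis
  proof
    assume "fw n i (u @ v) = Some x"
    then consider u' where "fw n i u = Some u'" "x = u' @ v" | v' where "fw n i v = Some v'" "x = u @ v'"
      by (auto simp: fw_append split: if_splits)
    then show ?thesis by cases (use comp_fw comp_refl in blast)+
  next
    assume "ew n i (u @ v) = Some x"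
    then consider u' where "ew n i u = Some u'" "x = u' @ v" | v' where "ew n i v = Some v'" "x = u @ v'"
      by (auto simp: ew_append split: if_splits)
    then show ?thesis by cases (use comp_ew comp_refl in blast)+
  qed
qed

lemma comp_append:
  assumes "x \<in> component (u @ v)"
  shows "\<exists>u' v'. x = u' @ v' \<and> u' \<in> component u \<and> v' \<in> component v"
  using assms
proof (rule comp_inv)
  show "\<exists>u' v'. u @ v = u' @ v' \<and> u' \<in> component u \<and> v' \<in> component v" using comp_refl by blast
  fix x y assume "\<exists>u' v'. x = u' @ v' \<and> u' \<in> component u \<and> v' \<in> component v" "edge x y"
  then obtain u' v' u'' v'' where "u' \<in> component u" "v' \<in> component v" "y = u'' @ v''" "u'' \<in> component u'" "v'' \<in> component v'"
    using edge_append by blast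
  then show "\<exists>u' v'. y = u' @ v' \<and> u' \<in> component u \<and> v' \<in> component v" using comp_trans by blast
qed

text \<open>The reduction to colours i < n once more, for any property stable under the two
  symmetries: colour n is the flip of n-1, and e is the dual of f.\<close>

lemma edge_closed:
  assumes P: "\<And>u v i. P u \<Longrightarrow> 1 \<le> i \<Longrightarrow> i < n \<Longrightarrow> fw n i u = Some v \<Longrightarrow> P v"
    and flip: "\<And>u. P u \<Longrightarrow> P (map flip u)" and du: "\<And>u. P u \<Longrightarrow> P (dual u)"
    and u: "P u" "edge u v"
  shows "P v"
proof -
  have F: "P v" if "P u" "fw n i u = Some v" for u v i
  proof -
    consider "\<not> (1 \<le> i \<and> i \<le> n)" | "1 \<le> i" "i < n" | "i = n" by linarith
    then show ?thesis
    proof cases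
      case 1 then show ?thesis using that colour_out by simp
    next
      case 2 then show ?thesis using P that by blast
    next
      case 3
      have "fw n (n-1) (map flip u) = Some (map flip v)"
        using that(2) 3 fw_flip[of "n-1" u] n2 by (simp add: flip_colour_def)
      then have "P (map flip v)" using P[OF flip[OF that(1)], of "n-1"] n2 by simp
      then show ?thesis using flip[of "map flip v"] by (simp only: map_flip_flip)
    qed
  qed
  obtain i where "fw n i u = Some v \<or> ew n i u = Some v" using u(2) unfolding edge_def by blast
  then show ?thesis
  proof
    assume "ew n i u = Some v"
    then have "fw n i (dual u) = Some (dual v)" by (simp add: fw_dual)
    then have "P (dual v)" using F[OF du[OF u(1)]] by blast
    then show ?thesis using du[of "dual v"] by simp
  qed (use F u in blast)
qed

lemma comp_closed:
  assumes "\<And>u v i. P u \<Longrightarrow> 1 \<le> i \<Longrightarrow> i < n \<Longrightarrow> fw n i u = Some v \<Longrightarrow> P v"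
    and "\<And>u. P u \<Longrightarrow> P (map flip u)" and "\<And>u. P u \<Longrightarrow> P (dual u)"
    and "P w" "u \<in> component w"
  shows "P u"
  using assms(5,4) edge_closed[of P, OF assms(1,2,3)] by (rule comp_inv)

lemma colw_comp: assumes "colw w" "u \<in> component w" shows "colw u"
proof (rule comp_closed[of colw])
  show "colw v" if "colw u" "1 \<le> i" "i < n" "fw n i u = Some v" for u v i
    using colw_f that by blast
  show "colw (map flip u)" if "colw u" for u using that colw_flip by blast
  show "colw (dual u)" if "colw u" for u using that by (rule colw_dual)
qed (fact assms)+

lemma lword_comp: assumes "lword n w" "u \<in> component w" shows "lword n u"
proof (rule comp_closed[of "lword n"])
  show "lword n v" if "lword n u" "1 \<le> i" "i < n" "fw n i u = Some v" for u v i
    using fw_lword that by blast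
  show "lword n (map flip u)" if "lword n u" for u using that lword_flip by blast
  show "lword n (dual u)" if "lword n u" for u using that lword_dual by blast
qed (fact assms)+

lemma comp_transport:
  assumes "u' \<in> component u" "cong u v"
  shows "\<exists>v'\<in>component v. cong u' v'"
  using assms(1)
proof (rule comp_inv)
  show "\<exists>v'\<in>component v. cong u v'" using assms(2) comp_refl by blast
  fix x y assume "\<exists>v'\<in>component v. cong x v'" "edge x y"
  then obtain v' i where v': "v' \<in> component v" "cong x v'" and "fw n i x = Some y \<or> ew n i x = Some y"
    unfolding edge_def by blast
  from this(3) show "\<exists>v'\<in>component v. cong y v'"
  proof
    assume "fw n i x = Some y"
    then obtain z where "fw n i v' = Some z" "cong y z" using cong_fw[OF v'(2), of i] by (auto simp: option_rel_Some1)
    then show ?thesis using comp_fw comp_trans v' by blast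
  next
    assume "ew n i x = Some y"
    then obtain z where "ew n i v' = Some z" "cong y z" using cong_ew[OF v'(2), of i] by (auto simp: option_rel_Some1)
    then show ?thesis using comp_ew comp_trans v' by blast
  qed
qed

definition hw :: "int list \<Rightarrow> bool" where
  "hw w \<longleftrightarrow> (\<forall>i. eps n i w = 0)"

lemma hw_iff: "hw w \<longleftrightarrow> (\<forall>i. 1 \<le> i \<and> i \<le> n \<longrightarrow> eD n i w = None)"
  unfolding hw_def eD_eq ew_None_iff using colour_out(3) by blast

lemma hw_cong: "hw u \<Longrightarrow> cong u v \<Longrightarrow> hw v"
  unfolding hw_def using cong_eps by simp

lemma canonical_hw: "canonical c \<Longrightarrow> hw c"
  unfolding canonical_def hw_def using cols_eps eps_flip by auto

text \<open>A measure that e strictly lowers; it makes raising to a highest weight word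
  terminate.\<close>

definition rank_sum :: "int list \<Rightarrow> int" where
  "rank_sum w = sum_list (map (rankD n) w)"

lemma rank_sum_ew: "ew n i w = Some w' \<Longrightarrow> rank_sum w' < rank_sum w"
proof -
  assume "ew n i w = Some w'"
  then have "fw n i w' = Some w" by (rule ew_SomeD)
  from fw_decomp[OF this] obtain u x y v where d: "w' = u @ [x] @ v" "w = u @ [y] @ v" "fL n i x = Some y" by blast
  have "rankD n x < rankD n y" using d(3) n2 by (auto simp: fL_def rankD_def split: if_splits)
  then show ?thesis using d by (simp add: rank_sum_def)
qed

lemma rank_sum_nonneg: "lword n w \<Longrightarrow> 0 \<le> rank_sum w"
  by (induction w) (auto simp: rank_sum_def letter_def rankD_def)

lemma raise_induct [consumes 1, case_names hw raise]:
  assumes "lword n w" "\<And>w. lword n w \<Longrightarrow> hw w \<Longrightarrow> P w"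
    "\<And>w i w'. lword n w \<Longrightarrow> ew n i w = Some w' \<Longrightarrow> lword n w' \<Longrightarrow> P w' \<Longrightarrow> P w"
  shows "P w"
  using assms(1)
proof (induction "nat (rank_sum w)" arbitrary: w rule: less_induct)
  case less
  show ?case
  proof (cases "hw w")
    case True then show ?thesis using assms(2) less by blast
  next
    case False
    then obtain i where "eps n i w \<noteq> 0" unfolding hw_def by blast
    then obtain w' where w': "ew n i w = Some w'" using ew_None_iff[of i w] by (cases "ew n i w") simp_all
    have l: "lword n w'" using lword_comp[OF less.prems comp_ew[OF w']] .
    have "nat (rank_sum w') < nat (rank_sum w)" using rank_sum_ew[OF w'] rank_sum_nonneg[OF l] by simp
    then show ?thesis using less.hyps[OF _ l] assms(3)[OF less.prems w' l] by blast
  qed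
qed

lemma hw_exists: "lword n w \<Longrightarrow> \<exists>u\<in>component w. hw u"
proof (induction rule: raise_induct)
  case (hw w) then show ?case using comp_refl by blast
next
  case (raise w i w')
  then show ?case using comp_trans comp_ew by blast
qed

section \<open>Weights\<close>

text \<open>\<open>pwt j\<close> sums these contributions: it is the sum of the first j coordinates
  of the weight in the standard basis.\<close>

definition wt1 :: "int \<Rightarrow> int \<Rightarrow> int" where
  "wt1 j x = (if 1 \<le> x \<and> x \<le> j then 1 else if -j \<le> x \<and> x \<le> -1 then -1 else 0)"

definition pwt :: "int \<Rightarrow> int list \<Rightarrow> int" where
  "pwt j w = sum_list (map (wt1 j) w)"

lemma pwt_simps [simp]: "pwt j [] = 0" "pwt j (x # w) = wt1 j x + pwt j w" "pwt j (u @ v) = pwt j u + pwt j v"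
  by (simp_all add: pwt_def)

lemma wt1_uminus: "wt1 j (-x) = - wt1 j x"
  by (auto simp: wt1_def)

lemma base3_pwt: assumes "base3 n p q" shows "pwt j p = pwt j q"
proof -
  have "wt1 j (n - 1) = - wt1 j (1 - n)" "\<And>x. wt1 j (x - 1) = - wt1 j (1 - x)"
    using wt1_uminus[of j "1 - n"] wt1_uminus[of j "1 - _"] by simp_all
  note e = this
  show ?thesis using assms
    by (cases rule: base3_cases) (simp_all add: wt1_uminus e)
qed

lemma base_rel_pwt: "base_rel p q \<Longrightarrow> pwt j p = pwt j q"
proof -
  have "contr p q \<Longrightarrow> pwt j p = pwt j q" for p q
    unfolding contr_def by (auto simp: wt1_uminus)
  then show "base_rel p q \<Longrightarrow> pwt j p = pwt j q" unfolding base_rel_def using base3_pwt by metis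
qed

lemma cong_pwt: "cong u v \<Longrightarrow> pwt j u = pwt j v"
proof (erule cong_ind)
  fix u v assume "cstep u v"
  then obtain a b p q where "u = a @ p @ b" "v = a @ q @ b" "base_rel p q"
    unfolding cstep_def by blast
  then show "pwt j u = pwt j v" using base_rel_pwt[of p q j] by simp
qed (rule refl, erule (1) trans)

lemma pwt_le_length: "pwt j w \<le> int (length w)"
  by (induction w) (auto simp: wt1_def)

lemma pwt_flip: "j < n \<Longrightarrow> pwt j (map flip w) = pwt j w"
  by (induction w) (auto simp: wt1_def flip_def)

text \<open>\<open>pwt n - pwt (n-1)\<close> is the n-th coordinate of the weight, and
  \<open>flip\<close> changes its sign.\<close>

lemma pwt_flip_n: "pwt n (map flip w) = 2 * pwt (n - 1) w - pwt n w"
proof (induction w)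
  case (Cons x w)
  have "wt1 n (flip x) = 2 * wt1 (n-1) x - wt1 n x" using n2 by (auto simp: wt1_def flip_def)
  then show ?case using Cons by simp
qed simp

lemma colw_distinct: "colw C \<Longrightarrow> distinct (filter (\<lambda>x. pos n x \<noteq> n) C)"
proof (induction C)
  case (Cons x v)
  have "x \<notin> set v" if "pos n x \<noteq> n"
    using colw_split(4)[of "[]" x v x] Cons.prems that by auto
  then show ?case using Cons by (simp add: colw_Cons)
qed simp

text \<open>A letter among 1,...,j with j < n occurs at most once in a column, whereas n can
  recur.\<close>

lemma colw_pwt:
  assumes C: "colw C" and j: "0 \<le> j" "j < n"
  shows "pwt j C \<le> min j (int (length C))"
proof -
  let ?F = "filter (\<lambda>x. 1 \<le> x \<and> x \<le> j) C"
  have "pwt j C \<le> int (length ?F)" by (induction C) (auto simp: wt1_def)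
  moreover have "filter (\<lambda>x. 1 \<le> x \<and> x \<le> j) (filter (\<lambda>x. pos n x \<noteq> n) C) = ?F"
    using j by (auto simp: pos_def intro: filter_cong)
  then have "distinct ?F" using colw_distinct[OF C] by (metis distinct_filter)
  then have "length ?F = card (set ?F)" by (rule distinct_card[symmetric])
  moreover have "card (set ?F) \<le> card {1..j}" by (rule card_mono) auto
  ultimately show ?thesis using pwt_le_length[of j C] j by simp
qed

lemma pwt_col: "0 \<le> k \<Longrightarrow> 0 \<le> j \<Longrightarrow> pwt j (col k) = min j k"
proof (induction k rule: int_ge_induct)
  case (step k)
  then show ?case using col_Suc[of "k+1"] by (auto simp: wt1_def)
qed simp

text \<open>The operators act factor by factor, so every word of the component is a product of
  columns of the same heights. The column 1...k attains the bound of \<open>colw_pwt\<close> for its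
  height.\<close>

lemma cols_dominates:
  assumes j: "0 \<le> j" "j < n"
  shows "heights ks \<Longrightarrow> x \<in> component (cols ks) \<Longrightarrow> pwt j x \<le> pwt j (cols ks)"
proof (induction ks arbitrary: x)
  case (Cons k ks)
  obtain u v where x: "x = u @ v" "u \<in> component (col k)" "v \<in> component (cols ks)"
    using comp_append Cons.prems(2) by (metis cols_simps(2))
  have "colw u" using colw_comp[OF colw_col x(2)] Cons.prems(1) by simp
  then have "pwt j u \<le> min j k" using colw_pwt[of u j] j comp_length[OF x(2)] Cons.prems(1) by simp
  moreover have "pwt j v \<le> pwt j (cols ks)" using Cons x by simp
  moreover have "pwt j (col k) = min j k" using pwt_col[of k j] j Cons.prems(1) by simp
  ultimately show ?case unfolding x(1) cols_simps pwt_simps by linarith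
next
  case Nil
  then show ?case using comp_length[of x "[]"] by simp
qed

lemma canonical_dominates:
  assumes "canonical c" "x \<in> component c" "0 \<le> j" "j < n"
  shows "pwt j x \<le> pwt j c"
proof -
  obtain ks where ks: "heights ks" "c = cols ks \<or> c = map flip (cols ks)" using assms(1) unfolding canonical_def by blast
  from ks(2) show ?thesis
  proof
    assume "c = cols ks" then show ?thesis using cols_dominates assms ks by blast
  next
    assume c: "c = map flip (cols ks)"
    then have "map flip x \<in> component (cols ks)" using comp_flip[OF assms(2)] by (simp only: c map_flip_flip)
    then have "pwt j (map flip x) \<le> pwt j (cols ks)" using cols_dominates assms ks by blast
    then show ?thesis using pwt_flip assms(4) c by simp
  qed
qed

lemma cols_pwt_n: "heights ks \<Longrightarrow> pwt n (cols ks) = int (length (cols ks)) \<and> pwt n (cols ks) - pwt (n-1) (cols ks) = int (count_list ks n)"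
proof (induction ks)
  case (Cons k ks)
  then show ?case using pwt_col[of k n] pwt_col[of k "n-1"] n2 by auto
qed simp

text \<open>No two letters of a canonical word cancel in the weight: -n is the only barred letter
  and never occurs together with n. So the length is the sum of the absolute values of the weight
  coordinates.\<close>

lemma canonical_length:
  assumes "canonical c"
  shows "int (length c) = pwt (n-1) c + \<bar>pwt n c - pwt (n-1) c\<bar>"
proof -
  obtain ks where ks: "heights ks" "c = cols ks \<or> c = map flip (cols ks)" using assms unfolding canonical_def by blast
  then show ?thesis using cols_pwt_n[OF ks(1)] pwt_flip[of "n-1" "cols ks"] pwt_flip_n[of "cols ks"] by auto
qed


section \<open>Uniqueness of the highest weight word\<close>

text \<open>Admissible columns of height n contain n or bar n, and the parity of its position separates the
  component of 1...n from that of 1...(n-1) bar n.\<close>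
definition parcol :: "int \<Rightarrow> int list \<Rightarrow> bool" where
  "parcol s C \<longleftrightarrow> colw C \<and> int (length C) = n \<and> (\<forall>k. 1 \<le> k \<and> k \<le> n \<longrightarrow> NB k C \<le> k) \<and>
     (\<forall>p < length C. (C ! p = n \<longrightarrow> even (int p + s)) \<and> (C ! p = -n \<longrightarrow> odd (int p + s)))"

lemma parcol_flip: "parcol s C \<Longrightarrow> parcol (s + 1) (map flip C)"
proof -
  have "flip x = n \<longleftrightarrow> x = -n" "flip x = -n \<longleftrightarrow> x = n" for x using n2 by (auto simp: flip_def)
  then show "parcol s C \<Longrightarrow> parcol (s + 1) (map flip C)"
    by (auto simp: parcol_def colw_flip NB_flip)
qed

text \<open>Position p goes to n-1-p and the change of sign exchanges the two parities, which
  together shifts s by n.\<close>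

lemma parcol_dual: assumes "parcol s C" shows "parcol (s + n) (dual C)"
proof -
  have len: "int (length C) = n" using assms by (simp add: parcol_def)
  have nth: "dual C ! p = - (C ! (length C - 1 - p))" if "p < length C" for p
    using that by (simp add: dual_def rev_nth)
  have "(dual C ! p = n \<longrightarrow> even (int p + (s + n))) \<and> (dual C ! p = -n \<longrightarrow> odd (int p + (s + n)))"
    if p: "p < length C" for p
  proof -
    let ?q = "length C - 1 - p"
    have q: "?q < length C" "int ?q = n - 1 - int p" using p len by auto
    have "(C ! ?q = n \<longrightarrow> even (int ?q + s)) \<and> (C ! ?q = -n \<longrightarrow> odd (int ?q + s))"
      using assms q(1) unfolding parcol_def by blast
    then show ?thesis unfolding nth[OF p] q(2) by auto
  qed
  then show ?thesis using assms by (auto simp: parcol_def NB_dual colw_dual)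
qed

text \<open>Positions stay fixed, so only a newly created letter of absolute value n matters; this
  is n, made from n-1 by colour n-1. Since the height is n and \<open>NB (n-1) C <= n-1\<close>, C
  already contains n or -n, further to the right. In the column C' the letter next to the new n must
  then be -n, and its known parity gives that of n.\<close>

lemma parcol_f:
  assumes C: "parcol s C" and i: "1 \<le> i" "i < n" and f: "fw n i C = Some C'"
  shows "parcol s C'"
proof -
  have col: "colw C" "colw C'" using C colw_f[OF i _ f] by (auto simp: parcol_def)
  have len: "int (length C) = n" "length C' = length C" using C fw_length[OF f] by (auto simp: parcol_def)
  have bound: "NB k C \<le> k" if "0 \<le> k" "k \<le> n" for k
    using C that NB_0[OF colw_lword[OF col(1)]] by (cases "k = 0") (auto simp: parcol_def)
  have "NB k C' \<le> k" if k: "1 \<le> k" "k \<le> n" for k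
  proof (cases "k = i")
    case True
    then show ?thesis
      using NB_f(2)[OF i col(1) f] bound[of "i-1"] bound[of i] bound[of "i+1"] i by auto
  next
    case False
    then show ?thesis using NB_f(1)[OF i col(1) f False] bound[of k] k by simp
  qed
  moreover have "(C' ! p = n \<longrightarrow> even (int p + s)) \<and> (C' ! p = -n \<longrightarrow> odd (int p + s))"
    if p: "p < length C'" for p
  proof -
    obtain u x y v where d: "C = u @ [x] @ v" "C' = u @ [y] @ v" "fL n i x = Some y"
      using fw_decomp[OF f] by blast
    have old: "(C ! q = n \<longrightarrow> even (int q + s)) \<and> (C ! q = -n \<longrightarrow> odd (int q + s))" if "q < length C" for q
      using C that unfolding parcol_def by blast
    show ?thesis
    proof (cases "p = length u \<and> \<bar>y\<bar> = n")
      case False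
      show ?thesis
      proof (cases "p = length u")
        case True
        then have "C' ! p = y" using d by simp
        then show ?thesis using False True n2 by auto
      next
        case neq: False
        then have "C' ! p = C ! p" using d by (auto simp: nth_append nth_Cons split: nat.splits)
        then show ?thesis using old[of p] p len by simp
      qed
    next
      case True
      then have y: "y = n" "x = n - 1" "i = n - 1"
        using fL_lt[OF i(2) d(3)] i by auto
      have kx: "pos n x = n - 1" using y letter_n by simp
      have lt: "letter n t" if "t \<in> set C" for t using colw_lword[OF col(1)] that by (simp add: lword_def)
      have "\<exists>t\<in>set C. \<bar>t\<bar> = n"
      proof (rule ccontr)
        assume no: "\<not> ?thesis"
        have "NB (n-1) C = int (length C)"
        proof (rule NB_eq_length)
          fix t assume "t \<in> set C"
          then have "\<bar>t\<bar> \<noteq> n" "-n \<le> t" "t \<le> n" using no lt[of t] by (auto simp: letter_def)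
          then show "\<bar>t\<bar> \<le> n - 1" by linarith
        qed
        then show False using bound[of "n-1"] len n2 by simp
      qed
      then obtain t where t: "t \<in> set C" "\<bar>t\<bar> = n" by blast
      have kt: "pos n t = n" using pos_eq_n[OF lt[OF t(1)]] t(2) by linarith
      note sp = colw_split[OF col(1)[unfolded d(1)]]
      have "t \<in> set v" using t(1) d(1) sp(1)[of t] kt kx y n2 by auto
      then obtain h v' where v: "v = h # v'" by (cases v) auto
      have "colw ((u @ [x]) @ [h] @ v')" using col(1) d(1) v by simp
      from colw_split(2)[OF this, of t] have "pos n h \<le> n" using \<open>t \<in> set v\<close> v kt by auto
      moreover have "n - 1 < pos n h" using sp(4)[of h] kx v by simp
      ultimately have kh: "pos n h = n" by simp
      have "adj n h" using col(2) d(2) v y by (auto simp: colw_append colw_Cons)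
      then have h: "h = -n" using kh letter_n(5) by (simp add: adj_def)
      have "C ! (length u + 1) = -n" "length u + 1 < length C" using d(1) v h by (auto simp: nth_append)
      then have "odd (int (length u + 1) + s)" using old by blast
      then have "even (int (length u) + s)" by simp
      moreover have "C' ! p = n" using True d y by simp
      ultimately show ?thesis using True n2 by auto
    qed
  qed
  ultimately show ?thesis using col len by (auto simp: parcol_def)
qed

lemma parcol_even: "parcol s C \<Longrightarrow> even (s - t) \<Longrightarrow> parcol t C"
  by (auto simp: parcol_def)

text \<open>The symmetries shift s, so \<open>edge_closed\<close> does not cover this case. Each
  symmetry is applied once before and once after the operator, and the total shift is even.\<close>

lemma parcol_edge:
  assumes u: "parcol s u" and m: "edge u v"
  shows "parcol s v"
proof -
  have F: "parcol s v" if "parcol s u" "fw n i u = Some v" for s u v i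
  proof -
    consider "\<not> (1 \<le> i \<and> i \<le> n)" | "1 \<le> i" "i < n" | "i = n" by linarith
    then show ?thesis
    proof cases
      case 1 then show ?thesis using that colour_out by simp
    next
      case 2 then show ?thesis using parcol_f that by blast
    next
      case 3
      have "fw n (n-1) (map flip u) = Some (map flip v)"
        using that(2) 3 fw_flip[of "n-1" u] n2 by (simp add: flip_colour_def)
      then have "parcol (s + 1) (map flip v)" using parcol_f[OF parcol_flip[OF that(1)], of "n-1"] n2 by simp
      then have "parcol (s + 1 + 1) v" using parcol_flip[of "s+1" "map flip v"] by (simp only: map_flip_flip)
      then show ?thesis by (rule parcol_even) simp
    qed
  qed
  obtain i where "fw n i u = Some v \<or> ew n i u = Some v" using m unfolding edge_def by blast
  then show ?thesis
  proof
    assume "ew n i u = Some v"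
    then have "fw n i (dual u) = Some (dual v)" by (simp add: fw_dual)
    then have "parcol (s + n) (dual v)" using F[OF parcol_dual[OF u]] by blast
    then have "parcol (s + n + n) v" using parcol_dual[of "s + n" "dual v"] by simp
    then show ?thesis by (rule parcol_even) simp
  qed (use F u in blast)
qed

lemma parcol_col: "parcol (n - 1) (col n)"
proof -
  have "length (col n) = nat n" by simp
  moreover have "col n ! p = int p + 1" if "p < nat n" for p using that by simp
  moreover have "int p = n - 1" if "int p + 1 = n" for p using that by simp
  ultimately show ?thesis using colw_col[of n] NB_col[of n] n2 by (auto simp: parcol_def)
qed

text \<open>A column of height n with these letters must contain -n, and nothing can follow it. It
  would stand at position n-1 (counted from 0), where the parity inherited from 1...n excludes
  it.\<close>

lemma col_n_minus_not_comp:
  assumes C: "C \<in> component (col n)" and l: "\<forall>x\<in>set C. x = -n \<or> 1 \<le> x \<and> x \<le> n - 1"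
  shows False
proof -
  have col: "colw C" using colw_comp[OF colw_col C] n2 by simp
  have len: "int (length C) = n" using comp_length[OF C] n2 by simp
  have pwt: "pwt (n-1) C \<le> n - 1" using colw_pwt[OF col, of "n-1"] n2 len by simp
  have "-n \<in> set C"
  proof (rule ccontr)
    assume "-n \<notin> set C"
    then have "\<forall>x\<in>set C. 1 \<le> x \<and> x \<le> n - 1" using l by metis
    then have "pwt (n-1) C = int (length C)" by (induction C) (auto simp: wt1_def)
    then show False using pwt len by simp
  qed
  then obtain a b where ab: "C = a @ [-n] @ b" by (auto dest: split_list)
  have "b = []"
  proof (rule ccontr)
    assume "b \<noteq> []"
    then obtain h b' where b: "b = h # b'" by (cases b) auto
    have "adj (-n) h" using col ab b by (auto simp: colw_append colw_Cons)
    moreover have "h = -n \<or> 1 \<le> h \<and> h \<le> n - 1" using l ab b by auto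
    ultimately show False using n2 by (auto simp: adj_def pos_def)
  qed
  then have last: "C ! (length C - 1) = -n" "length C - 1 < length C" using ab by auto
  have "parcol (n-1) C" using C parcol_col parcol_edge by (rule comp_inv)
  then have "odd (int (length C - 1) + (n - 1))" using last unfolding parcol_def by blast
  moreover have e: "int (length C - 1) = n - 1" using len n2 by linarith
  ultimately have "odd ((n - 1) + (n - 1))" unfolding e by blast
  then show False by simp
qed

lemma dominated:
  assumes u1: "lword n u1" "hw u1" and u2: "u2 \<in> component u1" and j: "0 \<le> j" "j < n"
  shows "pwt j u2 \<le> pwt j u1"
proof -
  obtain c where c: "canonical c" "cong u1 c" using hw_canonical u1 unfolding hw_def by blast
  obtain x where x: "x \<in> component c" "cong u2 x" using comp_transport[OF u2 c(2)] by blast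
  have "pwt j u2 = pwt j x" using cong_pwt[OF x(2)] .
  also have "\<dots> \<le> pwt j c" using canonical_dominates[OF c(1) x(1) j] .
  also have "\<dots> = pwt j u1" using cong_pwt[OF c(2)] by simp
  finally show ?thesis .
qed

lemma neg_pwt_le_length: "2 * pwt (n - 1) w - pwt n w \<le> int (length w)"
  using pwt_le_length[of n "map flip w"] pwt_flip_n[of w] by simp

lemma neg_pwt_eq_length:
  "2 * pwt (n - 1) w - pwt n w = int (length w) \<Longrightarrow> lword n w \<Longrightarrow> \<forall>x\<in>set w. x = -n \<or> 1 \<le> x \<and> x \<le> n - 1"
proof (induction w)
  case (Cons x w)
  have l: "letter n x" "lword n w" using Cons.prems(2) by simp_all
  have s: "2 * wt1 (n-1) x - wt1 n x \<le> 1" using n2 by (auto simp: wt1_def)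
  have "2 * pwt (n-1) w - pwt n w \<le> int (length w)" by (rule neg_pwt_le_length)
  then have e: "2 * wt1 (n-1) x - wt1 n x = 1" "2 * pwt (n-1) w - pwt n w = int (length w)"
    using Cons.prems(1) s by simp_all
  have "x = -n \<or> 1 \<le> x \<and> x \<le> n - 1" using e(1) l(1) n2 by (auto simp: wt1_def letter_def split: if_splits)
  then show ?case using Cons.IH[OF e(2) l(2)] by simp
qed simp

text \<open>Let l be the n-th weight coordinate of v. If l >= 1, the canonical word of
  \<open>v @ [-n]\<close> is by \<open>canonical_length\<close> too short for a word of n-th
  coordinate l+1 in its component; l <= -1 is the mirror image. If l = 0, the canonical word of
  \<open>v @ [n]\<close> has exactly one column 1...n. A word in its component with the weight of
  \<open>v @ [-n]\<close> attains the bound of \<open>neg_pwt_le_length\<close>, hence consists of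
  1,...,n-1 and -n, and its last factor contradicts \<open>col_n_minus_not_comp\<close>.\<close>

lemma hw_unique_n:
  assumes v: "lword n v" and h1: "hw (v @ [n])" and h2: "hw (v @ [-n])"
    and c: "v @ [-n] \<in> component (v @ [n])"
  shows False
proof -
  define l where "l = pwt n v - pwt (n-1) v"
  have s: "wt1 n n = 1" "wt1 (n-1) n = 0" "wt1 n (-n) = -1" "wt1 (n-1) (-n) = 0"
    using n2 by (auto simp: wt1_def)
  have lw: "lword n (v @ [n])" "lword n (v @ [-n])" using v letter_n by simp_all
  obtain c1 where c1: "canonical c1" "cong (v @ [n]) c1" using hw_canonical[OF lw(1)] h1 unfolding hw_def by blast
  obtain c2 where c2: "canonical c2" "cong (v @ [-n]) c2" using hw_canonical[OF lw(2)] h2 unfolding hw_def by blast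
  have S1: "pwt (n-1) c1 = pwt (n-1) v" "pwt n c1 = pwt n v + 1"
    and S2: "pwt (n-1) c2 = pwt (n-1) v" "pwt n c2 = pwt n v - 1"
    using cong_pwt[OF c1(2), of n] cong_pwt[OF c1(2), of "n-1"] cong_pwt[OF c2(2), of n] cong_pwt[OF c2(2), of "n-1"] s
    by simp_all
  consider "l \<ge> 1" | "l \<le> -1" | "l = 0" by linarith
  then show False
  proof cases
    case 1
    obtain x where x: "x \<in> component c2" "cong (v @ [n]) x" using comp_transport[OF comp_sym[OF c] c2(2)] by blast
    have "pwt n x = pwt n v + 1" using cong_pwt[OF x(2), of n] s by simp
    moreover have "pwt n x \<le> int (length c2)" using pwt_le_length[of n x] comp_length[OF x(1)] by simp
    ultimately show False using canonical_length[OF c2(1)] S2 1 l_def by simp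
  next
    case 2
    obtain x where x: "x \<in> component c1" "cong (v @ [-n]) x" using comp_transport[OF c c1(2)] by blast
    have "pwt n x = pwt n v - 1" "pwt (n-1) x = pwt (n-1) v" using cong_pwt[OF x(2), of n] cong_pwt[OF x(2), of "n-1"] s by simp_all
    moreover have "2 * pwt (n-1) x - pwt n x \<le> int (length c1)" using neg_pwt_le_length[of x] comp_length[OF x(1)] by simp
    ultimately show False using canonical_length[OF c1(1)] S1 2 l_def by simp
  next
    case 3
    obtain ks where ks: "heights ks" "c1 = cols ks \<or> c1 = map flip (cols ks)" using c1(1) unfolding canonical_def by blast
    have "pwt n c1 - pwt (n-1) c1 = 1" using S1 3 l_def by simp
    then have c1K: "c1 = cols ks" and cnt: "count_list ks n = 1"
      using ks(2) cols_pwt_n[OF ks(1)] pwt_flip[of "n-1" "cols ks"] pwt_flip_n[of "cols ks"] by auto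
    have "n \<in> set ks" using cnt count_list_0_iff[of ks n] by (metis zero_neq_one)
    then have "cong c1 (cols (remove1 n ks) @ col n)" using cong_cols_last[OF ks(1)] c1K by blast
    then have d: "cong (v @ [n]) (cols (remove1 n ks) @ col n)" using c1(2) cong_trans by blast
    obtain x where x: "x \<in> component (cols (remove1 n ks) @ col n)" "cong (v @ [-n]) x"
      using comp_transport[OF c d] by blast
    have len: "int (length x) = pwt (n-1) v + 1"
    proof -
      have "int (length (cols (remove1 n ks) @ col n)) = pwt n (cols (remove1 n ks) @ col n)"
        using cols_pwt_n[of "remove1 n ks @ [n]"] heights_remove1[OF ks(1)] n2 by simp
      also have "\<dots> = pwt n v + 1" using cong_pwt[OF d, of n] s by simp
      finally show ?thesis using comp_length[OF x(1)] 3 l_def by simp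
    qed
    have Sx: "pwt n x = pwt n v - 1" "pwt (n-1) x = pwt (n-1) v" using cong_pwt[OF x(2), of n] cong_pwt[OF x(2), of "n-1"] s by simp_all
    have lx: "lword n x"
      using lword_comp[OF _ x(1)] lword_cols heights_remove1[OF ks(1)] lword_col by simp
    have all: "\<forall>y\<in>set x. y = -n \<or> 1 \<le> y \<and> y \<le> n - 1"
      by (rule neg_pwt_eq_length[OF _ lx]) (use Sx len 3 l_def in simp)
    obtain a C where C: "x = a @ C" "C \<in> component (col n)" using comp_append[OF x(1)] by blast
    show False using col_n_minus_not_comp[OF C(2)] all C(1) by simp
  qed
qed

lemma wt1_determines:
  assumes x: "letter n x" and y: "letter n y" and s: "\<And>j. 0 \<le> j \<Longrightarrow> j < n \<Longrightarrow> wt1 j x = wt1 j y"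
  shows "x = y \<or> \<bar>x\<bar> = n \<and> \<bar>y\<bar> = n"
proof (rule ccontr)
  assume neg: "\<not> ?thesis"
  have *: False if "x \<noteq> y" "\<bar>x\<bar> \<le> \<bar>y\<bar>" "\<bar>x\<bar> < n" "letter n x" "letter n y"
      and s: "\<And>j. 0 \<le> j \<Longrightarrow> j < n \<Longrightarrow> wt1 j x = wt1 j y" for x y
    using s[of "\<bar>x\<bar>"] that(1-5) by (auto simp: wt1_def letter_def abs_if split: if_splits)
  show False
  proof (cases "\<bar>x\<bar> \<le> \<bar>y\<bar>")
    case True
    then have "\<bar>x\<bar> < n" using neg x y by (auto simp: letter_def)
    then show False using *[of x y] neg True x y s by blast
  next
    case False
    then have "\<bar>y\<bar> < n" using neg x y by (auto simp: letter_def)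
    then show False using *[of y x] neg False x y s by fastforce
  qed
qed

theorem hw_unique:
  "lword n u1 \<Longrightarrow> hw u1 \<Longrightarrow> hw u2 \<Longrightarrow> u2 \<in> component u1 \<Longrightarrow> u1 = u2"
proof (induction u1 arbitrary: u2 rule: rev_induct)
  case Nil
  then show ?case using comp_length by fastforce
next
  case (snoc y1 v1)
  obtain v2 t where vt: "u2 = v2 @ t" "v2 \<in> component v1" "t \<in> component [y1]" using comp_append[OF snoc.prems(4)] by blast
  have "length t = 1" using comp_length[OF vt(3)] by simp
  then obtain y2 where t: "t = [y2]" by (cases t) auto
  have h: "hw v1" "hw v2" using snoc.prems(2,3) vt(1) by (auto simp: hw_def eps_append)
  have l: "lword n v1" "letter n y1" using snoc.prems(1) by simp_all
  have v: "v1 = v2" using snoc.IH l(1) h vt(2) by blast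
  have u2: "u2 = v1 @ [y2]" using vt(1) t v by simp
  have l2: "lword n u2" using lword_comp[OF snoc.prems(1,4)] .
  then have ly2: "letter n y2" using u2 by simp
  have "pwt j u2 = pwt j (v1 @ [y1])" if "0 \<le> j" "j < n" for j
    using dominated[OF snoc.prems(1,2,4) that] dominated[OF l2 snoc.prems(3) comp_sym[OF snoc.prems(4)] that] by simp
  then have "wt1 j y1 = wt1 j y2" if "0 \<le> j" "j < n" for j using that u2 by simp
  then consider "y1 = y2" | "\<bar>y1\<bar> = n" "\<bar>y2\<bar> = n" "y1 \<noteq> y2" using wt1_determines[OF l(2) ly2] by blast
  then show ?case
  proof cases
    case 1 then show ?thesis using u2 by simp
  next
    case 2
    then have "y1 = n \<and> y2 = -n \<or> y1 = -n \<and> y2 = n" by linarith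
    then show ?thesis
    proof
      assume y: "y1 = n \<and> y2 = -n"
      then show ?thesis using hw_unique_n[OF l(1)] snoc.prems u2 by simp
    next
      assume y: "y1 = -n \<and> y2 = n"
      then show ?thesis using hw_unique_n[OF l(1)] snoc.prems u2 comp_sym[OF snoc.prems(4)] by simp
    qed
  qed
qed


section \<open>The congruence and the isomorphism relation\<close>

lemma hwD_eq:
  assumes "lword n w" "u \<in> component w" "hw u"
  shows "hwD n w = u"
  unfolding hwD_def
proof (rule the_equality)
  show "u \<in> component w \<and> (\<forall>i. 1 \<le> i \<and> i \<le> n \<longrightarrow> eD n i u = None)" using assms(2,3) hw_iff by blast
  fix x assume "x \<in> component w \<and> (\<forall>i. 1 \<le> i \<and> i \<le> n \<longrightarrow> eD n i x = None)"
  then have x: "x \<in> component w" "hw x" using hw_iff by blast+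
  have "x \<in> component u" using comp_eq[OF assms(2)] x(1) by simp
  then show "x = u" using hw_unique[OF lword_comp[OF assms(1,2)] assms(3) x(2)] by simp
qed

lemma hwD_comp: "lword n w \<Longrightarrow> hwD n w \<in> component w" and hwD_hw: "lword n w \<Longrightarrow> hw (hwD n w)"
  using hw_exists hwD_eq by metis+

lemma hwD_same_comp: "lword n w \<Longrightarrow> v \<in> component w \<Longrightarrow> hwD n v = hwD n w"
  using hwD_eq[OF lword_comp, of w v "hwD n w"] hwD_comp hwD_hw comp_eq by blast

lemma hwD_cong:
  assumes "lword n u" "lword n v" "cong u v"
  shows "cong (hwD n u) (hwD n v)"
proof -
  obtain x where x: "x \<in> component v" "cong (hwD n u) x" using comp_transport[OF hwD_comp[OF assms(1)] assms(3)] by blast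
  have "hw x" using hw_cong hwD_hw[OF assms(1)] x(2) by blast
  then show ?thesis using hwD_eq[OF assms(2) x(1)] x(2) by simp
qed

text \<open>Raising both words by the same operators keeps them congruent and in one component until
  the highest weight, where they coincide; since f inverts e, the equality descends again.\<close>

lemma cong_comp_eq:
  assumes "lword n u" "u' \<in> component u" "cong u u'"
  shows "u = u'"
  using assms
proof (induction arbitrary: u' rule: raise_induct)
  case (hw w)
  then show ?case using hw_unique hw_cong by blast
next
  case (raise w i w')
  obtain x where x: "ew n i u' = Some x" "cong w' x"
    using cong_ew[OF raise.prems(2), of i] raise.hyps(2) by (auto simp: option_rel_Some1)
  have "w \<in> component w'" using comp_sym[OF comp_ew[OF raise.hyps(2)]] .
  then have "x \<in> component w'" using raise.prems(1) comp_ew[OF x(1)] comp_trans by blast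
  then have "w' = x" using raise.IH x(2) by blast
  then have "Some w = Some u'" using ew_SomeD[OF raise.hyps(2)] ew_SomeD[OF x(1)] by simp
  then show ?case by simp
qed

lemma fpath_Nil [simp]: "fpath n [] w = Some w" by (simp add: fpath_def)

lemma fpath_Cons: "fpath n (i # is) w = Option.bind (fpath n is w) (fD n i)"
  by (simp add: fpath_def)

lemma cong_common_path:
  assumes "lword n u" "lword n v" "cong u v"
  shows "\<exists>is. fpath n is (hwD n u) = Some u \<and> fpath n is (hwD n v) = Some v"
  using assms
proof (induction arbitrary: v rule: raise_induct)
  case (hw w)
  have "hw v" using hw_cong hw by blast
  then have "hwD n w = w" "hwD n v = v" using hwD_eq hw comp_refl by blast+
  then show ?case by (intro exI[of _ "[]"]) simp
next
  case (raise w i w')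
  obtain x where x: "ew n i v = Some x" "cong w' x"
    using cong_ew[OF raise.prems(2), of i] raise.hyps(2) by (auto simp: option_rel_Some1)
  have lx: "lword n x" using lword_comp[OF raise.prems(1) comp_ew[OF x(1)]] .
  obtain "is" where p: "fpath n is (hwD n w') = Some w'" "fpath n is (hwD n x) = Some x"
    using raise.IH[OF lx x(2)] by blast
  have "hwD n w' = hwD n w" "hwD n x = hwD n v"
    using hwD_same_comp[OF raise.hyps(1) comp_ew[OF raise.hyps(2)]]
      hwD_same_comp[OF raise.prems(1) comp_ew[OF x(1)]] by simp_all
  then have "fpath n (i # is) (hwD n w) = Some w" "fpath n (i # is) (hwD n v) = Some v"
    using p ew_SomeD[OF raise.hyps(2)] ew_SomeD[OF x(1)] by (simp_all add: fpath_Cons fD_eq)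
  then show ?case by blast
qed

lemma cong_fpath: "cong u v \<Longrightarrow> fpath n is u = Some u' \<Longrightarrow> \<exists>v'. fpath n is v = Some v' \<and> cong u' v'"
proof (induction "is" arbitrary: u')
  case (Cons i "is")
  obtain x where x: "fpath n is u = Some x" "fw n i x = Some u'"
    using Cons.prems(2) by (cases "fpath n is u") (auto simp: fpath_Cons fD_eq)
  obtain y where y: "fpath n is v = Some y" "cong x y" using Cons.IH[OF Cons.prems(1) x(1)] by blast
  obtain z where "fw n i y = Some z" "cong u' z" using cong_fw[OF y(2), of i] x(2) by (auto simp: option_rel_Some1)
  then show ?case using y(1) by (simp add: fpath_Cons fD_eq)
qed simp

lemma cong_comp_iso:
  assumes l: "lword n u" "lword n v" and c: "cong u v"
  shows "comp_iso n u v"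
proof -
  \<comment> \<open>By \<open>cong_comp_eq\<close> the congruent partner in the other component is
    unique, so the choice is determined. Bijectivity and compatibility with the arrows follow from
    this uniqueness.\<close>
  define g where "g = (\<lambda>x. SOME y. y \<in> component v \<and> cong x y)"
  have g: "g x \<in> component v" "cong x (g x)" if "x \<in> component u" for x
  proof -
    have "\<exists>y. y \<in> component v \<and> cong x y" using comp_transport[OF that c] by blast
    then show "g x \<in> component v" "cong x (g x)" unfolding g_def using someI_ex[of "\<lambda>y. y \<in> component v \<and> cong x y"] by blast+
  qed
  have uniq: "y = y'" if "lword n w" "y \<in> component w" "y' \<in> component w" "cong y y'" for w y y'
    using cong_comp_eq[OF lword_comp[OF that(1,2)] _ that(4)] comp_eq[OF that(2)] that(3) by blast
  have "bij_betw g (component u) (component v)"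
  proof (intro bij_betw_imageI inj_onI equalityI subsetI)
    fix x y assume xy: "x \<in> component u" "y \<in> component u" "g x = g y"
    have "cong x y" using g(2)[OF xy(1)] cong_sym[OF g(2)[OF xy(2)]] xy(3) cong_trans by metis
    then show "x = y" using uniq[OF l(1) xy(1,2)] by blast
  next
    fix y assume "y \<in> g ` component u"
    then show "y \<in> component v" using g(1) by blast
  next
    fix y assume y: "y \<in> component v"
    obtain x where x: "x \<in> component u" "cong y x" using comp_transport[OF y cong_sym[OF c]] by blast
    have "cong y (g x)" using x(2) g(2)[OF x(1)] cong_trans by blast
    then have "y = g x" using uniq[OF l(2) y g(1)[OF x(1)]] by blast
    then show "y \<in> g ` component u" using x(1) by blast
  qed
  moreover have "fD n i x = Some y \<longleftrightarrow> fD n i (g x) = Some (g y)" if xy: "x \<in> component u" "y \<in> component u" for x y i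
    unfolding fD_eq
  proof
    assume f: "fw n i x = Some y"
    then obtain z where z: "fw n i (g x) = Some z" "cong y z"
      using cong_fw[OF g(2)[OF xy(1)], of i] by (auto simp: option_rel_Some1)
    have "z \<in> component v" using comp_fw[OF z(1)] g(1)[OF xy(1)] comp_trans by blast
    moreover have "cong z (g y)" using cong_sym[OF z(2)] g(2)[OF xy(2)] cong_trans by blast
    ultimately have "z = g y" using uniq[OF l(2) _ g(1)[OF xy(2)]] by blast
    then show "fw n i (g x) = Some (g y)" using z(1) by simp
  next
    assume f: "fw n i (g x) = Some (g y)"
    then obtain z where z: "fw n i x = Some z" "cong (g y) z"
      using cong_fw[OF cong_sym[OF g(2)[OF xy(1)]], of i] by (auto simp: option_rel_Some1)
    have "z \<in> component u" using comp_fw[OF z(1)] xy(1) comp_trans by blast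
    moreover have "cong y z" using g(2)[OF xy(2)] z(2) cong_trans by blast
    ultimately have "y = z" using uniq[OF l(1) xy(2)] by blast
    then show "fw n i x = Some y" using z(1) by simp
  qed
  ultimately show ?thesis unfolding comp_iso_def by blast
qed

lemma cong_simD: "lword n u \<Longrightarrow> lword n v \<Longrightarrow> cong u v \<Longrightarrow> simD n u v"
  unfolding simD_def using cong_comp_iso cong_common_path by blast

section \<open>Tableaux of highest weight\<close>

lemma readingT_TY: "readingT (TY T) = cols (rev (map (\<lambda>C. int (length C)) T))"
  by (simp add: readingT_def TY_def cols_def rev_map comp_def)

lemma readingT_TYm: 
  assumes "\<forall>C\<in>set T. int (length C) \<le> n"
  shows "readingT (TYm n T) = map flip (readingT (TY T))"
proof -
  have "(if int (length C) = n then [1..n-1] @ [-n] else [1..int (length C)]) = map flip [1..int (length C)]"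
    if "int (length C) \<le> n" for C :: "int list"
    using that map_flip_col[of "n-1"] map_flip_col[of "int (length C)"] col_Suc[of n] n2 by (auto simp: flip_def)
  then have "TYm n T = map (map flip) (TY T)" using assms by (auto simp: TYm_def TY_def)
  then show ?thesis by (simp add: readingT_def rev_map map_concat)
qed

text \<open>Heights in the order of the reading, from the last column to the first, hence weakly
  increasing for a tabloid.\<close>

definition shape :: "int list list \<Rightarrow> int list" where
  "shape T = rev (map (\<lambda>C. int (length C)) T)"

lemma orth_iff:
  assumes "tabloid n T"
  shows "orth n T \<longleftrightarrow> readingT T \<in> component (cols (shape T)) \<or> readingT T \<in> component (map flip (cols (shape T)))"
proof -
  have "\<forall>C\<in>set T. int (length C) \<le> n" using assms by (simp add: tabloid_def)
  then show ?thesis using assms readingT_TYm[of T] by (simp add: orth_def readingT_TY shape_def)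
qed

lemma tabloid_shape: "tabloid n T \<Longrightarrow> heights (shape T) \<and> sorted (shape T)"
proof -
  assume T: "tabloid n T"
  have "1 \<le> int (length C)" if "C \<noteq> []" for C :: "int list" using that by (cases C) auto
  then have "heights (shape T)" using T by (auto simp: heights_def shape_def tabloid_def)
  moreover have "sorted_wrt (\<lambda>C D. length D \<le> length C) T" using T by (simp add: tabloid_def)
  then have "sorted (shape T)"
    by (auto simp: shape_def sorted_wrt_rev sorted_wrt_map)
  ultimately show "heights (shape T) \<and> sorted (shape T)" by blast
qed

lemma tabloid_lword: "tabloid n T \<Longrightarrow> lword n (readingT T)"
  by (auto simp: tabloid_def readingT_def lword_def is_col_def)

text \<open>This recovers the columns of a tableau from a mere word: the operators preserve the cuts
  between the factors as well as the column property of each factor.\<close>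

lemma split_columns:
  "heights ks \<Longrightarrow> x \<in> component (cols ks) \<Longrightarrow>
    \<exists>Cs. x = concat Cs \<and> map (\<lambda>C. int (length C)) Cs = ks \<and> (\<forall>C\<in>set Cs. colw C)"
proof (induction ks arbitrary: x)
  case Nil
  then have "x = []" using comp_length[of x "[]"] by simp
  then show ?case by (intro exI[of _ "[]"]) simp
next
  case (Cons k ks)
  obtain u v where x: "x = u @ v" "u \<in> component (col k)" "v \<in> component (cols ks)"
    using comp_append Cons.prems(2) by (metis cols_simps(2))
  obtain Cs where Cs: "v = concat Cs" "map (\<lambda>C. int (length C)) Cs = ks" "\<forall>C\<in>set Cs. colw C"
    using Cons.IH[OF _ x(3)] Cons.prems(1) by auto
  have "colw u" using colw_comp[OF colw_col x(2)] Cons.prems(1) by simp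
  moreover have "int (length u) = k" using comp_length[OF x(2)] Cons.prems(1) by simp
  ultimately show ?case using x(1) Cs by (intro exI[of _ "u # Cs"]) simp
qed

lemma split_columns_flip:
  assumes "heights ks" "x \<in> component (map flip (cols ks))"
  shows "\<exists>Cs. x = concat Cs \<and> map (\<lambda>C. int (length C)) Cs = ks \<and> (\<forall>C\<in>set Cs. colw C)"
proof -
  have "map flip x \<in> component (cols ks)" using comp_flip[OF assms(2)] by (simp only: map_flip_flip)
  then obtain Cs where Cs: "map flip x = concat Cs" "map (\<lambda>C. int (length C)) Cs = ks" "\<forall>C\<in>set Cs. colw C"
    using split_columns[OF assms(1)] by blast
  have "x = map flip (concat Cs)" unfolding Cs(1)[symmetric] map_flip_flip ..
  then have "x = concat (map (map flip) Cs)" by (simp add: map_concat)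
  moreover have "map (\<lambda>C. int (length C)) (map (map flip) Cs) = ks" using Cs(2) by (simp add: comp_def)
  ultimately show ?thesis using Cs(3) colw_flip by (intro exI[of _ "map (map flip) Cs"]) auto
qed

lemma heights_sort:
  assumes "heights ks" shows "heights (sort ks)" "cong (cols ks) (cols (sort ks))"
proof -
  have "count_list ks k = count_list (sort ks) k" for k
    by (simp add: count_list_eq_length_filter filter_sort)
  then show "cong (cols ks) (cols (sort ks))" using cong_cols_perm[OF assms] by blast
  show "heights (sort ks)" using assms by (simp add: heights_def)
qed

lemma tableau_exists:
  assumes w: "lword n w"
  shows "\<exists>T. orth n T \<and> simD n (readingT T) w"
proof -
  obtain c where c: "canonical c" "cong (hwD n w) c"
    using hw_canonical[OF lword_comp[OF w hwD_comp[OF w]]] hwD_hw[OF w] unfolding hw_def by blast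
  obtain ks where ks: "heights ks" "c = cols ks \<or> c = map flip (cols ks)" using c(1) unfolding canonical_def by blast
  \<comment> \<open>A canonical word may have its columns in any order. A tabloid needs sorted
    heights, and the commutation of the columns allows sorting within the class.\<close>
  note hs = heights_sort[OF ks(1)]
  define d where "d = (if c = cols ks then cols (sort ks) else map flip (cols (sort ks)))"
  have "cong c d" using ks(2) hs(2) cong_flip[OF hs(2)] by (auto simp: d_def)
  then have "cong (hwD n w) d" using c(2) cong_trans by blast
  then obtain x where x: "x \<in> component d" "cong w x" using comp_transport[OF comp_sym[OF hwD_comp[OF w]]] by blast
  have dd: "d = cols (sort ks) \<or> d = map flip (cols (sort ks))" by (simp add: d_def)
  then obtain Cs where Cs: "x = concat Cs" "map (\<lambda>C. int (length C)) Cs = sort ks" "\<forall>C\<in>set Cs. colw C"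
    using split_columns[OF hs(1), of x] split_columns_flip[OF hs(1), of x] x(1) by blast
  define T where "T = rev Cs"
  have r: "readingT T = x" and sh: "shape T = sort ks" using Cs by (simp_all add: T_def readingT_def shape_def rev_map)
  have "sorted (map (\<lambda>C. int (length C)) Cs)" using Cs(2) by simp
  then have "sorted_wrt (\<lambda>C D. length D \<le> length C) T"
    by (simp add: T_def sorted_wrt_rev sorted_wrt_map)
  moreover have "C \<noteq> [] \<and> int (length C) \<le> n" if "C \<in> set T" for C
  proof -
    have "int (length C) \<in> set (sort ks)" using that Cs(2)[symmetric] by (auto simp: T_def)
    then show ?thesis using ks(1) by (auto simp: heights_def)
  qed
  ultimately have tab: "tabloid n T" using Cs(3) by (simp add: tabloid_def T_def is_col_iff)
  have "orth n T" using orth_iff[OF tab] r sh x(1) dd by auto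
  moreover have "simD n (readingT T) w"
    using cong_simD[OF tabloid_lword[OF tab] w] r cong_sym[OF x(2)] by simp
  ultimately show ?thesis by blast
qed

section \<open>From isomorphic components to congruence, and uniqueness of the tableau\<close>

lemma orth_hw:
  assumes "orth n T"
  obtains c where "heights (shape T)" "c = cols (shape T) \<or> c = map flip (cols (shape T))" "canonical c" "readingT T \<in> component c"
    "lword n (readingT T)" "lword n c" "hw c"
proof -
  have t: "tabloid n T" using assms by (simp add: orth_def)
  note h = tabloid_shape[OF t]
  obtain c where c: "c = cols (shape T) \<or> c = map flip (cols (shape T))" "readingT T \<in> component c"
    using orth_iff[OF t] assms by blast
  have can: "canonical c" using c(1) h unfolding canonical_def by blast
  have "lword n c" using lword_comp[OF tabloid_lword[OF t] comp_sym[OF c(2)]] .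
  then show thesis using that[OF _ c(1) can c(2) tabloid_lword[OF t]] h canonical_hw[OF can] by blast
qed

lemma phi_flip_cols:
  assumes "heights ks"
  shows "\<And>i. 1 \<le> i \<Longrightarrow> i < n - 1 \<Longrightarrow> phi n i (map flip (cols ks)) = count_list ks i"
    "phi n (n-1) (map flip (cols ks)) = 2 * count_list ks n + count_list ks (n-1)"
    "phi n n (map flip (cols ks)) = count_list ks (n-1)"
  using cols_phi[OF assms] n2 by (simp_all add: phi_flip flip_colour_def)

text \<open>For i < n-1 the value \<open>phi n i\<close> counts the columns of height i with or
  without flip. The values at n-1 and n detect the flip unless no column has height n, and then the
  flip changes nothing.\<close>

lemma canonical_phi_eq:
  assumes h: "heights ks" "heights ls"
    and c: "c = cols ks \<or> c = map flip (cols ks)" and d: "d = cols ls \<or> d = map flip (cols ls)"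
    and p: "\<And>i. 1 \<le> i \<Longrightarrow> i \<le> n \<Longrightarrow> phi n i c = phi n i d"
  shows "(\<forall>k. count_list ks k = count_list ls k) \<and>
    (c = cols ks \<and> d = cols ls \<or> c = map flip (cols ks) \<and> d = map flip (cols ls))"
proof -
  have out: "count_list ks k = 0" "count_list ls k = 0" if "\<not> (1 \<le> k \<and> k \<le> n)" for k
    using that h by (auto simp: heights_def count_list_0_iff)
  note P = cols_phi[OF h(1)] cols_phi[OF h(2)] phi_flip_cols[OF h(1)] phi_flip_cols[OF h(2)]
  have low: "count_list ks i = count_list ls i" if "1 \<le> i" "i < n - 1" for i
    using p[of i] c d P that by auto
  have pn: "phi n n c = phi n n d" "phi n (n-1) c = phi n (n-1) d" using p[of n] p[of "n-1"] n2 by simp_all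
  have zero: "map flip (cols ms) = cols ms" if "heights ms" "count_list ms n = 0" for ms
  proof (rule map_flip_cols, rule ballI)
    fix k assume "k \<in> set ms"
    moreover have "n \<notin> set ms" using that(2) by (simp add: count_list_0_iff)
    ultimately show "k < n" using that(1) by (auto simp: heights_def order_le_less)
  qed
  have "count_list ks n = count_list ls n \<and> count_list ks (n-1) = count_list ls (n-1) \<and>
    (c = cols ks \<and> d = cols ls \<or> c = map flip (cols ks) \<and> d = map flip (cols ls))"
    using c d
  proof (elim disjE)
    assume e: "c = cols ks" "d = cols ls"
    then show ?thesis using pn P n2 by auto
  next
    assume e: "c = map flip (cols ks)" "d = map flip (cols ls)"
    then show ?thesis using pn P n2 by auto
  next
    assume e: "c = cols ks" "d = map flip (cols ls)"
    \<comment> \<open>Adding the two equations leaves twice the number of columns of height n on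
      both sides equal to zero.\<close>
    then have "2 * count_list ks n + count_list ks (n-1) = count_list ls (n-1)"
      "count_list ks (n-1) = 2 * count_list ls n + count_list ls (n-1)" using pn P n2 by auto
    then have "count_list ks n = 0" "count_list ls n = 0" "count_list ks (n-1) = count_list ls (n-1)" by linarith+
    then show ?thesis using zero h e by simp
  next
    assume e: "c = map flip (cols ks)" "d = cols ls"
    then have "2 * count_list ls n + count_list ls (n-1) = count_list ks (n-1)"
      "count_list ls (n-1) = 2 * count_list ks n + count_list ks (n-1)" using pn P n2 by auto
    then have "count_list ks n = 0" "count_list ls n = 0" "count_list ks (n-1) = count_list ls (n-1)" by linarith+
    then show ?thesis using zero h e by simp
  qed
  moreover have "count_list ks k = count_list ls k" if "count_list ks n = count_list ls n" "count_list ks (n-1) = count_list ls (n-1)" for k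
  proof -
    consider "\<not> (1 \<le> k \<and> k \<le> n)" | "1 \<le> k" "k < n - 1" | "k = n - 1" | "k = n" by linarith
    then show ?thesis by cases (use out low that in simp_all)
  qed
  ultimately show ?thesis by blast
qed

text \<open>An isomorphism preserves \<open>phi\<close> and sends the highest weight vertex to the
  highest weight vertex. By \<open>canonical_phi_eq\<close> these two vertices are congruent, and
  the common path of lowering operators transports the congruence to u and v.\<close>

lemma simD_cong:
  assumes l: "lword n u" "lword n v" and s: "simD n u v"
  shows "cong u v"
proof -
  let ?h = "hwD n u" and ?k = "hwD n v"
  obtain g where bij: "bij_betw g (component u) (component v)"
    and g: "\<And>x y i. x \<in> component u \<Longrightarrow> y \<in> component u \<Longrightarrow> 1 \<le> i \<Longrightarrow> i \<le> n \<Longrightarrow> fw n i x = Some y \<longleftrightarrow> fw n i (g x) = Some (g y)"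
    using s unfolding simD_def comp_iso_def fD_eq by blast
  obtain "is" where p: "fpath n is ?h = Some u" "fpath n is ?k = Some v" using s unfolding simD_def by blast
  have gin: "g x \<in> component v" if "x \<in> component u" for x using bij that by (rule bij_betwE[rule_format])
  have gsur: "\<exists>x\<in>component u. g x = y" if "y \<in> component v" for y
    using that unfolding bij_betw_imp_surj_on[OF bij, symmetric] by blast
  \<comment> \<open>\<open>comp_iso\<close> compares only arrows between given vertices. That f is
    defined at x exactly when it is at g x needs in addition that components are closed under f and
    that g is onto.\<close>
  have f_comp: "(\<exists>y. fw n i x = Some y) \<longleftrightarrow> (\<exists>y. fw n i (g x) = Some y)"
    and f_g: "fw n i x = Some y \<Longrightarrow> fw n i (g x) = Some (g y)"
    if x: "x \<in> component u" and i: "1 \<le> i" "i \<le> n" for x y i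
  proof -
    show A: "fw n i x = Some y \<Longrightarrow> fw n i (g x) = Some (g y)" for y
      using g[OF x _ i] comp_fw comp_trans[OF x] by blast
    have "\<exists>y. fw n i x = Some y" if z: "fw n i (g x) = Some z" for z
    proof -
      have "z \<in> component v" using comp_fw[OF z] gin[OF x] comp_trans by blast
      then obtain y where "y \<in> component u" "g y = z" using gsur by blast
      then show ?thesis using g[OF x _ i] z by blast
    qed
    then show "(\<exists>y. fw n i x = Some y) \<longleftrightarrow> (\<exists>y. fw n i (g x) = Some y)" using A by blast
  qed
  have phi_g: "phi n i x = phi n i (g x)" if "x \<in> component u" "1 \<le> i" "i \<le> n" for x i
    using that(1)
  proof (induction "phi n i x" arbitrary: x)
    case 0
    then have "fw n i x = None" using fw_None_iff[of i x] by simp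
    then have "fw n i (g x) = None" using f_comp[OF 0(2) that(2,3)] by (cases "fw n i (g x)") auto
    then show ?case using 0 fw_None_iff[of i "g x"] by simp
  next
    case (Suc m)
    then obtain y where y: "fw n i x = Some y" using fw_None_iff[of i x] by (cases "fw n i x") auto
    have gy: "fw n i (g x) = Some (g y)" using f_g[OF Suc(3) that(2,3) y] .
    have "phi n i y = phi n i (g y)"
      using Suc(1)[of y] fw_SomeD[OF y] Suc(2) comp_fw[OF y] comp_trans[OF Suc(3)] by simp
    then show ?case using fw_SomeD[OF y] fw_SomeD[OF gy] by simp
  qed
  have hin: "?h \<in> component u" "hw ?h" using hwD_comp hwD_hw l by blast+
  have "hw (g ?h)"
    unfolding hw_def
  proof
    fix i
    show "eps n i (g ?h) = 0"
    proof (cases "1 \<le> i \<and> i \<le> n")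
      case True
      show ?thesis
      proof (rule ccontr)
        assume "eps n i (g ?h) \<noteq> 0"
        then obtain z where z: "ew n i (g ?h) = Some z" using ew_None_iff[of i "g ?h"] by (cases "ew n i (g ?h)") auto
        have "z \<in> component v" using comp_ew[OF z] gin[OF hin(1)] comp_trans by blast
        then obtain y where y: "y \<in> component u" "g y = z" using gsur by blast
        have "fw n i y = Some ?h" using g[OF y(1) hin(1)] True ew_SomeD[OF z] y(2) by blast
        then have "ew n i ?h = Some y" using fw_iff_ew by blast
        then show False using hin(2) ew_None_iff[of i ?h] unfolding hw_def by simp
      qed
    qed (rule colour_out)
  qed
  then have gh: "?k = g ?h" using hwD_eq[OF l(2) gin[OF hin(1)]] by blast
  have lh: "lword n ?h" "lword n ?k" using lword_comp l hwD_comp by blast+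
  obtain c where c: "canonical c" "cong ?h c" using hw_canonical[OF lh(1)] hin(2) unfolding hw_def by blast
  obtain d where d: "canonical d" "cong ?k d" using hw_canonical[OF lh(2)] hwD_hw[OF l(2)] unfolding hw_def by blast
  obtain ks where ks: "heights ks" "c = cols ks \<or> c = map flip (cols ks)" using c(1) unfolding canonical_def by blast
  obtain ls where ls: "heights ls" "d = cols ls \<or> d = map flip (cols ls)" using d(1) unfolding canonical_def by blast
  have "phi n i c = phi n i d" if "1 \<le> i" "i \<le> n" for i
    using phi_g[OF hin(1) that] gh cong_phi[OF c(2), of i] cong_phi[OF d(2), of i] by simp
  from canonical_phi_eq[OF ks(1) ls(1) ks(2) ls(2) this]
  have e: "\<forall>k. count_list ks k = count_list ls k" "c = cols ks \<and> d = cols ls \<or> c = map flip (cols ks) \<and> d = map flip (cols ls)"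
    by blast+
  have "cong (cols ks) (cols ls)" using cong_cols_perm[OF ks(1)] e(1) by blast
  then have "cong c d" using e(2) cong_flip by blast
  then have "cong ?h ?k" using c(2) cong_sym[OF d(2)] cong_trans by blast
  then obtain v' where "fpath n is ?k = Some v'" "cong u v'" using cong_fpath p(1) by blast
  then show ?thesis using p(2) by simp
qed

lemma count_list_sorted_eq:
  fixes xs ys :: "int list"
  assumes "sorted xs" "sorted ys" "\<And>k. count_list xs k = count_list ys k"
  shows "xs = ys"
  using assms
proof (induction xs arbitrary: ys)
  case Nil
  show ?case
  proof (cases ys)
    case (Cons a l) then show ?thesis using Nil.prems(3)[of a] by simp
  qed simp
next
  case (Cons x xs)
  have "count_list ys x \<noteq> 0" using Cons.prems(3)[of x] by simp
  then have xin: "x \<in> set ys" by (simp add: count_list_0_iff)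
  then obtain y ys' where ys: "ys = y # ys'" by (cases ys) auto
  have "count_list (x # xs) y \<noteq> 0" using Cons.prems(3)[of y] ys by simp
  then have "y \<in> set (x # xs)" unfolding count_list_0_iff by blast
  then have "x \<le> y" using Cons.prems(1) by auto
  moreover have "y \<le> x" using xin ys Cons.prems(2) by auto
  ultimately have "x = y" by simp
  moreover have "count_list xs k = count_list ys' k" for k
    using Cons.prems(3)[of k] ys \<open>x = y\<close> by (simp split: if_splits)
  then have "xs = ys'" using Cons.IH[of ys'] Cons.prems(1,2) ys by simp
  ultimately show ?case using ys by simp
qed

lemma concat_inj: "concat xs = concat ys \<Longrightarrow> map length xs = map length ys \<Longrightarrow> xs = ys"
proof (induction xs arbitrary: ys)
  case (Cons x xs)
  then obtain y ys' where "ys = y # ys'" "length x = length y" by (cases ys) auto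
  then show ?case using Cons by simp
qed simp

text \<open>The two highest weight words are congruent, so \<open>phi\<close> gives equal shapes,
  which are sorted, and the same choice of flip. Both readings then lie in one component, where
  congruent words are equal, and the heights determine how to cut the common word.\<close>

lemma orth_cong_eq:
  assumes o: "orth n T" "orth n T'" and c: "cong (readingT T) (readingT T')"
  shows "T = T'"
proof -
  obtain a where a: "heights (shape T)" "a = cols (shape T) \<or> a = map flip (cols (shape T))" "readingT T \<in> component a"
    "lword n (readingT T)" "lword n a" "hw a" using orth_hw[OF o(1)] by metis
  obtain b where b: "heights (shape T')" "b = cols (shape T') \<or> b = map flip (cols (shape T'))" "readingT T' \<in> component b"
    "lword n (readingT T')" "lword n b" "hw b" using orth_hw[OF o(2)] by metis
  have ha: "hwD n (readingT T) = a" using hwD_eq[OF a(4) comp_sym[OF a(3)] a(6)] .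
  have hb: "hwD n (readingT T') = b" using hwD_eq[OF b(4) comp_sym[OF b(3)] b(6)] .
  have "cong a b" using hwD_cong[OF a(4) b(4) c] ha hb by simp
  then have "phi n i a = phi n i b" for i by (rule cong_phi)
  from canonical_phi_eq[OF a(1) b(1) a(2) b(2) this]
  have e: "\<forall>k. count_list (shape T) k = count_list (shape T') k"
    "a = cols (shape T) \<and> b = cols (shape T') \<or> a = map flip (cols (shape T)) \<and> b = map flip (cols (shape T'))" by blast+
  have "sorted (shape T)" "sorted (shape T')" using o tabloid_shape by (auto simp: orth_def)
  then have sh: "shape T = shape T'" using count_list_sorted_eq e(1) by blast
  then have "a = b" using e(2) by auto
  then have "readingT T' \<in> component (readingT T)" using a(3) b(3) comp_sym comp_trans by blast
  then have "readingT T = readingT T'" using cong_comp_eq[OF a(4) _ c] by blast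
  then have "concat (rev T) = concat (rev T')" by (simp add: readingT_def)
  moreover have "map length (rev T) = map length (rev T')"
  proof -
    have "map (\<lambda>C. int (length C)) T = map (\<lambda>C. int (length C)) T'" using sh by (simp add: shape_def)
    then have "map nat (map (\<lambda>C. int (length C)) T) = map nat (map (\<lambda>C. int (length C)) T')" by simp
    then have "map length T = map length T'" by (simp add: comp_def)
    then show ?thesis by (simp add: rev_map[symmetric])
  qed
  ultimately have "rev T = rev T'" by (rule concat_inj)
  then show ?thesis by simp
qed

lemma orth_lword: "orth n T \<Longrightarrow> lword n (readingT T)"
  using tabloid_lword by (simp add: orth_def)

lemma unique_tableau:
  assumes w: "lword n w"
  shows "\<exists>!T. orth n T \<and> simD n (readingT T) w"
proof (rule ex_ex1I)
  show "\<exists>T. orth n T \<and> simD n (readingT T) w" using tableau_exists[OF w] .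
  fix T T' assume t: "orth n T \<and> simD n (readingT T) w" "orth n T' \<and> simD n (readingT T') w"
  then have "cong (readingT T) w" "cong (readingT T') w" using simD_cong orth_lword w by blast+
  then have "cong (readingT T) (readingT T')" using cong_sym cong_trans by blast
  then show "T = T'" using orth_cong_eq t by blast
qed

lemma PD_spec: "lword n w \<Longrightarrow> orth n (PD n w) \<and> simD n (readingT (PD n w)) w"
  unfolding PD_def by (rule theI'[OF unique_tableau])

lemma PD_cong: "lword n w \<Longrightarrow> cong (readingT (PD n w)) w"
  using PD_spec simD_cong orth_lword by blast

lemma PD_eq_iff:
  assumes l: "lword n u" "lword n v"
  shows "PD n u = PD n v \<longleftrightarrow> cong u v"
proof
  assume "PD n u = PD n v"
  then show "cong u v" using PD_cong[OF l(1)] PD_cong[OF l(2)] cong_sym cong_trans by metis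
next
  assume "cong u v"
  then have "cong (readingT (PD n u)) (readingT (PD n v))"
    using PD_cong[OF l(1)] PD_cong[OF l(2)] cong_sym cong_trans by blast
  then show "PD n u = PD n v" using orth_cong_eq PD_spec l by blast
qed

end

theorem mainTheorem9:
  fixes n :: int
  assumes "n \<ge> 2"
  shows "(\<forall>w. lword n w \<longrightarrow> (\<exists>!T. orth n T \<and> simD n (readingT T) w)) \<and>
         (\<forall>w1 w2. lword n w1 \<and> lword n w2 \<longrightarrow>
            (simD n w1 w2 \<longleftrightarrow> congD n w1 w2) \<and> (congD n w1 w2 \<longleftrightarrow> PD n w1 = PD n w2))"
proof -
  interpret D_crystal n by unfold_locales (rule assms)
  show ?thesis using unique_tableau simD_cong cong_simD PD_eq_iff by blast
qed

end
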